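(* Let $\mu$ be the Ising model on $\Omega=\{\pm1\}^n$ with zero external field and symmetric interaction matrix $J\in\mathbb{R}^{n\times n}$, i.e. $\mu(x)\propto\exp(\frac12x^\top Jx)$, satisfying $\||J|\|_2<1$ and $\|J\|_1\le C$ for some constant $C>0$. Use the canonical transition rates $q_i^\star(x)=\frac12\sqrt{\mu(x^i)/\mu(x)}$ and weights $w_i^\star(x)=\sqrt{\mu(x^i)/\mu(x)}$. Then there are constants $c>0$, $b\in(0,1]$ and $\rho\in\mathbb{R}$, depending only on $\||J|\|_2$ and $C$, such that: (1) (Local Bobkov) for all $f:\Omega\to[0,1]$ and $t\ge0$, pointwise on $\Omega$, $\ \mathcal I(P_tf)\le P_t\left(\sqrt{\mathcal I(f)^2+\gamma(t)\Gamma^\star(f)}\right)$, where $\gamma(t)=\frac{2(1-e^{-2\rho t})}{b\rho}$ if $\rho\ne0$ and $\gamma(t)=\frac{4t}{b}$ if $\rho=0$; (2) (Talagrand's variance–surface-area) for all $f:\Omega\to\{0,1\}$, $\ A^\star(f)\ge c\,\mathrm{Var}_\mu(f)\sqrt{\log\frac{e}{\mathrm{Var}_\mu(f)}}$; (3) (Talagrand's $L^1$–$L^2$) for all $f:\Omega\to\mathbb{R}$, $\displaystyle\ c\,\mathrm{Var}_\mu(f)\le\sum_{i=1}^n\frac{I_i^\star(f)}{1+\log\left(\sqrt{I_i^\star(f)}/\mathbb{E}_\mu[|\delta_i^\star f|]\right)}$; (4) (KKL) for all $f:\Omega\to\{\pm1\}$, $\ I^\star(f)\ge c\log(1/\mathcal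 M^\star(f))\,\mathrm{Var}_\mu(f)$, where $\mathcal M^\star(f)=\max_{i\in[n]}I_i^\star(f)$; (5) (Eldan–Gross) for all $f:\Omega\to\{\pm1\}$, $\ A^\star(f)\ge c\,\mathrm{Var}_\mu(f)\sqrt{\log\left(1+\frac{e}{J^\star(f)}\right)}$.
   Context: Notation: $x^i$ is $x\in\Omega$ with its $i$-th coordinate flipped; $[n]=\{1,\dots,n\}$; $\log$ is natural; $|J|=(|J_{ij}|)_{i,j}$ is the entrywise absolute value; $\|\cdot\|_2$ is the spectral norm and $\|\cdot\|_1$ the maximum absolute column sum. The semigroup is $P_t=e^{tL}$ with $Lf(x)=\sum_{i=1}^nq_i^\star(x)(f(x^i)-f(x))$. $\delta_i^\star f(x)=q_i^\star(x)(f(x^i)-f(x))$; $\Gamma^\star(f)=\sum_{i=1}^n(\delta_i^\star f)^2$; $I_i^\star(f)=\mathbb{E}_\mu[(\delta_i^\star f)^2]$; $I^\star(f)=\sum_iI_i^\star(f)$; $A^\star(f)=\mathbb{E}_\mu[\sqrt{\Gamma^\star(f)}]$; $J^\star(f)=\sum_{i=1}^n(\mathbb{E}_\mu[|\delta_i^\star f|])^2$ (unrelated to the interaction matrix $J$). $\mathcal I:[0,1]\to\mathbb{R}_+$ is the Gaussian isoperimetric profile $\mathcal I(x)=\varphi(\Phi^{-1}(x))$ ($\mathcal I(0)=\mathcal I(1)=0$), with $\varphi,\Phi$ the standard Gaussian density and distribution function. Conventions: a summand with $I_i^\star(f)=0$ is $0$; right-hand sides containing the factor $\mathrm{Var}_\mu(f)$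 are $0$ if $\mathrm{Var}_\mu(f)=0$. *)

theory Defs
  imports "HOL-Probability.Probability"
begin

text \<open>
  Vectors in \<open>\<real>\<^sup>n\<close> and \<open>n \<times> n\<close> matrices are functions on indices of which only the values on
  \<open>{1..n}\<close> matter, so that \<open>n\<close> can be quantified inside a statement.
\<close>

definition symmetric_mat :: "nat \<Rightarrow> (nat \<Rightarrow> nat \<Rightarrow> real) \<Rightarrow> bool" where
  "symmetric_mat n A \<longleftrightarrow> (\<forall>i\<in>{1..n}. \<forall>j\<in>{1..n}. A i j = A j i)"

definition spectral_norm :: "nat \<Rightarrow> (nat \<Rightarrow> nat \<Rightarrow> real) \<Rightarrow> real" where
  "spectral_norm n A =
     (SUP v\<in>{v. L2_set v {1..n} = 1}. L2_set (\<lambda>i. \<Sum>j\<in>{1..n}. A i j * v j) {1..n})"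

definition max_col_sum_norm :: "nat \<Rightarrow> (nat \<Rightarrow> nat \<Rightarrow> real) \<Rightarrow> real" where
  "max_col_sum_norm n A = Max ((\<lambda>j. \<Sum>i\<in>{1..n}. \<bar>A i j\<bar>) ` {1..n})"

text \<open>Configurations are extensional, so \<open>cube n\<close> has exactly \<open>2\<^sup>n\<close> elements.\<close>

definition cube :: "nat \<Rightarrow> (nat \<Rightarrow> real) set" where
  "cube n = {1..n} \<rightarrow>\<^sub>E {-1, 1}"

definition flip :: "nat \<Rightarrow> (nat \<Rightarrow> real) \<Rightarrow> (nat \<Rightarrow> real)" where
  "flip i x = x(i := - x i)"

definition ising_weight :: "nat \<Rightarrow> (nat \<Rightarrow> nat \<Rightarrow> real) \<Rightarrow> (nat \<Rightarrow> real) \<Rightarrow> real" where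
  "ising_weight n J x = exp (1/2 * (\<Sum>i\<in>{1..n}. \<Sum>j\<in>{1..n}. x i * J i j * x j))"

definition ising :: "nat \<Rightarrow> (nat \<Rightarrow> nat \<Rightarrow> real) \<Rightarrow> (nat \<Rightarrow> real) pmf" where
  "ising n J = embed_pmf (\<lambda>x. if x \<in> cube n
     then ising_weight n J x / (\<Sum>y\<in>cube n. ising_weight n J y) else 0)"

lemma finite_cube [simp]: "finite (cube n)"
  by (auto simp: cube_def intro!: finite_PiE)

lemma cube_nonempty [simp]: "cube n \<noteq> {}"
  by (auto simp: cube_def PiE_eq_empty_iff)

lemma flip_in_cube: "x \<in> cube n \<Longrightarrow> i \<in> {1..n} \<Longrightarrow> flip i x \<in> cube n"
  by (fastforce simp: cube_def flip_def PiE_iff extensional_def)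

lemma pmf_ising:
  "pmf (ising n J) x =
     (if x \<in> cube n then ising_weight n J x / (\<Sum>y\<in>cube n. ising_weight n J y) else 0)"
proof -
  define Z where "Z = (\<Sum>y\<in>cube n. ising_weight n J y)"
  have pos: "ising_weight n J y > 0" for y
    by (simp add: ising_weight_def)
  have Z: "Z > 0"
    unfolding Z_def by (intro sum_pos) (auto simp: pos)
  define p where "p = (\<lambda>x. if x \<in> cube n then ising_weight n J x / Z else 0)"
  have nonneg: "0 \<le> p y" for y
    using Z pos[of y] by (auto simp: p_def)
  have supp: "{y. ennreal (p y) \<noteq> 0} \<subseteq> cube n"
    by (auto simp: p_def)
  have "(\<integral>\<^sup>+y. ennreal (p y) \<partial>count_space UNIV) = (\<Sum>y\<in>cube n. ennreal (p y))"
    by (rule nn_integral_count_space') (auto simp: p_def)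
  also have "\<dots> = ennreal (\<Sum>y\<in>cube n. p y)"
    by (simp add: nonneg sum_ennreal)
  also have "(\<Sum>y\<in>cube n. p y) = (\<Sum>y\<in>cube n. ising_weight n J y) / Z"
    by (simp add: p_def sum_divide_distrib)
  also have "\<dots> = 1"
    using Z by (simp add: Z_def)
  finally have "pmf (embed_pmf p) x = p x"
    by (intro pmf_embed_pmf nonneg) simp
  then show ?thesis
    unfolding ising_def p_def Z_def .
qed

definition rate_star :: "nat \<Rightarrow> (nat \<Rightarrow> nat \<Rightarrow> real) \<Rightarrow> nat \<Rightarrow> (nat \<Rightarrow> real) \<Rightarrow> real" where
  "rate_star n J i x = 1/2 * sqrt (pmf (ising n J) (flip i x) / pmf (ising n J) x)"

definition delta_star ::
  "nat \<Rightarrow> (nat \<Rightarrow> nat \<Rightarrow> real) \<Rightarrow> nat \<Rightarrow> ((nat \<Rightarrow> real) \<Rightarrow> real) \<Rightarrow> (nat \<Rightarrow> real) \<Rightarrow> real" where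
  "delta_star n J i f x = rate_star n J i x * (f (flip i x) - f x)"

definition generator ::
  "nat \<Rightarrow> (nat \<Rightarrow> nat \<Rightarrow> real) \<Rightarrow> ((nat \<Rightarrow> real) \<Rightarrow> real) \<Rightarrow> (nat \<Rightarrow> real) \<Rightarrow> real" where
  "generator n J f x = (\<Sum>i\<in>{1..n}. rate_star n J i x * (f (flip i x) - f x))"

text \<open>
  \<open>e\<^sup>t\<^sup>L\<close> as a power series in the operator \<open>L\<close>, evaluated pointwise; the series converges at every
  configuration because the space of functions on the cube is finite-dimensional.
\<close>

definition semigroup_P ::
  "nat \<Rightarrow> (nat \<Rightarrow> nat \<Rightarrow> real) \<Rightarrow> real \<Rightarrow> ((nat \<Rightarrow> real) \<Rightarrow> real) \<Rightarrow> (nat \<Rightarrow> real) \<Rightarrow> real" where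
  "semigroup_P n J t f x = (\<Sum>k. t ^ k / fact k * (generator n J ^^ k) f x)"

lemma summable_semigroup_P:
  assumes "x \<in> cube n"
  shows "summable (\<lambda>k. t ^ k / fact k * (generator n J ^^ k) f x)"
proof -
  define q where "q = (\<Sum>i\<in>{1..n}. \<Sum>y\<in>cube n. rate_star n J i y)"
  define M where "M = (\<Sum>y\<in>cube n. \<bar>f y\<bar>)"
  have rate_nonneg: "0 \<le> rate_star n J i y" for i y
    by (simp add: rate_star_def)
  have rate_le: "(\<Sum>i\<in>{1..n}. rate_star n J i y) \<le> q" if "y \<in> cube n" for y
    unfolding q_def
    by (intro sum_mono member_le_sum) (use that rate_nonneg in auto)
  have bound: "\<bar>(generator n J ^^ k) f y\<bar> \<le> (2 * q) ^ k * M" if "y \<in> cube n" for k y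
    using that
  proof (induction k arbitrary: y)
    case 0
    then show ?case
      by (auto simp: M_def intro!: member_le_sum[where f = "\<lambda>z. \<bar>f z\<bar>"])
  next
    case (Suc k)
    let ?g = "(generator n J ^^ k) f"
    let ?B = "(2 * q) ^ k * M"
    have B: "0 \<le> ?B"
      using Suc.IH[OF Suc.prems] by linarith
    have "\<bar>generator n J ?g y\<bar> \<le>
        (\<Sum>i\<in>{1..n}. \<bar>rate_star n J i y * (?g (flip i y) - ?g y)\<bar>)"
      unfolding generator_def by (rule sum_abs)
    also have "\<dots> \<le> (\<Sum>i\<in>{1..n}. rate_star n J i y * (2 * ?B))"
    proof (rule sum_mono)
      fix i assume "i \<in> {1..n}"
      then have "\<bar>?g (flip i y)\<bar> \<le> ?B" "\<bar>?g y\<bar> \<le> ?B"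
        using Suc.IH Suc.prems flip_in_cube by blast+
      then have "\<bar>?g (flip i y) - ?g y\<bar> \<le> 2 * ?B"
        by linarith
      then show "\<bar>rate_star n J i y * (?g (flip i y) - ?g y)\<bar> \<le> rate_star n J i y * (2 * ?B)"
        by (simp only: abs_mult abs_of_nonneg[OF rate_nonneg])
           (rule mult_left_mono[OF _ rate_nonneg])
    qed
    also have "\<dots> = (\<Sum>i\<in>{1..n}. rate_star n J i y) * (2 * ?B)"
      by (simp only: sum_distrib_right)
    also have "\<dots> \<le> q * (2 * ?B)"
      by (rule mult_right_mono[OF rate_le[OF Suc.prems]]) (use B in linarith)
    finally show ?case
      by (simp add: mult_ac)
  qed
  have "summable (\<lambda>k. (inverse (fact k) * (\<bar>t\<bar> * (2 * q)) ^ k) * M)"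
    by (intro summable_mult2 summable_exp)
  then show ?thesis
  proof (rule summable_comparison_test')
    fix k
    have "norm (t ^ k / fact k * (generator n J ^^ k) f x) =
        \<bar>t\<bar> ^ k / fact k * \<bar>(generator n J ^^ k) f x\<bar>"
      by (simp add: abs_mult power_abs)
    also have "\<dots> \<le> \<bar>t\<bar> ^ k / fact k * ((2 * q) ^ k * M)"
      by (intro mult_left_mono bound assms) simp
    finally show "norm (t ^ k / fact k * (generator n J ^^ k) f x) \<le>
        (inverse (fact k) * (\<bar>t\<bar> * (2 * q)) ^ k) * M"
      by (simp add: power_mult_distrib field_simps)
  qed
qed

definition Gamma_star ::
  "nat \<Rightarrow> (nat \<Rightarrow> nat \<Rightarrow> real) \<Rightarrow> ((nat \<Rightarrow> real) \<Rightarrow> real) \<Rightarrow> (nat \<Rightarrow> real) \<Rightarrow> real" where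
  "Gamma_star n J f x = (\<Sum>i\<in>{1..n}. (delta_star n J i f x)\<^sup>2)"

definition L1_influence ::
  "nat \<Rightarrow> (nat \<Rightarrow> nat \<Rightarrow> real) \<Rightarrow> nat \<Rightarrow> ((nat \<Rightarrow> real) \<Rightarrow> real) \<Rightarrow> real" where
  "L1_influence n J i f = measure_pmf.expectation (ising n J) (\<lambda>x. \<bar>delta_star n J i f x\<bar>)"

definition I_star ::
  "nat \<Rightarrow> (nat \<Rightarrow> nat \<Rightarrow> real) \<Rightarrow> nat \<Rightarrow> ((nat \<Rightarrow> real) \<Rightarrow> real) \<Rightarrow> real" where
  "I_star n J i f = measure_pmf.expectation (ising n J) (\<lambda>x. (delta_star n J i f x)\<^sup>2)"

definition total_I_star :: "nat \<Rightarrow> (nat \<Rightarrow> nat \<Rightarrow> real) \<Rightarrow> ((nat \<Rightarrow> real) \<Rightarrow> real) \<Rightarrow> real" where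
  "total_I_star n J f = (\<Sum>i\<in>{1..n}. I_star n J i f)"

definition M_star :: "nat \<Rightarrow> (nat \<Rightarrow> nat \<Rightarrow> real) \<Rightarrow> ((nat \<Rightarrow> real) \<Rightarrow> real) \<Rightarrow> real" where
  "M_star n J f = Max ((\<lambda>i. I_star n J i f) ` {1..n})"

definition A_star :: "nat \<Rightarrow> (nat \<Rightarrow> nat \<Rightarrow> real) \<Rightarrow> ((nat \<Rightarrow> real) \<Rightarrow> real) \<Rightarrow> real" where
  "A_star n J f = measure_pmf.expectation (ising n J) (\<lambda>x. sqrt (Gamma_star n J f x))"

definition J_star :: "nat \<Rightarrow> (nat \<Rightarrow> nat \<Rightarrow> real) \<Rightarrow> ((nat \<Rightarrow> real) \<Rightarrow> real) \<Rightarrow> real" where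
  "J_star n J f = (\<Sum>i\<in>{1..n}. (L1_influence n J i f)\<^sup>2)"

definition Var_ising :: "nat \<Rightarrow> (nat \<Rightarrow> nat \<Rightarrow> real) \<Rightarrow> ((nat \<Rightarrow> real) \<Rightarrow> real) \<Rightarrow> real" where
  "Var_ising n J f = measure_pmf.variance (ising n J) f"

text \<open>The Gaussian isoperimetric profile; \<open>inv\<close> is only applied on \<open>(0,1)\<close>, the range of \<open>\<Phi>\<close>.\<close>

definition gauss_profile :: "real \<Rightarrow> real" where
  "gauss_profile p = (if 0 < p \<and> p < 1
     then std_normal_density (inv (cdf std_normal_distribution) p) else 0)"

definition bobkov_gamma :: "real \<Rightarrow> real \<Rightarrow> real \<Rightarrow> real" where
  "bobkov_gamma b \<rho> t =
     (if \<rho> = 0 then 4 * t / b else 2 * (1 - exp (- 2 * \<rho> * t)) / (b * \<rho>))"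

end

theory Submission
  imports Defs
begin

text \<open>
  All five inequalities come from three facts about the reversible semigroup with the canonical
  rates \<open>q\<^sub>i(x) = exp (- x\<^sub>i h\<^sub>i(x)) / 2\<close>, where \<open>h\<^sub>i\<close> is the local field. Write \<open>v\<^sub>i = \<delta>\<^sub>i P\<^sub>t f\<close>.

  Gradients obey a closed system. For these rates the ratio \<open>q\<^sub>j(x\<^sup>i) / q\<^sub>j(x) = exp (2 x\<^sub>i x\<^sub>j J\<^sub>i\<^sub>j)\<close> is
  symmetric in \<open>i, j\<close>, and therefore \<open>v' = L v + V v\<close> with a zeroth-order matrix \<open>V\<close> whose row sums
  are bounded in terms of the column sums of \<open>J\<close> (\<open>\<delta>_generator\<close>). A minimum principle for finite
  systems of differential inequalities turns this into two pointwise statements. First, the function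
  \<open>sqrt (I(P\<^sub>\<tau> f)\<^sup>2 + \<gamma>(t - \<tau>) \<Gamma>(P\<^sub>\<tau> f))\<close> is a subsolution of the heat equation, which is the local Bobkov
  inequality with a negative \<open>\<rho>\<close> (\<open>local_bobkov\<close>); the identity \<open>I I'' = -1\<close> is replaced by a bound for
  the Bregman divergence of the Gaussian profile \<open>I\<close> (\<open>gauss_profile_bregman\<close>), and the price for the
  jumps is absorbed by \<open>b\<close>. Second, \<open>\<bar>v\<^sub>i\<bar>\<close> is at most \<open>exp (3 \<kappa> t)\<close> times a fixed nonnegative matrix,
  bounded on Euclidean space, applied to the vector of the \<open>P\<^sub>t \<bar>\<delta>\<^sub>j f\<bar>\<close> (\<open>gradient_comparison\<close>).

  A log-Sobolev inequality holds because the spectral norm of \<open>\<bar>J\<bar>\<close> is below \<open>1\<close>. By the chain rule,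
  averaged over the choice of the spin whose marginal is split off, it is enough to control, for each set \<open>S\<close>
  of free spins, the sum over \<open>i \<in> S\<close> of the entropies of the one-spin marginals. These are dominated
  by squared covariances with the spins, and the heat-bath chain contracts oscillation vectors by a
  factor \<open>1 - (1 - s) / \<bar>S\<bar>\<close> in Euclidean norm, so the covariances sum up to at most \<open>(1 - s)\<^sup>-\<^sup>2\<close> times
  single-site quantities (\<open>dobrushin_covariance_bound\<close>, \<open>log_sobolev_conditional\<close>). The same
  argument gives the Poincare inequality.

  For \<open>g \<ge> 0\<close> the mean of \<open>P\<^sub>t g\<close> is conserved while the entropy of \<open>(P\<^sub>t g)\<^sup>2\<close> bounds its dissipation, so
  the log-Sobolev inequality gives a closed differential inequality for the second moment \<open>N(t)\<close>, and
  \<open>ln (N(t) / (E g)\<^sup>2)\<close> decays exponentially (\<open>nash\<close>). This replaces hypercontractivity.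

  The remaining inequalities follow. For (3), the variance is controlled by the dissipation up to time
  \<open>1\<close>, hence by the integrals of the second moments of \<open>P\<^sub>t \<bar>\<delta>\<^sub>j f\<bar>\<close>, and \<open>nash\<close> makes the \<open>j\<close>-th one
  decay at a rate proportional to the logarithm in the denominator. (4) is (3) for functions whose
  gradients either vanish or are of order \<open>1\<close>. For (2) and (5), the local Bobkov inequality for
  indicators says that the variance lost up to time \<open>t\<close> is at most a constant times \<open>sqrt t\<close> times the
  surface area. By log-convexity of \<open>t \<mapsto> Var (P\<^sub>t f)\<close>, if \<open>Var (P\<^sub>1 f) \<le> exp (- X) Var f\<close> then half of the
  variance is lost already at a time of order \<open>1 / X\<close>, so the surface area is at least a constant times
  \<open>sqrt X Var f\<close> (\<open>surface_ge_log_decay\<close>). The inequality \<open>nash\<close> supplies \<open>X\<close> of order \<open>ln (1 / Var f)\<close> when it is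
  applied to \<open>\<bar>f - E f\<bar>\<close>, and of order \<open>ln (Var f / J\<^sup>*(f))\<close> when it is applied to the gradients.
\<close>

section \<open>The Gaussian isoperimetric profile\<close>

abbreviation gauss_pdf :: "real \<Rightarrow> real" where
  "gauss_pdf \<equiv> std_normal_density"

abbreviation gauss_cdf :: "real \<Rightarrow> real" where
  "gauss_cdf \<equiv> cdf std_normal_distribution"

lemma gauss_pdf_deriv: "(gauss_pdf has_real_derivative - x * gauss_pdf x) (at x)"
  unfolding std_normal_density_def[abs_def]
  by (auto intro!: derivative_eq_intros simp: field_simps)

lemma gauss_pdf_pos: "gauss_pdf x > 0"
  by (rule normal_density_pos) simp

lemma gauss_pdf_even: "gauss_pdf (- x) = gauss_pdf x"
  by (simp add: std_normal_density_def)

lemma gauss_pdf_mult_exp: "gauss_pdf x * exp (x\<^sup>2 / 2) = 1 / sqrt (2 * pi)"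
  by (simp add: std_normal_density_def exp_minus field_simps)

text \<open>
  A crude polynomial bound, from \<open>exp u \<ge> 1 + u\<close> and \<open>sqrt (2 \<pi>) \<ge> 5/2\<close>. It gives the limits at
  infinity and \<open>2 \<bar>x\<bar> \<phi>(x) \<le> 1\<close>.
\<close>
lemma gauss_pdf_le: "gauss_pdf x \<le> 2 / (5 + x\<^sup>2)"
proof -
  have s: "sqrt (2 * pi) \<ge> 5 / 2"
    by (rule real_le_rsqrt) (use pi_approx in \<open>simp add: power2_eq_square\<close>)
  have "5 / 2 + x\<^sup>2 / 2 \<le> (5 / 2) * exp (x\<^sup>2 / 2)"
    using exp_ge_add_one_self[of "x\<^sup>2 / 2"] zero_le_power2[of x] by linarith
  also have "\<dots> \<le> sqrt (2 * pi) * exp (x\<^sup>2 / 2)"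
    using s by simp
  finally have "(5 + x\<^sup>2) / 2 * gauss_pdf x \<le> (sqrt (2 * pi) * exp (x\<^sup>2 / 2)) * gauss_pdf x"
    using gauss_pdf_pos[of x] by (intro mult_right_mono) auto
  also have "\<dots> = 1"
  proof -
    have "sqrt (2 * pi) * (gauss_pdf x * exp (x\<^sup>2 / 2)) = 1"
      unfolding gauss_pdf_mult_exp by simp
    then show ?thesis by (simp only: mult_ac)
  qed
  finally show ?thesis
    by (simp add: field_simps add_pos_nonneg)
qed

text \<open>
  On a half-line \<open>(a, \<infinity>)\<close> the distribution function is a constant plus the integral of the density
  from \<open>a\<close>, so the fundamental theorem of calculus applies.
\<close>
lemma gauss_cdf_deriv: "(gauss_cdf has_real_derivative gauss_pdf x) (at x)"
proof -
  interpret real_distribution std_normal_distribution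
    by (rule real_dist_normal_dist)
  define a where "a = x - 1"
  have cont: "continuous_on S gauss_pdf" for S
    by (intro continuous_at_imp_continuous_on ballI DERIV_isCont[OF gauss_pdf_deriv])
  have eq: "gauss_cdf y = gauss_cdf a + integral {a..y} gauss_pdf" if "y > a" for y
  proof -
    have int: "set_integrable lborel {a..y} gauss_pdf"
      by (intro borel_integrable_atLeastAtMost') (rule cont)
    have "gauss_cdf y - gauss_cdf a = measure std_normal_distribution {a<..y}"
      using cdf_diff_eq[OF that] .
    also have "\<dots> = enn2real (\<integral>\<^sup>+z. ennreal (indicator {a..y} z * gauss_pdf z) \<partial>lborel)"
    proof -
      have "emeasure std_normal_distribution {a<..y} =
          (\<integral>\<^sup>+z. ennreal (gauss_pdf z) * indicator {a<..y} z \<partial>lborel)"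
        by (rule emeasure_density) auto
      also have "\<dots> = (\<integral>\<^sup>+z. ennreal (indicator {a..y} z * gauss_pdf z) \<partial>lborel)"
        by (rule nn_integral_cong_AE)
           (use AE_lborel_singleton[of a] in eventually_elim, auto simp: indicator_def)
      finally show ?thesis by (simp add: measure_def)
    qed
    also have "\<dots> = (LINT z:{a..y}|lborel. gauss_pdf z)"
      unfolding set_lebesgue_integral_def
      by (subst integral_eq_nn_integral) (auto intro!: borel_measurable_times)
    also have "\<dots> = integral {a..y} gauss_pdf"
      using set_borel_integral_eq_integral[OF int] by simp
    finally show ?thesis by simp
  qed
  have "((\<lambda>y. integral {a..y} gauss_pdf) has_real_derivative gauss_pdf x) (at x within {a..x+1})"
    by (rule integral_has_real_derivative[OF cont]) (auto simp: a_def)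
  then have "((\<lambda>y. integral {a..y} gauss_pdf) has_real_derivative gauss_pdf x) (at x)"
    by (simp add: at_within_Icc_at a_def)
  then have "((\<lambda>y. gauss_cdf a + integral {a..y} gauss_pdf) has_real_derivative gauss_pdf x) (at x)"
    by (auto intro!: derivative_eq_intros)
  then show ?thesis
    by (rule has_field_derivative_transform_within[where d = 1])
       (use eq in \<open>auto simp: a_def dist_real_def\<close>)
qed

lemma gauss_cdf_lims:
  "(gauss_cdf \<longlongrightarrow> 0) at_bot" "(gauss_cdf \<longlongrightarrow> 1) at_top"
proof -
  interpret real_distribution std_normal_distribution
    by (rule real_dist_normal_dist)
  show "(gauss_cdf \<longlongrightarrow> 0) at_bot" "(gauss_cdf \<longlongrightarrow> 1) at_top"
    by (rule cdf_lim_at_bot cdf_lim_at_top_prob)+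
qed

lemma gauss_cdf_strict_mono: "x < y \<Longrightarrow> gauss_cdf x < gauss_cdf y"
  by (rule DERIV_pos_imp_increasing) (auto intro!: exI[of _ "gauss_pdf _"] gauss_cdf_deriv gauss_pdf_pos)

lemma gauss_cdf_inj: "inj gauss_cdf"
  by (rule linorder_injI) (use gauss_cdf_strict_mono in force)

lemma gauss_cdf_isCont: "isCont gauss_cdf x"
  by (rule DERIV_isCont[OF gauss_cdf_deriv])

text \<open>
  The sum \<open>\<Phi>(x) + \<Phi>(- x)\<close> has derivative \<open>0\<close> and tends to \<open>1\<close>.
\<close>
lemma gauss_cdf_refl: "gauss_cdf (- x) = 1 - gauss_cdf x"
proof -
  define h where "h = (\<lambda>x. gauss_cdf x + gauss_cdf (- x))"
  have "(h has_real_derivative 0) (at x)" for x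
    unfolding h_def
    by (auto intro!: derivative_eq_intros DERIV_chain2[OF gauss_cdf_deriv] gauss_cdf_deriv
             simp: gauss_pdf_even)
  then have const: "h y = h 0" for y
    using DERIV_isconst_all by blast
  have "((\<lambda>x. gauss_cdf x + gauss_cdf (- x)) \<longlongrightarrow> 1 + 0) at_top"
    by (intro tendsto_add gauss_cdf_lims filterlim_compose[OF gauss_cdf_lims(1)])
       (rule filterlim_uminus_at_bot_at_top)
  moreover have "(\<lambda>x. gauss_cdf x + gauss_cdf (- x)) = (\<lambda>_. h 0)"
    using const by (simp add: h_def fun_eq_iff)
  ultimately have "h 0 = 1"
    by (simp add: tendsto_const_iff)
  then show ?thesis
    using const[of x] by (simp add: h_def)
qed

text \<open>
  The Gaussian tail estimates below are all reduced to the sign of a derivative by this principle.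
\<close>
lemma nonneg_if_decreasing_to_zero:
  fixes g :: "real \<Rightarrow> real"
  assumes "\<And>y. y \<ge> x \<Longrightarrow> (g has_real_derivative g' y) (at y)" "\<And>y. y \<ge> x \<Longrightarrow> g' y \<le> 0"
    and "(g \<longlongrightarrow> 0) at_top"
  shows "g x \<ge> 0"
proof -
  have "g y \<le> g x" if "y \<ge> x" for y
    using DERIV_nonpos_imp_nonincreasing[OF that] assms(1,2) by blast
  then show ?thesis
    by (intro tendsto_upperbound[OF assms(3)]) (auto simp: eventually_at_top_linorder)
qed

lemma gauss_pdf_lims: "(gauss_pdf \<longlongrightarrow> 0) at_top" "((\<lambda>x. x * gauss_pdf x) \<longlongrightarrow> 0) at_top"
proof -
  have sq: "filterlim (\<lambda>x::real. 5 + x\<^sup>2) at_top at_top"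
    by (intro filterlim_tendsto_add_at_top[OF tendsto_const] filterlim_pow_at_top filterlim_ident) auto
  have "((\<lambda>x::real. 2 / (5 + x\<^sup>2)) \<longlongrightarrow> 0) at_top"
    by (rule tendsto_divide_0[OF tendsto_const]) (rule filterlim_at_top_imp_at_infinity[OF sq])
  then show "(gauss_pdf \<longlongrightarrow> 0) at_top"
    by (rule tendsto_sandwich[rotated 2, OF tendsto_const[of 0]])
       (use gauss_pdf_le less_imp_le[OF gauss_pdf_pos] in auto)
  have 1: "((\<lambda>x::real. 2 / x) \<longlongrightarrow> 0) at_top"
    by (rule tendsto_divide_0[OF tendsto_const]) (rule filterlim_at_top_imp_at_infinity[OF filterlim_ident])
  have "\<forall>\<^sub>F x in at_top. 0 \<le> x * gauss_pdf x \<and> x * gauss_pdf x \<le> 2 / x"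
    using eventually_gt_at_top[of "0::real"]
  proof (eventually_elim)
    fix x :: real assume x: "0 < x"
    have "x * gauss_pdf x \<le> x * (2 / (5 + x\<^sup>2))"
      using x by (intro mult_left_mono gauss_pdf_le) auto
    also have "\<dots> \<le> 2 / x"
      using x by (simp add: field_simps power2_eq_square add_pos_pos)
    finally show "0 \<le> x * gauss_pdf x \<and> x * gauss_pdf x \<le> 2 / x"
      using x gauss_pdf_pos[of x] by simp
  qed
  then have "\<forall>\<^sub>F x in at_top. 0 \<le> x * gauss_pdf x" "\<forall>\<^sub>F x in at_top. x * gauss_pdf x \<le> 2 / x"
    by (auto elim: eventually_mono)
  then show "((\<lambda>x. x * gauss_pdf x) \<longlongrightarrow> 0) at_top"
    by (rule tendsto_sandwich[OF _ _ tendsto_const[of 0] 1])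
qed

lemma gauss_cdf_bounds: "0 < gauss_cdf x" "gauss_cdf x < 1"
proof -
  have gt: "gauss_cdf y \<le> 1" for y
  proof -
    have "0 \<le> 1 - gauss_cdf y"
    proof (rule nonneg_if_decreasing_to_zero[where g = "\<lambda>x. 1 - gauss_cdf x" and g' = "\<lambda>x. - gauss_pdf x"])
      show "((\<lambda>x. 1 - gauss_cdf x) has_real_derivative - gauss_pdf z) (at z)" for z
        using DERIV_diff[OF DERIV_const[of 1] gauss_cdf_deriv] by simp
    qed (use tendsto_diff[OF tendsto_const[of 1] gauss_cdf_lims(2)] less_imp_le[OF gauss_pdf_pos] in auto)
    then show ?thesis by simp
  qed
  show lt: "gauss_cdf x < 1" for x
    using gauss_cdf_strict_mono[of x "x+1"] gt[of "x+1"] by simp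
  show "0 < gauss_cdf x"
    using gauss_cdf_refl[of x] lt[of "-x"] by simp
qed

lemma gauss_cdf_surj:
  assumes "0 < p" "p < 1"
  obtains x where "gauss_cdf x = p"
proof -
  have "\<forall>\<^sub>F x in at_bot. gauss_cdf x < p" "\<forall>\<^sub>F x in at_top. gauss_cdf x > p"
    using order_tendstoD(2)[OF gauss_cdf_lims(1) assms(1)]
          order_tendstoD(1)[OF gauss_cdf_lims(2) assms(2)] .
  then obtain a b where ab: "\<And>x. x \<le> a \<Longrightarrow> gauss_cdf x < p" "\<And>x. x \<ge> b \<Longrightarrow> gauss_cdf x > p"
    by (auto simp: eventually_at_bot_linorder eventually_at_top_linorder)
  have "gauss_cdf (min a b) \<le> p" "p \<le> gauss_cdf (max a b)" "min a b \<le> max a b"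
    using ab by (auto intro: less_imp_le)
  then show ?thesis
    using IVT[of gauss_cdf "min a b" p "max a b"] gauss_cdf_isCont that by blast
qed

lemma gauss_profile_cdf: "gauss_profile (gauss_cdf x) = gauss_pdf x"
  using gauss_cdf_bounds[of x] by (simp add: gauss_profile_def inv_f_f[OF gauss_cdf_inj])

text \<open>
  For positive \<open>x\<close>, the function \<open>\<phi>(x) / x - (1 - \<Phi>(x))\<close> has derivative \<open>- \<phi>(x) / x\<^sup>2\<close>.
\<close>
lemma mills_upper: "x * (1 - gauss_cdf x) \<le> gauss_pdf x"
proof (cases "x > 0")
  case True
  have "((\<lambda>y. gauss_pdf y / y) \<longlongrightarrow> 0) at_top"
    using tendsto_mult[OF gauss_pdf_lims(1) tendsto_inverse_0_at_top[OF filterlim_ident]]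
    by (simp add: divide_inverse)
  from tendsto_diff[OF this tendsto_diff[OF tendsto_const[of 1] gauss_cdf_lims(2)]]
  have lim: "((\<lambda>y. gauss_pdf y / y - (1 - gauss_cdf y)) \<longlongrightarrow> 0) at_top"
    by simp
  have "0 \<le> gauss_pdf x / x - (1 - gauss_cdf x)"
  proof (rule nonneg_if_decreasing_to_zero[where g = "\<lambda>y. gauss_pdf y / y - (1 - gauss_cdf y)"
       and g' = "\<lambda>y. - gauss_pdf y / y\<^sup>2"])
    show "((\<lambda>y. gauss_pdf y / y - (1 - gauss_cdf y)) has_real_derivative - gauss_pdf y / y\<^sup>2) (at y)"
      if "y \<ge> x" for y
    proof -
      have y: "y \<noteq> 0" using that True by simp
      have 1: "((\<lambda>y. gauss_pdf y / y) has_real_derivative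
          ((- y * gauss_pdf y) * y - gauss_pdf y * 1) / (y * y)) (at y)"
        by (rule DERIV_divide[OF gauss_pdf_deriv DERIV_ident y])
      have "((\<lambda>y. gauss_pdf y / y - (1 - gauss_cdf y)) has_real_derivative
          ((- y * gauss_pdf y) * y - gauss_pdf y * 1) / (y * y) - (0 - gauss_pdf y)) (at y)"
        by (rule DERIV_diff[OF 1 DERIV_diff[OF DERIV_const gauss_cdf_deriv]])
      moreover have "((- y * gauss_pdf y) * y - gauss_pdf y * 1) / (y * y) - (0 - gauss_pdf y) = - gauss_pdf y / y\<^sup>2"
        using y by (simp add: field_simps power2_eq_square)
      ultimately show ?thesis by simp
    qed
    show "- gauss_pdf y / y\<^sup>2 \<le> 0" for y
      using gauss_pdf_pos[of y] by simp
  qed (rule lim)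
  then show ?thesis
    using True by (simp add: field_simps)
next
  case False
  then have "x * (1 - gauss_cdf x) \<le> 0"
    using gauss_cdf_bounds[of x] by (intro mult_nonpos_nonneg) auto
  then show ?thesis
    using gauss_pdf_pos[of x] by linarith
qed

text \<open>
  Birnbaum's bound. With \<open>R = sqrt (x\<^sup>2 + 4)\<close>, the sign of the derivative of the difference is that of
  \<open>x (R\<^sup>2 - 1) - (1 + x\<^sup>2) R\<close>, and the squares of the two terms differ by exactly \<open>4\<close>.
\<close>
lemma birnbaum_lower: "gauss_pdf x * (sqrt (x\<^sup>2 + 4) - x) / 2 \<le> 1 - gauss_cdf x"
proof -
  define g where "g = (\<lambda>x. (1 - gauss_cdf x) - gauss_pdf x * (sqrt (x\<^sup>2 + 4) - x) / 2)"
  define g' where "g' = (\<lambda>x. - gauss_pdf x / 2 * (1 + x\<^sup>2 + x / sqrt (x\<^sup>2 + 4) - x * sqrt (x\<^sup>2 + 4)))"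
  have der: "(g has_real_derivative g' y) (at y)" for y
  proof -
    have p: "y\<^sup>2 + 4 > 0" by (simp add: add_nonneg_pos)
    define R where "R = sqrt (y\<^sup>2 + 4)"
    have R: "R > 0" using p by (simp add: R_def)
    have 1: "((\<lambda>x. sqrt (x\<^sup>2 + 4)) has_real_derivative y / R) (at y)"
      using p by (auto intro!: derivative_eq_intros simp: R_def field_simps)
    have "(g has_real_derivative (0 - gauss_pdf y) - ((- y * gauss_pdf y) * (R - y) + (y / R - 1) * gauss_pdf y) / 2) (at y)"
      unfolding g_def
      by (intro DERIV_diff DERIV_const gauss_cdf_deriv DERIV_cdivide)
         (use DERIV_mult[OF gauss_pdf_deriv DERIV_diff[OF 1 DERIV_ident]] in \<open>simp add: R_def\<close>)
    moreover have "(0 - gauss_pdf y) - ((- y * gauss_pdf y) * (R - y) + (y / R - 1) * gauss_pdf y) / 2 = g' y"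
      unfolding g'_def R_def[symmetric] using R by (simp add: field_simps power2_eq_square)
    ultimately show ?thesis by simp
  qed
  have neg: "g' y \<le> 0" for y
  proof -
    define R where "R = sqrt (y\<^sup>2 + 4)"
    have R: "R > 0" "R\<^sup>2 = y\<^sup>2 + 4" by (auto simp: R_def add_nonneg_pos)
    have "y * (R\<^sup>2 - 1) \<le> (1 + y\<^sup>2) * R"
    proof (rule power2_le_imp_le)
      have "((1 + y\<^sup>2) * R)\<^sup>2 - (y * (R\<^sup>2 - 1))\<^sup>2 = 4"
        unfolding power_mult_distrib R(2) by (simp add: power2_eq_square algebra_simps)
      then show "(y * (R\<^sup>2 - 1))\<^sup>2 \<le> ((1 + y\<^sup>2) * R)\<^sup>2" by simp
    qed (use R in auto)
    then have "0 \<le> 1 + y\<^sup>2 + y / R - y * R"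
      using R(1) by (simp add: field_simps power2_eq_square)
    then show ?thesis
      unfolding g'_def R_def[symmetric] using gauss_pdf_pos[of y]
      by (simp add: mult_nonneg_nonneg)
  qed
  have lim: "(g \<longlongrightarrow> 0) at_top"
  proof -
    have "((\<lambda>x. gauss_pdf x * (sqrt (x\<^sup>2 + 4) - x) / 2) \<longlongrightarrow> 0) at_top"
    proof (rule tendsto_sandwich[OF _ _ tendsto_const[of 0] gauss_pdf_lims(1)])
      show "\<forall>\<^sub>F x in at_top. 0 \<le> gauss_pdf x * (sqrt (x\<^sup>2 + 4) - x) / 2"
      proof (intro always_eventually allI divide_nonneg_nonneg mult_nonneg_nonneg)
        fix x :: real
        show "0 \<le> gauss_pdf x" using gauss_pdf_pos[of x] by simp
        show "0 \<le> sqrt (x\<^sup>2 + 4) - x" using real_le_rsqrt[of x "x\<^sup>2 + 4"] by simp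
      qed simp
      show "\<forall>\<^sub>F x in at_top. gauss_pdf x * (sqrt (x\<^sup>2 + 4) - x) / 2 \<le> gauss_pdf x"
        using eventually_ge_at_top[of 0]
      proof eventually_elim
        fix x :: real assume "x \<ge> 0"
        then have "sqrt (x\<^sup>2 + 4) \<le> x + 2"
          by (intro real_le_lsqrt) (auto simp: power2_eq_square algebra_simps)
        then have "gauss_pdf x * (sqrt (x\<^sup>2 + 4) - x) \<le> gauss_pdf x * 2"
          using gauss_pdf_pos[of x] by (intro mult_left_mono) auto
        then show "gauss_pdf x * (sqrt (x\<^sup>2 + 4) - x) / 2 \<le> gauss_pdf x" by simp
      qed
    qed
    from tendsto_diff[OF tendsto_diff[OF tendsto_const[of 1] gauss_cdf_lims(2)] this]
    show ?thesis unfolding g_def by simp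
  qed
  have "g x \<ge> 0"
    by (rule nonneg_if_decreasing_to_zero[OF der neg lim])
  then show ?thesis by (simp add: g_def)
qed

text \<open>
  The quadratic \<open>m\<^sup>2 - x m - 1\<close> has positive root \<open>(x + sqrt (x\<^sup>2 + 4)) / 2\<close>, and Birnbaum's bound says
  that the hazard rate \<open>m = \<phi>(x) / (1 - \<Phi>(x))\<close> does not exceed it.
\<close>
lemma gauss_tail_quadratic:
  "gauss_pdf x * (gauss_pdf x - x * (1 - gauss_cdf x)) \<le> (1 - gauss_cdf x)\<^sup>2"
proof -
  define R where "R = sqrt (x\<^sup>2 + 4)"
  define Q where "Q = 1 - gauss_cdf x"
  have R2: "R\<^sup>2 = x\<^sup>2 + 4" by (auto simp: R_def add_nonneg_pos)
  have "x \<le> R" "-x \<le> R"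
    using real_le_rsqrt[of x "x\<^sup>2 + 4"] real_le_rsqrt[of "-x" "x\<^sup>2 + 4"] by (auto simp: R_def)
  have p: "gauss_pdf x * (R - x) \<le> 2 * Q"
    using birnbaum_lower[of x] by (simp add: R_def Q_def)
  have "gauss_pdf x * ((R - x) * (R + x)) \<le> 2 * Q * (R + x)"
    using mult_right_mono[OF p, of "R + x"] \<open>-x \<le> R\<close> by (simp add: mult_ac)
  moreover have "(R - x) * (R + x) = 4"
    using R2 by (simp add: power2_eq_square algebra_simps)
  ultimately have "gauss_pdf x - x * Q \<le> Q * (R - x) / 2"
    by (simp add: field_simps)
  then have "gauss_pdf x * (gauss_pdf x - x * Q) \<le> gauss_pdf x * (Q * (R - x) / 2)"
    using gauss_pdf_pos[of x] by (intro mult_left_mono) auto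
  also have "\<dots> = Q * (gauss_pdf x * (R - x) / 2)" by simp
  also have "\<dots> \<le> Q * Q"
    using p gauss_cdf_bounds[of x] by (intro mult_left_mono) (auto simp: Q_def)
  finally show ?thesis by (simp add: Q_def power2_eq_square)
qed

text \<open>
  The hazard rate \<open>m\<close> satisfies \<open>m' = m (m - x)\<close>, which is nonnegative by \<open>mills_upper\<close>.
\<close>
lemma gauss_hazard_mono:
  assumes "x \<le> y"
  shows "gauss_pdf x * (1 - gauss_cdf y) \<le> gauss_pdf y * (1 - gauss_cdf x)"
proof -
  have pos: "1 - gauss_cdf z > 0" for z using gauss_cdf_bounds[of z] by simp
  have "gauss_pdf x / (1 - gauss_cdf x) \<le> gauss_pdf y / (1 - gauss_cdf y)"
  proof (rule DERIV_nonneg_imp_nondecreasing[OF assms])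
    fix z
    have 1: "((\<lambda>z. 1 - gauss_cdf z) has_real_derivative 0 - gauss_pdf z) (at z)"
      by (rule DERIV_diff[OF DERIV_const gauss_cdf_deriv])
    have "((\<lambda>z. gauss_pdf z / (1 - gauss_cdf z)) has_real_derivative
        ((- z * gauss_pdf z) * (1 - gauss_cdf z) - gauss_pdf z * (0 - gauss_pdf z)) /
          ((1 - gauss_cdf z) * (1 - gauss_cdf z))) (at z)"
      by (rule DERIV_divide[OF gauss_pdf_deriv 1]) (use pos[of z] in simp)
    also have "((- z * gauss_pdf z) * (1 - gauss_cdf z) - gauss_pdf z * (0 - gauss_pdf z)) /
          ((1 - gauss_cdf z) * (1 - gauss_cdf z)) =
        gauss_pdf z * (gauss_pdf z - z * (1 - gauss_cdf z)) / (1 - gauss_cdf z)\<^sup>2"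
      by (simp add: power2_eq_square algebra_simps)
    finally have "((\<lambda>z. gauss_pdf z / (1 - gauss_cdf z)) has_real_derivative
        gauss_pdf z * (gauss_pdf z - z * (1 - gauss_cdf z)) / (1 - gauss_cdf z)\<^sup>2) (at z)" .
    moreover have "0 \<le> gauss_pdf z * (gauss_pdf z - z * (1 - gauss_cdf z)) / (1 - gauss_cdf z)\<^sup>2"
      using mills_upper[of z] gauss_pdf_pos[of z] by (intro divide_nonneg_nonneg mult_nonneg_nonneg) auto
    ultimately show "\<exists>d. ((\<lambda>z. gauss_pdf z / (1 - gauss_cdf z)) has_real_derivative d) (at z) \<and> 0 \<le> d"
      by blast
  qed
  then show ?thesis using pos[of x] pos[of y] by (simp add: field_simps)
qed

text \<open>
  Let \<open>\<Delta> = \<Phi>(y) - \<Phi>(x)\<close>. If \<open>\<Delta>\<close> exhausts half of the tail beyond \<open>x\<close>, the left side is at most its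
  value for \<open>y = \<infinity>\<close>, which \<open>gauss_tail_quadratic\<close> bounds by the square of the tail. Otherwise
  \<open>gauss_hazard_mono\<close> keeps the density above \<open>\<phi>(x) / 2\<close> on the whole interval; then \<open>\<Delta>\<close> is at least
  \<open>(y - x) \<phi>(x) / 2\<close>, while the bracket is at most \<open>(y - x) \<Delta>\<close>.
\<close>
lemma gauss_bregman_right:
  assumes "x \<le> y"
  shows "gauss_pdf x * (gauss_pdf x - gauss_pdf y - x * (gauss_cdf y - gauss_cdf x))
           \<le> 4 * (gauss_cdf y - gauss_cdf x)\<^sup>2"
proof -
  define \<Delta> where "\<Delta> = gauss_cdf y - gauss_cdf x"
  define B where "B = gauss_pdf x - gauss_pdf y - x * \<Delta>"
  define Q where "Q = 1 - gauss_cdf x"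
  have Q: "Q > 0" using gauss_cdf_bounds[of x] by (simp add: Q_def)
  have mono: "gauss_cdf x \<le> gauss_cdf z" if "x \<le> z" for z
    using that gauss_cdf_strict_mono[of x z] by (cases "x = z") auto
  have \<Delta>: "\<Delta> \<ge> 0" using mono[OF assms] by (simp add: \<Delta>_def)
  show ?thesis
  proof (cases "\<Delta> \<ge> Q / 2")
    case True
    have "x * (1 - gauss_cdf y) \<le> y * (1 - gauss_cdf y)"
      using assms gauss_cdf_bounds[of y] by (intro mult_right_mono) auto
    also have "\<dots> \<le> gauss_pdf y" by (rule mills_upper)
    finally have "B \<le> gauss_pdf x - x * Q"
      by (simp add: B_def \<Delta>_def Q_def algebra_simps)
    then have "gauss_pdf x * B \<le> gauss_pdf x * (gauss_pdf x - x * Q)"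
      using gauss_pdf_pos[of x] by (intro mult_left_mono) auto
    also have "\<dots> \<le> Q\<^sup>2" unfolding Q_def by (rule gauss_tail_quadratic)
    also have "\<dots> \<le> (2 * \<Delta>)\<^sup>2" using True Q by (intro power_mono) auto
    also have "\<dots> = 4 * \<Delta>\<^sup>2" by (simp add: power2_eq_square)
    finally show ?thesis by (simp add: B_def \<Delta>_def)
  next
    case False
    have half: "gauss_pdf z \<ge> gauss_pdf x / 2" if z: "x \<le> z" "z \<le> y" for z
    proof -
      have "gauss_cdf z \<le> gauss_cdf y"
        using z gauss_cdf_strict_mono[of z y] by (cases "z = y") auto
      then have "1 - gauss_cdf z \<ge> Q / 2"
        using False by (simp add: Q_def \<Delta>_def)
      then have "gauss_pdf x * (Q / 2) \<le> gauss_pdf x * (1 - gauss_cdf z)"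
        using gauss_pdf_pos[of x] by (intro mult_left_mono) auto
      also have "\<dots> \<le> gauss_pdf z * Q"
        unfolding Q_def by (rule gauss_hazard_mono) (use z in auto)
      finally show ?thesis using Q by simp
    qed
    have 1: "gauss_pdf x / 2 * (y - x) \<le> \<Delta>"
    proof -
      have "gauss_cdf x - gauss_pdf x / 2 * x \<le> gauss_cdf y - gauss_pdf x / 2 * y"
      proof (rule DERIV_nonneg_imp_nondecreasing[OF assms, where f = "\<lambda>z. gauss_cdf z - gauss_pdf x / 2 * z"])
        fix z assume "x \<le> z" "z \<le> y"
        moreover have "((\<lambda>z. gauss_cdf z - gauss_pdf x / 2 * z) has_real_derivative gauss_pdf z - gauss_pdf x / 2) (at z)"
          by (auto intro!: derivative_eq_intros gauss_cdf_deriv)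
        ultimately show "\<exists>d. ((\<lambda>z. gauss_cdf z - gauss_pdf x / 2 * z) has_real_derivative d) (at z) \<and> 0 \<le> d"
          using half[of z] by auto
      qed
      then show ?thesis unfolding \<Delta>_def right_diff_distrib by linarith
    qed
    have 2: "B \<le> (y - x) * \<Delta>"
    proof -
      define h where "h = (\<lambda>z. (z - x) * (gauss_cdf z - gauss_cdf x) -
         (gauss_pdf x - gauss_pdf z - x * (gauss_cdf z - gauss_cdf x)))"
      have "h x \<le> h y"
      proof (rule DERIV_nonneg_imp_nondecreasing[OF assms])
        fix z assume z: "x \<le> z" "z \<le> y"
        have "(h has_real_derivative gauss_cdf z - gauss_cdf x) (at z)"
          unfolding h_def
          by (auto intro!: derivative_eq_intros gauss_cdf_deriv gauss_pdf_deriv simp: algebra_simps)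
        then show "\<exists>d. (h has_real_derivative d) (at z) \<and> 0 \<le> d"
          using mono[OF z(1)] by auto
      qed
      then show ?thesis by (simp add: h_def B_def \<Delta>_def)
    qed
    have "gauss_pdf x * B \<le> gauss_pdf x * ((y - x) * \<Delta>)"
      using gauss_pdf_pos[of x] by (intro mult_left_mono 2) auto
    also have "\<dots> = 2 * (gauss_pdf x / 2 * (y - x)) * \<Delta>" by simp
    also have "\<dots> \<le> 2 * \<Delta> * \<Delta>"
      by (intro mult_right_mono mult_left_mono 1 \<Delta>) auto
    also have "\<dots> \<le> 4 * \<Delta>\<^sup>2" by (simp add: power2_eq_square)
    finally show ?thesis by (simp add: B_def \<Delta>_def)
  qed
qed

lemma gauss_bregman:
  "gauss_pdf x * (gauss_pdf x - gauss_pdf y - x * (gauss_cdf y - gauss_cdf x))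
     \<le> 4 * (gauss_cdf y - gauss_cdf x)\<^sup>2"
proof (cases "x \<le> y")
  case False
  then show ?thesis
    using gauss_bregman_right[of "-x" "-y"]
    by (simp add: gauss_pdf_even gauss_cdf_refl power2_commute algebra_simps)
qed (rule gauss_bregman_right)

definition gauss_quantile :: "real \<Rightarrow> real" where
  "gauss_quantile p = inv gauss_cdf p"

lemma gauss_cdf_quantile:
  assumes "0 < p" "p < 1"
  shows "gauss_cdf (gauss_quantile p) = p"
  using gauss_cdf_surj[OF assms] unfolding gauss_quantile_def by (metis f_inv_into_f rangeI)

lemma gauss_quantile_cdf: "gauss_quantile (gauss_cdf x) = x"
  by (simp add: gauss_quantile_def inv_f_f[OF gauss_cdf_inj])

lemma gauss_profile_quantile:
  assumes "0 < p" "p < 1"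
  shows "gauss_profile p = gauss_pdf (gauss_quantile p)"
  using gauss_profile_cdf[of "gauss_quantile p"] gauss_cdf_quantile[OF assms] by simp

text \<open>
  In the quantile variable \<open>x\<close> the profile is \<open>\<phi>(x)\<close>; the factor \<open>\<phi>(x)\<close> in \<open>\<phi>' = - x \<phi>\<close> cancels against
  the derivative \<open>1 / \<phi>(x)\<close> of the quantile.
\<close>
lemma gauss_profile_deriv:
  assumes "0 < p" "p < 1"
  shows "(gauss_profile has_real_derivative - gauss_quantile p) (at p)"
proof -
  have cont: "isCont gauss_quantile p"
  proof -
    have "isCont gauss_quantile (gauss_cdf (gauss_quantile p))"
      by (rule isCont_inverse_function[where d = 1]) (auto simp: gauss_quantile_cdf gauss_cdf_isCont)
    then show ?thesis by (simp add: gauss_cdf_quantile assms)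
  qed
  have "(gauss_quantile has_real_derivative inverse (gauss_pdf (gauss_quantile p))) (at p)"
    by (rule DERIV_inverse_function[where f = gauss_cdf and a = 0 and b = 1])
       (use assms cont gauss_cdf_deriv gauss_pdf_pos[of "gauss_quantile p"] in \<open>auto simp: gauss_cdf_quantile\<close>)
  from DERIV_chain2[OF gauss_pdf_deriv this]
  have "((\<lambda>p. gauss_pdf (gauss_quantile p)) has_real_derivative - gauss_quantile p) (at p)"
    by (rule DERIV_cong) (use gauss_pdf_pos[of "gauss_quantile p"] in simp)
  then show ?thesis
    by (rule has_field_derivative_transform_within_open[where S = "{0<..<1}"])
       (use assms in \<open>auto simp: gauss_profile_quantile\<close>)
qed

lemma gauss_profile_pos: "0 < p \<Longrightarrow> p < 1 \<Longrightarrow> gauss_profile p > 0"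
  by (simp add: gauss_profile_quantile gauss_pdf_pos)

lemma gauss_profile_nonneg: "gauss_profile p \<ge> 0"
  by (cases "0 < p \<and> p < 1") (auto dest: gauss_profile_pos simp: gauss_profile_def)

text \<open>
  The quantitative form of \<open>I I'' = -1\<close> that replaces second derivatives in discrete space: the Bregman
  divergence of \<open>- I\<close>, multiplied by \<open>I\<close>, is at most quadratic over arbitrary jumps.
\<close>
lemma gauss_profile_bregman:
  assumes "0 < a" "a < 1" "0 < b" "b < 1"
  shows "gauss_profile a * (gauss_profile a - gauss_profile b - gauss_quantile a * (b - a)) \<le> 4 * (b - a)\<^sup>2"
  using gauss_bregman[of "gauss_quantile a" "gauss_quantile b"] assms
  by (simp add: gauss_profile_quantile gauss_cdf_quantile)

text \<open>
  This gives continuity of the profile at the end points \<open>0\<close> and \<open>1\<close>.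
\<close>
lemma gauss_pdf_sq_le_cdf: "(gauss_pdf x)\<^sup>2 \<le> 1 - gauss_cdf x"
proof -
  define g where "g = (\<lambda>x. (1 - gauss_cdf x) - (gauss_pdf x)\<^sup>2)"
  define g' where "g' = (\<lambda>x. - gauss_pdf x * (1 - 2 * x * gauss_pdf x))"
  have der: "(g has_real_derivative g' y) (at y)" for y
    unfolding g_def g'_def
    by (auto intro!: derivative_eq_intros gauss_cdf_deriv gauss_pdf_deriv simp: algebra_simps power2_eq_square)
  have neg: "g' y \<le> 0" for y
  proof -
    have "2 * y * gauss_pdf y \<le> 2 * \<bar>y\<bar> * gauss_pdf y"
      using gauss_pdf_pos[of y] by (intro mult_right_mono) auto
    also have "\<dots> \<le> 2 * \<bar>y\<bar> * (2 / (5 + y\<^sup>2))"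
      using gauss_pdf_le[of y] by (intro mult_left_mono) auto
    also have "\<dots> \<le> 1"
    proof -
      have "4 * \<bar>y\<bar> \<le> 5 + \<bar>y\<bar>\<^sup>2"
        using zero_le_power2[of "\<bar>y\<bar> - 2"] unfolding power2_eq_square by (simp add: algebra_simps)
      then show ?thesis by (simp add: field_simps add_pos_nonneg)
    qed
    finally show ?thesis using gauss_pdf_pos[of y] by (simp add: g'_def)
  qed
  have "(g \<longlongrightarrow> (1 - 1) - 0\<^sup>2) at_top"
    unfolding g_def by (intro tendsto_intros gauss_cdf_lims gauss_pdf_lims)
  then have "g x \<ge> 0"
    by (intro nonneg_if_decreasing_to_zero[OF der neg]) simp
  then show ?thesis by (simp add: g_def)
qed

lemma gauss_profile_refl: "gauss_profile (1 - p) = gauss_profile p"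
proof (cases "0 < p \<and> p < 1")
  case True
  then obtain x where x: "gauss_cdf x = p" using gauss_cdf_surj by blast
  then have "gauss_profile (1 - p) = gauss_profile (gauss_cdf (-x))" by (simp add: gauss_cdf_refl)
  then show ?thesis using x gauss_profile_cdf gauss_pdf_even by metis
qed (auto simp: gauss_profile_def)

lemma gauss_profile_le_sqrt:
  assumes "0 \<le> p" "p \<le> 1"
  shows "gauss_profile p \<le> sqrt p" "gauss_profile p \<le> sqrt (1 - p)"
proof -
  have *: "gauss_profile p \<le> sqrt (1 - p)" if "0 \<le> p" "p \<le> 1" for p
  proof (cases "0 < p \<and> p < 1")
    case True
    then obtain x where x: "gauss_cdf x = p" using gauss_cdf_surj by blast
    show ?thesis using gauss_pdf_sq_le_cdf[of x] gauss_profile_cdf[of x] x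
      by (simp add: real_le_rsqrt)
  qed (use that in \<open>auto simp: gauss_profile_def\<close>)
  show "gauss_profile p \<le> sqrt p" using *[of "1 - p"] assms gauss_profile_refl[of p] by simp
  show "gauss_profile p \<le> sqrt (1 - p)" by (rule *[OF assms])
qed

lemma gauss_profile_continuous: "continuous_on {0..1} gauss_profile"
proof -
  have z: "((\<lambda>p::real. sqrt p) \<longlongrightarrow> 0) (at 0 within {0..1})"
    and o: "((\<lambda>p::real. sqrt (1 - p)) \<longlongrightarrow> 0) (at 1 within {0..1})"
    by (auto intro!: tendsto_eq_intros)
  have "(gauss_profile \<longlongrightarrow> gauss_profile p) (at p within {0..1})" if "p \<in> {0..1}" for p
  proof -
    have "p = 0 \<or> p = 1 \<or> (0 < p \<and> p < 1)" using that by auto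
    then consider "p = 0" | "p = 1" | "0 < p" "p < 1" by blast
    then show ?thesis
    proof cases
      case 1
      have "(gauss_profile \<longlongrightarrow> 0) (at 0 within {0..1})"
        by (rule tendsto_sandwich[OF _ _ tendsto_const[of 0] z])
           (auto simp: eventually_at_filter gauss_profile_nonneg gauss_profile_le_sqrt)
      with 1 show ?thesis by (simp add: gauss_profile_def)
    next
      case 2
      have "(gauss_profile \<longlongrightarrow> 0) (at 1 within {0..1})"
        by (rule tendsto_sandwich[OF _ _ tendsto_const[of 0] o])
           (auto simp: eventually_at_filter gauss_profile_nonneg gauss_profile_le_sqrt)
      with 2 show ?thesis by (simp add: gauss_profile_def)
    next
      case 3
      then have "isCont gauss_profile p" by (intro DERIV_isCont[OF gauss_profile_deriv])
      then show ?thesis using isCont_def tendsto_within_subset by blast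
    qed
  qed
  then show ?thesis by (simp add: continuous_on_def)
qed

text \<open>
  By symmetry let the quantile be nonnegative; then compare the hazard rate with its value at \<open>0\<close>.
\<close>
lemma gauss_profile_ge_quarter:
  assumes "0 \<le> p" "p \<le> 1"
  shows "p * (1 - p) / 4 \<le> gauss_profile p"
proof -
  have half: "p * (1 - p) / 4 \<le> gauss_profile p" if p: "0 < p" "p < 1" and x: "gauss_cdf x = p" "x \<ge> 0" for p x
  proof -
    have h: "gauss_cdf 0 = 1 / 2" using gauss_cdf_refl[of 0] by simp
    have "sqrt (2 * pi) \<le> 4"
      by (rule real_le_lsqrt) (use pi_less_4 in auto)
    then have "1 / 4 \<le> gauss_pdf 0"
      by (simp add: std_normal_density_def field_simps)
    then have "1 / 4 * (1 - p) \<le> gauss_pdf 0 * (1 - p)"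
      using p by (intro mult_right_mono) auto
    also have "\<dots> \<le> gauss_profile p"
      using gauss_hazard_mono[OF x(2)] x(1) h gauss_profile_cdf[of x] gauss_pdf_pos[of x] by simp
    finally have "(1 - p) / 4 \<le> gauss_profile p" by simp
    moreover have "p * (1 - p) \<le> 1 * (1 - p)" using p by (intro mult_right_mono) auto
    ultimately show ?thesis by simp
  qed
  show ?thesis
  proof (cases "0 < p \<and> p < 1")
    case True
    then obtain x where x: "gauss_cdf x = p" using gauss_cdf_surj by blast
    show ?thesis
    proof (cases "x \<ge> 0")
      case True
      then show ?thesis using half x \<open>0 < p \<and> p < 1\<close> by blast
    next
      case False
      then have "(1 - p) * (1 - (1 - p)) / 4 \<le> gauss_profile (1 - p)"
        using \<open>0 < p \<and> p < 1\<close> x by (intro half[where x = "-x"]) (auto simp: gauss_cdf_refl)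
      then show ?thesis by (simp add: gauss_profile_refl mult.commute)
    qed
  qed (use assms in \<open>auto simp: gauss_profile_def\<close>)
qed

section \<open>A minimum principle for finite systems of differential inequalities\<close>

declare One_nat_def [simp del]

text \<open>
  Only the situation in which a component attains a common negative minimum has to be examined, and
  this makes coupled systems easy to treat. The proof looks at the minimum of \<open>exp (- (\<kappa> + 1) t) y\<^sub>a(t)\<close>
  over all components and times: if it were negative, it would be attained at a positive time, and there
  the hypothesis makes the derivative strictly positive, so that earlier values are smaller.
\<close>
lemma touching_minimum_principle:
  fixes y :: "'a \<Rightarrow> real \<Rightarrow> real"
  assumes fin: "finite A"
    and cont: "\<And>a. a \<in> A \<Longrightarrow> continuous_on {0..T} (y a)"
    and init: "\<And>a. a \<in> A \<Longrightarrow> 0 \<le> y a 0"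
    and der: "\<And>a t. a \<in> A \<Longrightarrow> 0 < t \<Longrightarrow> t \<le> T \<Longrightarrow> (y a has_real_derivative y' a t) (at t)"
    and touch: "\<And>a t. a \<in> A \<Longrightarrow> 0 < t \<Longrightarrow> t \<le> T \<Longrightarrow> y a t < 0 \<Longrightarrow>
        (\<And>b. b \<in> A \<Longrightarrow> y a t \<le> y b t) \<Longrightarrow> \<kappa> * y a t \<le> y' a t"
    and a: "a \<in> A" and t: "0 \<le> t" "t \<le> T"
  shows "0 \<le> y a t"
proof (rule ccontr)
  assume neg: "\<not> 0 \<le> y a t"
  define z where "z = (\<lambda>a t. exp (- (\<kappa> + 1) * t) * y a t)"
  have "\<forall>a\<in>A. \<exists>s\<in>{0..T}. \<forall>r\<in>{0..T}. z a s \<le> z a r"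
    unfolding z_def using t
    by (intro ballI continuous_attains_inf continuous_intros cont) auto
  then obtain m where m: "\<And>a. a \<in> A \<Longrightarrow> m a \<in> {0..T}"
    and min: "\<And>a r. a \<in> A \<Longrightarrow> r \<in> {0..T} \<Longrightarrow> z a (m a) \<le> z a r"
    by metis
  define b where "b = arg_min_on (\<lambda>a. z a (m a)) A"
  have ne: "A \<noteq> {}" using a by auto
  have b: "b \<in> A" and bmin: "\<And>a. a \<in> A \<Longrightarrow> z b (m b) \<le> z a (m a)"
    unfolding b_def using arg_min_if_finite(1)[OF fin ne] arg_min_least[OF fin ne] by auto
  define s where "s = m b"
  have s: "0 \<le> s" "s \<le> T" using m[OF b] by (auto simp: s_def)
  have glob: "z b s \<le> z c r" if "c \<in> A" "0 \<le> r" "r \<le> T" for c r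
    using bmin[OF that(1)] min[of c r] that by (auto simp: s_def)
  have zneg: "z b s < 0"
  proof -
    have "z a t < 0" using neg by (simp add: z_def mult_pos_neg)
    then show ?thesis using glob[OF a t] by linarith
  qed
  then have yneg: "y b s < 0"
    by (simp add: z_def mult_less_0_iff)
  then have s0: "0 < s" using init[OF b] s by (cases "s = 0") auto
  have "y b s \<le> y c s" if "c \<in> A" for c
    using glob[OF that s] by (simp add: z_def)
  then have "\<kappa> * y b s \<le> y' b s"
    using touch[OF b s0 s(2) yneg] by blast
  then have pos: "0 < exp (- (\<kappa> + 1) * s) * (y' b s - (\<kappa> + 1) * y b s)"
    using yneg by (intro mult_pos_pos) (auto simp: algebra_simps)
  have "(z b has_real_derivative exp (- (\<kappa> + 1) * s) * (y' b s - (\<kappa> + 1) * y b s)) (at s)"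
    unfolding z_def by (auto intro!: derivative_eq_intros der[OF b s0 s(2)] simp: algebra_simps)
  from DERIV_pos_inc_left[OF this pos] obtain d where d: "d > 0" "\<And>h. 0 < h \<Longrightarrow> h < d \<Longrightarrow> z b (s - h) < z b s"
    by blast
  define h where "h = min (d / 2) s"
  have h: "0 < h" "h < d" "h \<le> s" using d(1) s0 by (auto simp: h_def)
  have "z b (s - h) < z b s" by (rule d(2)[OF h(1,2)])
  then show False using glob[OF b, of "s - h"] h s by simp
qed

section \<open>The Ising model and its semigroup\<close>

lemma flip_flip [simp]: "flip i (flip i x) = x"
  by (auto simp: flip_def fun_eq_iff)

lemma flip_commute: "flip i (flip j x) = flip j (flip i x)"
  by (auto simp: flip_def fun_eq_iff)

lemma flip_apply: "flip i x j = (if j = i then - x i else x j)"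
  by (simp add: flip_def)

lemma cube_cases: "x \<in> cube n \<Longrightarrow> i \<in> {1..n} \<Longrightarrow> x i = - 1 \<or> x i = 1"
  unfolding cube_def by (drule (1) PiE_mem) auto

lemma cube_sq: "x \<in> cube n \<Longrightarrow> i \<in> {1..n} \<Longrightarrow> x i * x i = 1"
  using cube_cases[of x n i] by auto

lemma cube_abs: "x \<in> cube n \<Longrightarrow> i \<in> {1..n} \<Longrightarrow> \<bar>x i\<bar> = 1"
  using cube_cases[of x n i] by auto

lemma sum_cube_flip:
  assumes "i \<in> {1..n}"
  shows "(\<Sum>x\<in>cube n. F (flip i x)) = (\<Sum>x\<in>cube n. F x)"
  by (rule sum.reindex_bij_witness[where i = "flip i" and j = "flip i"])
     (use assms flip_in_cube in auto)

locale ising_model =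
  fixes n :: nat and J :: "nat \<Rightarrow> nat \<Rightarrow> real" and C :: real
  assumes symJ: "symmetric_mat n J"
    and col_sum: "max_col_sum_norm n J \<le> C"
    and Cpos: "C > 0"
begin

abbreviation "\<Omega> \<equiv> cube n"
abbreviation "I \<equiv> {1..n}"
abbreviation "w \<equiv> ising_weight n J"
abbreviation "q \<equiv> rate_star n J"
abbreviation "L \<equiv> generator n J"
abbreviation "P \<equiv> semigroup_P n J"
abbreviation "\<delta> \<equiv> delta_star n J"
abbreviation "\<mu> \<equiv> pmf (ising n J)"

text \<open>
  The local field \<open>h\<^sub>i\<close>: the conditional mean of \<open>x\<^sub>i\<close> given the other spins is \<open>tanh h\<^sub>i\<close>.
\<close>
definition field :: "nat \<Rightarrow> (nat \<Rightarrow> real) \<Rightarrow> real" where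
  "field i x = (\<Sum>j\<in>I - {i}. J i j * x j)"

lemma J_sym: "i \<in> I \<Longrightarrow> j \<in> I \<Longrightarrow> J i j = J j i"
  using symJ by (auto simp: symmetric_mat_def)

lemma col_sum_le: "j \<in> I \<Longrightarrow> (\<Sum>i\<in>I. \<bar>J i j\<bar>) \<le> C"
proof -
  assume "j \<in> I"
  then have "(\<Sum>i\<in>I. \<bar>J i j\<bar>) \<le> max_col_sum_norm n J"
    unfolding max_col_sum_norm_def by (intro Max_ge) auto
  then show ?thesis using col_sum by simp
qed

lemma row_sum_le: "i \<in> I \<Longrightarrow> (\<Sum>j\<in>I. \<bar>J i j\<bar>) \<le> C"
proof -
  assume i: "i \<in> I"
  have "(\<Sum>j\<in>I. \<bar>J i j\<bar>) = (\<Sum>j\<in>I. \<bar>J j i\<bar>)"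
    by (intro sum.cong refl) (metis J_sym i)
  then show ?thesis using col_sum_le[OF i] by simp
qed

lemma J_le: "i \<in> I \<Longrightarrow> j \<in> I \<Longrightarrow> \<bar>J i j\<bar> \<le> C"
  using member_le_sum[of j I "\<lambda>j. \<bar>J i j\<bar>"] row_sum_le[of i] by simp

lemma field_le:
  assumes "x \<in> \<Omega>" "i \<in> I"
  shows "\<bar>field i x\<bar> \<le> C"
proof -
  have "\<bar>field i x\<bar> \<le> (\<Sum>j\<in>I - {i}. \<bar>J i j * x j\<bar>)"
    unfolding field_def by (rule sum_abs)
  also have "\<dots> = (\<Sum>j\<in>I - {i}. \<bar>J i j\<bar>)"
    by (intro sum.cong) (auto simp: abs_mult cube_abs[OF assms(1)])
  also have "\<dots> \<le> (\<Sum>j\<in>I. \<bar>J i j\<bar>)" by (intro sum_mono2) auto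
  finally show ?thesis using row_sum_le[OF assms(2)] by simp
qed

lemma w_pos: "w x > 0"
  by (simp add: ising_weight_def)

text \<open>
  In the quadratic form exactly the terms with one index equal to \<open>k\<close> change sign, and by symmetry of \<open>J\<close>
  they appear twice.
\<close>
lemma w_flip:
  assumes "k \<in> I"
  shows "w (flip k x) = w x * exp (- 2 * x k * field k x)"
proof -
  define S where "S = I - {k}"
  define A where "A = (\<Sum>i\<in>S. \<Sum>j\<in>S. x i * J i j * x j)"
  have row: "(\<Sum>j\<in>I. F j) = F k + (\<Sum>j\<in>S. F j)" for F :: "nat \<Rightarrow> real"
    unfolding S_def using assms by (intro sum.remove) auto
  have split: "(\<Sum>i\<in>I. \<Sum>j\<in>I. y i * J i j * y j) =
     y k * J k k * y k + y k * (\<Sum>j\<in>S. J k j * y j) + (\<Sum>i\<in>S. y i * J i k) * y k +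
     (\<Sum>i\<in>S. \<Sum>j\<in>S. y i * J i j * y j)" for y :: "nat \<Rightarrow> real"
    by (simp add: row sum.distrib sum_distrib_left sum_distrib_right mult.assoc)
  have A: "(\<Sum>i\<in>S. \<Sum>j\<in>S. flip k x i * J i j * flip k x j) = A"
    unfolding A_def by (intro sum.cong) (auto simp: flip_apply S_def)
  have f1: "(\<Sum>j\<in>S. J k j * flip k x j) = field k x"
    unfolding field_def S_def by (intro sum.cong) (auto simp: flip_apply)
  have f2: "(\<Sum>i\<in>S. flip k x i * J i k) = field k x"
    unfolding field_def S_def by (intro sum.cong) (use assms J_sym in \<open>auto simp: flip_apply\<close>)
  have f3: "(\<Sum>i\<in>S. x i * J i k) = field k x"
    unfolding field_def S_def by (intro sum.cong) (use assms J_sym in auto)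
  have f4: "(\<Sum>i\<in>S. J k i * x i) = field k x"
    unfolding field_def S_def ..
  show ?thesis
    unfolding ising_weight_def split[of x] split[of "flip k x"] A f1 f2 f3 f4 A_def[symmetric]
    by (simp add: flip_apply exp_add[symmetric] algebra_simps)
qed

lemma \<mu>_eq: "x \<in> \<Omega> \<Longrightarrow> \<mu> x = w x / (\<Sum>y\<in>\<Omega>. w y)"
  by (simp add: pmf_ising)

lemma Z_pos: "(\<Sum>y\<in>\<Omega>. w y) > 0"
  by (intro sum_pos) (auto simp: w_pos)

lemma \<mu>_pos: "x \<in> \<Omega> \<Longrightarrow> \<mu> x > 0"
  by (simp add: \<mu>_eq w_pos Z_pos)

lemma \<mu>_sum: "(\<Sum>x\<in>\<Omega>. \<mu> x) = 1"
  using Z_pos by (simp add: \<mu>_eq sum_divide_distrib[symmetric])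

lemma \<mu>_flip:
  assumes "x \<in> \<Omega>" "i \<in> I"
  shows "\<mu> (flip i x) = \<mu> x * exp (- 2 * x i * field i x)"
  using assms flip_in_cube[OF assms] by (simp add: \<mu>_eq w_flip)

lemma q_eq:
  assumes "x \<in> \<Omega>" "i \<in> I"
  shows "q i x = exp (- x i * field i x) / 2"
proof -
  have "\<mu> (flip i x) / \<mu> x = (exp (- x i * field i x))\<^sup>2"
    using \<mu>_pos[OF assms(1)] by (simp add: \<mu>_flip[OF assms] exp_double[symmetric] algebra_simps)
  then show ?thesis by (simp add: rate_star_def)
qed

lemma q_bounds:
  assumes "x \<in> \<Omega>" "i \<in> I"
  shows "exp (- C) / 2 \<le> q i x" "q i x \<le> exp C / 2" "0 < q i x"
proof -
  have "\<bar>x i * field i x\<bar> \<le> C"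
    using field_le[OF assms] cube_abs[OF assms] by (simp add: abs_mult)
  then show "exp (- C) / 2 \<le> q i x" "q i x \<le> exp C / 2" "0 < q i x"
    by (auto simp: q_eq[OF assms])
qed

text \<open>
  The ratio \<open>q\<^sub>j(x\<^sup>i) / q\<^sub>j(x)\<close> of the canonical rates.
\<close>
definition coupling :: "nat \<Rightarrow> nat \<Rightarrow> (nat \<Rightarrow> real) \<Rightarrow> real" where
  "coupling i j x = exp (2 * x i * x j * J i j)"

lemma field_flip:
  assumes "i \<in> I" "j \<in> I" "i \<noteq> j"
  shows "field j (flip i x) = field j x - 2 * J j i * x i"
proof -
  have "field j y = J j i * y i + (\<Sum>k\<in>I - {j} - {i}. J j k * y k)" for y
    unfolding field_def by (rule sum.remove) (use assms in auto)
  moreover have "(\<Sum>k\<in>I - {j} - {i}. J j k * flip i x k) = (\<Sum>k\<in>I - {j} - {i}. J j k * x k)"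
    by (intro sum.cong) (auto simp: flip_apply)
  ultimately show ?thesis by (simp add: flip_apply)
qed

lemma q_flip:
  assumes "x \<in> \<Omega>" "i \<in> I" "j \<in> I" "i \<noteq> j"
  shows "q j (flip i x) = q j x * coupling i j x"
  using assms J_sym[of i j]
  by (simp add: q_eq flip_in_cube field_flip coupling_def flip_apply exp_add[symmetric] algebra_simps)

lemma coupling_sym: "i \<in> I \<Longrightarrow> j \<in> I \<Longrightarrow> coupling i j x = coupling j i x"
  by (simp add: coupling_def J_sym mult.commute mult.left_commute)

lemma generator_eq: "L f x = (\<Sum>i\<in>I. \<delta> i f x)"
  by (simp add: generator_def delta_star_def)

text \<open>
  The commutator of \<open>\<delta>\<^sub>i\<close> and \<open>L\<close> contains no differences of \<open>\<delta>\<^sub>i u\<close>. This is special to the canonical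
  rates: substituting \<open>q\<^sub>j(x\<^sup>i) = r q\<^sub>j(x)\<close> and \<open>q\<^sub>i(x\<^sup>j) = r q\<^sub>i(x)\<close> with the same factor \<open>r\<close> into the mixed second
  difference of \<open>u\<close> leaves only terms of order zero. The summand \<open>j = i\<close> already has the form required
  by \<open>L\<close>.
\<close>
lemma \<delta>_generator:
  assumes x: "x \<in> \<Omega>" and i: "i \<in> I"
  shows "\<delta> i (L u) x = L (\<delta> i u) x +
    (\<Sum>j\<in>I - {i}. (coupling i j x - 1) * (q i x * \<delta> j u x - q j x * \<delta> i u x))"
proof -
  define T where "T = (\<lambda>j. q i x * (\<delta> j u (flip i x) - \<delta> j u x))"
  have T: "T j = q j x * (\<delta> i u (flip j x) - \<delta> i u x) +
      (coupling i j x - 1) * (q i x * \<delta> j u x - q j x * \<delta> i u x)" if "j \<in> I - {i}" for j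
  proof -
    have ij: "j \<in> I" "i \<noteq> j" using that by auto
    show ?thesis
      unfolding T_def delta_star_def q_flip[OF x i ij] q_flip[OF x ij(1) i ij(2)[symmetric]]
        coupling_sym[OF ij(1) i] flip_commute[of i j]
      by (simp add: algebra_simps)
  qed
  have "\<delta> i (L u) x = (\<Sum>j\<in>I. T j)"
    by (simp add: delta_star_def[of _ _ _ "L u"] generator_eq[of u] T_def sum_distrib_left sum_subtractf
        right_diff_distrib)
  also have "\<dots> = T i + (\<Sum>j\<in>I - {i}. T j)"
    using i by (intro sum.remove) auto
  also have "\<dots> = T i + ((\<Sum>j\<in>I - {i}. q j x * (\<delta> i u (flip j x) - \<delta> i u x)) +
      (\<Sum>j\<in>I - {i}. (coupling i j x - 1) * (q i x * \<delta> j u x - q j x * \<delta> i u x)))"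
    by (simp add: T sum.distrib)
  also have "\<dots> = L (\<delta> i u) x +
      (\<Sum>j\<in>I - {i}. (coupling i j x - 1) * (q i x * \<delta> j u x - q j x * \<delta> i u x))"
    using i by (simp add: generator_def sum.remove[of I i] T_def)
  finally show ?thesis .
qed

text \<open>
  A bound for the row sums of \<open>M\<close>, which in turn bounds the entries of the zeroth-order matrix above.
\<close>
definition \<kappa> :: real where "\<kappa> = C * exp (3 * C)"
definition M :: "nat \<Rightarrow> nat \<Rightarrow> real" where "M i j = \<bar>J i j\<bar> * exp (3 * C)"

lemma \<kappa>_pos: "\<kappa> > 0" using Cpos by (simp add: \<kappa>_def)
lemma M_nonneg: "M i j \<ge> 0" by (simp add: M_def)
lemma M_sym: "i \<in> I \<Longrightarrow> j \<in> I \<Longrightarrow> M i j = M j i" by (simp add: M_def J_sym)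

lemma M_row: "i \<in> I \<Longrightarrow> (\<Sum>j\<in>I. M i j) \<le> \<kappa>"
  using row_sum_le[of i] by (simp add: M_def \<kappa>_def sum_distrib_right[symmetric])

lemma abs_exp_minus_one: "\<bar>exp (a::real) - 1\<bar> \<le> \<bar>a\<bar> * exp \<bar>a\<bar>"
proof (cases "a \<ge> 0")
  case True
  have "exp a * (1 - a) \<le> exp a * exp (- a)"
    using exp_ge_add_one_self[of "-a"] by (intro mult_left_mono) auto
  then have "exp a - 1 \<le> a * exp a" by (simp add: exp_minus algebra_simps)
  then show ?thesis using True by simp
next
  case False
  have "1 - exp a \<le> - a" using exp_ge_add_one_self[of a] by linarith
  also have "\<dots> \<le> - a * exp (- a)" using False by simp
  finally show ?thesis using False by simp
qed

lemma coupling_bound: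
  assumes x: "x \<in> \<Omega>" and ij: "i \<in> I" "j \<in> I" and k: "k \<in> I"
  shows "\<bar>coupling i j x - 1\<bar> * q k x \<le> M i j"
proof -
  have "\<bar>2 * x i * x j * J i j\<bar> = 2 * \<bar>J i j\<bar>"
    using cube_abs[OF x ij(1)] cube_abs[OF x ij(2)] by (simp add: abs_mult)
  then have "\<bar>coupling i j x - 1\<bar> \<le> 2 * \<bar>J i j\<bar> * exp (2 * \<bar>J i j\<bar>)"
    using abs_exp_minus_one[of "2 * x i * x j * J i j"] by (simp add: coupling_def)
  also have "\<dots> \<le> 2 * \<bar>J i j\<bar> * exp (2 * C)"
    using J_le[OF ij] by (intro mult_left_mono) auto
  finally have "\<bar>coupling i j x - 1\<bar> * q k x \<le> (2 * \<bar>J i j\<bar> * exp (2 * C)) * (exp C / 2)"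
    using q_bounds[OF x k] by (intro mult_mono) auto
  also have "\<dots> = M i j"
    unfolding M_def using exp_add[of "2 * C" C] by (simp add: mult_ac)
  finally show ?thesis .
qed

text \<open>
  Termwise differentiation of the exponential series; \<open>L\<close> is a finite sum and passes through it.
\<close>
lemma P_deriv:
  assumes x: "x \<in> \<Omega>"
  shows "((\<lambda>t. P t f x) has_real_derivative L (P t f) x) (at t)"
proof -
  define c where "c = (\<lambda>x k. (L ^^ k) f x / fact k)"
  have c: "t ^ k / fact k * (L ^^ k) f y = c y k * t ^ k" for t k y
    by (simp add: c_def)
  have P: "P t f y = (\<Sum>k. c y k * t ^ k)" for t y
    unfolding semigroup_P_def c ..
  have sm: "summable (\<lambda>k. c y k * t ^ k)" if "y \<in> \<Omega>" for y t
    using summable_semigroup_P[OF that, of t J f] unfolding c .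
  have "((\<lambda>t. P t f x) has_real_derivative (\<Sum>k. diffs (c x) k * t ^ k)) (at t)"
    unfolding P by (rule termdiffs_strong_converges_everywhere[OF sm[OF x]])
  moreover have "(\<Sum>k. diffs (c x) k * t ^ k) = L (P t f) x"
  proof -
    have "diffs (c x) k * t ^ k = (\<Sum>i\<in>I. q i x * (c (flip i x) k * t ^ k - c x k * t ^ k))" for k
    proof -
      have "diffs (c x) k = L ((L ^^ k) f) x / fact k"
        by (simp add: diffs_def c_def field_simps del: of_nat_Suc)
      also have "\<dots> = (\<Sum>i\<in>I. q i x * (c (flip i x) k - c x k))"
        unfolding generator_def c_def sum_divide_distrib
        by (simp only: diff_divide_distrib[symmetric] times_divide_eq_right)
      finally have "diffs (c x) k * t ^ k = (\<Sum>i\<in>I. q i x * (c (flip i x) k - c x k) * t ^ k)"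
        by (simp add: sum_distrib_right)
      then show ?thesis by (simp only: mult.assoc left_diff_distrib)
    qed
    then have "(\<Sum>k. diffs (c x) k * t ^ k) = (\<Sum>k. \<Sum>i\<in>I. q i x * (c (flip i x) k * t ^ k - c x k * t ^ k))"
      by simp
    also have "\<dots> = (\<Sum>i\<in>I. \<Sum>k. q i x * (c (flip i x) k * t ^ k - c x k * t ^ k))"
      by (intro suminf_sum summable_mult summable_diff sm) (use x flip_in_cube in auto)
    also have "\<dots> = (\<Sum>i\<in>I. q i x * ((\<Sum>k. c (flip i x) k * t ^ k) - (\<Sum>k. c x k * t ^ k)))"
    proof (intro sum.cong refl)
      fix i assume "i \<in> I"
      then have s: "summable (\<lambda>k. c (flip i x) k * t ^ k)" "summable (\<lambda>k. c x k * t ^ k)"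
        using sm x flip_in_cube by auto
      show "(\<Sum>k. q i x * (c (flip i x) k * t ^ k - c x k * t ^ k)) =
        q i x * ((\<Sum>k. c (flip i x) k * t ^ k) - (\<Sum>k. c x k * t ^ k))"
        using suminf_mult[OF summable_diff[OF s]] suminf_diff[OF s] by simp
    qed
    also have "\<dots> = L (P t f) x" by (simp add: generator_def P)
    finally show ?thesis .
  qed
  ultimately show ?thesis by simp
qed

lemma P_zero: "P 0 f x = f x"
proof -
  have "(\<lambda>k. 0 ^ k / fact k * (L ^^ k) f x) = (\<lambda>k. if k = 0 then f x else 0)" by auto
  then show ?thesis unfolding semigroup_P_def using sums_unique[OF sums_single[of 0 "\<lambda>_. f x"]] by simp
qed

lemma L_at_min:
  assumes "x \<in> \<Omega>" "\<And>y. y \<in> \<Omega> \<Longrightarrow> f x \<le> f y"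
  shows "0 \<le> L f x"
  unfolding generator_def
  by (intro sum_nonneg mult_nonneg_nonneg less_imp_le[OF q_bounds(3)]) (use assms flip_in_cube in auto)

lemma generator_linear: "L (\<lambda>x. a * f x + b * g x) x = a * L f x + b * L g x"
  by (simp add: generator_def sum_distrib_left sum.distrib[symmetric] algebra_simps)

text \<open>
  At a common minimum \<open>L u \<ge> 0\<close> because all rates are nonnegative.
\<close>
lemma supersolution_nonneg:
  assumes der: "\<And>x t. x \<in> \<Omega> \<Longrightarrow> 0 \<le> t \<Longrightarrow> t \<le> T \<Longrightarrow> ((\<lambda>t. u t x) has_real_derivative u' t x) (at t)"
    and super: "\<And>x t. x \<in> \<Omega> \<Longrightarrow> 0 < t \<Longrightarrow> t \<le> T \<Longrightarrow> L (u t) x \<le> u' t x"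
    and init: "\<And>x. x \<in> \<Omega> \<Longrightarrow> 0 \<le> u 0 x"
    and x: "x \<in> \<Omega>" and t: "0 \<le> t" "t \<le> T"
  shows "0 \<le> u t x"
proof (rule touching_minimum_principle[where A = \<Omega> and y = "\<lambda>x t. u t x" and \<kappa> = 0 and y' = "\<lambda>x t. u' t x" and T = T])
  show "continuous_on {0..T} (\<lambda>t. u t y)" if "y \<in> \<Omega>" for y
    by (intro continuous_at_imp_continuous_on ballI DERIV_isCont[OF der]) (use that in auto)
  fix y s assume "y \<in> \<Omega>" "0 < s" "s \<le> T" "u s y < 0" and "\<And>b. b \<in> \<Omega> \<Longrightarrow> u s y \<le> u s b"
  then have "0 \<le> L (u s) y" by (intro L_at_min) auto
  then show "0 * u s y \<le> u' s y" using super[of y s] \<open>y \<in> \<Omega>\<close> \<open>0 < s\<close> \<open>s \<le> T\<close> by simp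
qed (use der init x t in auto)

text \<open>
  Positivity, linearity, conservation of constants and the semigroup law all follow by exhibiting a
  second solution of the same initial value problem.
\<close>
lemma P_unique:
  assumes der: "\<And>x t. x \<in> \<Omega> \<Longrightarrow> 0 \<le> t \<Longrightarrow> ((\<lambda>t. u t x) has_real_derivative L (u t) x) (at t)"
    and x: "x \<in> \<Omega>" and t: "0 \<le> t" and init: "\<And>x. x \<in> \<Omega> \<Longrightarrow> u 0 x = f x"
  shows "P t f x = u t x"
proof -
  have "0 \<le> c * (P t f x - u t x)" for c
  proof (rule supersolution_nonneg[where u = "\<lambda>t x. c * (P t f x - u t x)" and T = t and
        u' = "\<lambda>t x. c * (L (P t f) x - L (u t) x)"])
    fix y s assume "y \<in> \<Omega>" "0 \<le> s" "s \<le> t"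
    then show "((\<lambda>t. c * (P t f y - u t y)) has_real_derivative c * (L (P s f) y - L (u s) y)) (at s)"
      by (intro DERIV_cmult DERIV_diff P_deriv der)
  next
    fix y s
    show "L (\<lambda>x. c * (P s f x - u s x)) y \<le> c * (L (P s f) y - L (u s) y)"
      using generator_linear[of c "P s f" "-c" "u s" y] by (simp add: algebra_simps)
  qed (use x t init in \<open>auto simp: P_zero\<close>)
  from this[of 1] this[of "-1"] show ?thesis by simp
qed

lemma P_nonneg: "x \<in> \<Omega> \<Longrightarrow> 0 \<le> t \<Longrightarrow> (\<And>y. y \<in> \<Omega> \<Longrightarrow> 0 \<le> f y) \<Longrightarrow> 0 \<le> P t f x"
  by (rule supersolution_nonneg[where u = "\<lambda>t. P t f" and u' = "\<lambda>t. L (P t f)" and T = t])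
     (auto simp: P_zero P_deriv)

lemma P_linear:
  assumes x: "x \<in> \<Omega>" and t: "0 \<le> t"
  shows "P t (\<lambda>x. a * f x + b * g x) x = a * P t f x + b * P t g x"
proof (rule P_unique[OF _ x t])
  fix x t assume "x \<in> \<Omega>"
  then show "((\<lambda>t. a * P t f x + b * P t g x) has_real_derivative L (\<lambda>x. a * P t f x + b * P t g x) x) (at t)"
    unfolding generator_linear by (intro DERIV_add DERIV_cmult P_deriv)
qed (simp add: P_zero)

lemma P_cong:
  assumes "x \<in> \<Omega>" "0 \<le> t" "\<And>y. y \<in> \<Omega> \<Longrightarrow> f y = g y"
  shows "P t f x = P t g x"
  by (rule P_unique[OF P_deriv assms(1,2)]) (auto simp: P_zero assms(3))

lemma P_const: "x \<in> \<Omega> \<Longrightarrow> 0 \<le> t \<Longrightarrow> P t (\<lambda>_. c) x = c"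
  by (rule P_unique) (auto simp: generator_def)

lemma P_mono:
  assumes "x \<in> \<Omega>" "0 \<le> t" "\<And>y. y \<in> \<Omega> \<Longrightarrow> f y \<le> g y"
  shows "P t f x \<le> P t g x"
proof -
  have "0 \<le> P t (\<lambda>x. 1 * g x + (-1) * f x) x"
    by (rule P_nonneg[OF assms(1,2)]) (use assms(3) in auto)
  then show ?thesis unfolding P_linear[OF assms(1,2)] by simp
qed

lemma P_semigroup:
  assumes x: "x \<in> \<Omega>" and st: "0 \<le> s" "0 \<le> t"
  shows "P t (P s f) x = P (s + t) f x"
proof (rule P_unique[OF _ x st(2)])
  fix x r assume x: "x \<in> \<Omega>"
  have "((\<lambda>t. s + t) has_real_derivative 1) (at r)" by (auto intro!: derivative_eq_intros)
  from DERIV_chain2[OF P_deriv[OF x] this]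
  show "((\<lambda>t. P (s + t) f x) has_real_derivative L (P (s + r) f) x) (at r)" by simp
qed simp

lemma P_sum:
  assumes x: "x \<in> \<Omega>" and t: "0 \<le> t" and "finite A"
  shows "P t (\<lambda>x. \<Sum>a\<in>A. g a x) x = (\<Sum>a\<in>A. P t (g a) x)"
  using assms(3)
proof (induction A rule: finite_induct)
  case (insert a A)
  then show ?case using P_linear[OF x t, of 1 "g a" 1 "\<lambda>x. \<Sum>a\<in>A. g a x"] by simp
qed (simp add: P_const[OF x t])

lemma P_abs:
  assumes x: "x \<in> \<Omega>" and t: "0 \<le> t"
  shows "\<bar>P t f x\<bar> \<le> P t (\<lambda>x. \<bar>f x\<bar>) x"
proof -
  have "P t f x \<le> P t (\<lambda>x. \<bar>f x\<bar>) x" "P t (\<lambda>x. (-1) * f x + 0 * f x) x \<le> P t (\<lambda>x. \<bar>f x\<bar>) x"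
    by (rule P_mono[OF x t]; simp)+
  then show ?thesis unfolding P_linear[OF x t] by simp
qed

end

section \<open>The local Bobkov inequality\<close>

lemma DERIV_square:
  fixes f :: "real \<Rightarrow> real"
  assumes "(f has_real_derivative D) (at x)"
  shows "((\<lambda>x. (f x)\<^sup>2) has_real_derivative 2 * (f x * D)) (at x)"
  using DERIV_power[OF assms, of 2] by (simp add: mult_ac)

context ising_model begin

text \<open>
  A Schur test: \<open>\<bar>v\<^sub>i v\<^sub>j\<bar> \<le> (v\<^sub>i\<^sup>2 + v\<^sub>j\<^sup>2) / 2\<close>, and \<open>M\<close> is symmetric with row sums at most \<open>\<kappa>\<close>.
\<close>
lemma drift_bound:
  assumes x: "x \<in> \<Omega>"
  shows "(\<Sum>i\<in>I. v i * (\<Sum>j\<in>I - {i}. (coupling i j x - 1) * (q i x * v j - q j x * v i)))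
           \<le> 2 * \<kappa> * (\<Sum>i\<in>I. (v i)\<^sup>2)"
proof -
  have S: "v i * (\<Sum>j\<in>I - {i}. (coupling i j x - 1) * (q i x * v j - q j x * v i))
      \<le> (\<Sum>j\<in>I. M i j * (3 / 2 * (v i)\<^sup>2 + 1 / 2 * (v j)\<^sup>2))" if i: "i \<in> I" for i
  proof -
    have "v i * (\<Sum>j\<in>I - {i}. (coupling i j x - 1) * (q i x * v j - q j x * v i)) =
        (\<Sum>j\<in>I - {i}. v i * ((coupling i j x - 1) * (q i x * v j - q j x * v i)))"
      by (simp add: sum_distrib_left)
    also have "\<dots> \<le> (\<Sum>j\<in>I - {i}. M i j * (3 / 2 * (v i)\<^sup>2 + 1 / 2 * (v j)\<^sup>2))"
    proof (rule sum_mono)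
      fix j assume "j \<in> I - {i}"
      then have j: "j \<in> I" by auto
      define r where "r = coupling i j x - 1"
      have b: "\<bar>r\<bar> * q i x \<le> M i j" "\<bar>r\<bar> * q j x \<le> M i j"
        unfolding r_def using coupling_bound[OF x i j] i j by auto
      have "v i * (r * (q i x * v j - q j x * v i)) = (r * q i x) * (v i * v j) - (r * q j x) * (v i * v i)"
        by (simp add: algebra_simps)
      also have "\<dots> \<le> \<bar>(r * q i x) * (v i * v j)\<bar> + \<bar>(r * q j x) * (v i * v i)\<bar>"
        by linarith
      also have "\<dots> = (\<bar>r\<bar> * q i x) * (\<bar>v i\<bar> * \<bar>v j\<bar>) + (\<bar>r\<bar> * q j x) * (\<bar>v i\<bar> * \<bar>v i\<bar>)"
        using q_bounds(3)[OF x i] q_bounds(3)[OF x j] by (simp add: abs_mult)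
      also have "\<dots> \<le> M i j * (\<bar>v i\<bar> * \<bar>v j\<bar>) + M i j * (\<bar>v i\<bar> * \<bar>v i\<bar>)"
        by (intro add_mono mult_right_mono b) auto
      also have "\<dots> = M i j * (\<bar>v i\<bar> * \<bar>v j\<bar> + (v i)\<^sup>2)"
        by (simp add: power2_eq_square algebra_simps)
      also have "\<dots> \<le> M i j * (3 / 2 * (v i)\<^sup>2 + 1 / 2 * (v j)\<^sup>2)"
      proof (intro mult_left_mono M_nonneg)
        have "0 \<le> (\<bar>v i\<bar> - \<bar>v j\<bar>)\<^sup>2" by simp
        then have "2 * (\<bar>v i\<bar> * \<bar>v j\<bar>) \<le> (v i)\<^sup>2 + (v j)\<^sup>2"
          unfolding power2_diff by simp
        then show "\<bar>v i\<bar> * \<bar>v j\<bar> + (v i)\<^sup>2 \<le> 3 / 2 * (v i)\<^sup>2 + 1 / 2 * (v j)\<^sup>2" by simp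
      qed
      finally show "v i * ((coupling i j x - 1) * (q i x * v j - q j x * v i))
          \<le> M i j * (3 / 2 * (v i)\<^sup>2 + 1 / 2 * (v j)\<^sup>2)" unfolding r_def .
    qed
    also have "\<dots> \<le> (\<Sum>j\<in>I. M i j * (3 / 2 * (v i)\<^sup>2 + 1 / 2 * (v j)\<^sup>2))"
      by (intro sum_mono2) (auto intro!: mult_nonneg_nonneg M_nonneg add_nonneg_nonneg)
    finally show ?thesis .
  qed
  have "(\<Sum>i\<in>I. v i * (\<Sum>j\<in>I - {i}. (coupling i j x - 1) * (q i x * v j - q j x * v i)))
      \<le> (\<Sum>i\<in>I. \<Sum>j\<in>I. M i j * (3 / 2 * (v i)\<^sup>2 + 1 / 2 * (v j)\<^sup>2))"
    by (intro sum_mono S)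
  also have "\<dots> = (\<Sum>i\<in>I. \<Sum>j\<in>I. M i j * (3 / 2 * (v i)\<^sup>2)) + (\<Sum>i\<in>I. \<Sum>j\<in>I. M i j * (1 / 2 * (v j)\<^sup>2))"
    by (simp only: distrib_left sum.distrib)
  also have "(\<Sum>i\<in>I. \<Sum>j\<in>I. M i j * (1 / 2 * (v j)\<^sup>2)) = (\<Sum>j\<in>I. \<Sum>i\<in>I. M i j * (1 / 2 * (v j)\<^sup>2))"
    by (rule sum.swap)
  also have "\<dots> = (\<Sum>i\<in>I. \<Sum>j\<in>I. M i j * (1 / 2 * (v i)\<^sup>2))"
    by (intro sum.cong refl arg_cong2[where f = "(*)"] M_sym)
  also have "(\<Sum>i\<in>I. \<Sum>j\<in>I. M i j * (3 / 2 * (v i)\<^sup>2)) + (\<Sum>i\<in>I. \<Sum>j\<in>I. M i j * (1 / 2 * (v i)\<^sup>2))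
      = (\<Sum>i\<in>I. (\<Sum>j\<in>I. M i j) * (2 * (v i)\<^sup>2))"
    unfolding sum.distrib[symmetric] sum_distrib_right
    by (intro sum.cong refl) (simp add: algebra_simps)
  also have "\<dots> \<le> (\<Sum>i\<in>I. \<kappa> * (2 * (v i)\<^sup>2))"
    by (intro sum_mono mult_right_mono M_row) auto
  also have "\<dots> = 2 * \<kappa> * (\<Sum>i\<in>I. (v i)\<^sup>2)"
    by (simp add: sum_distrib_left mult_ac)
  finally show ?thesis .
qed

lemma sqrt_cauchy_schwarz:
  fixes a a' g :: real
  assumes g: "0 \<le> g" and I: "finite I"
  shows "a * a' + g * (\<Sum>i\<in>I. v i * v' i) \<le>
     sqrt (a\<^sup>2 + g * (\<Sum>i\<in>I. (v i)\<^sup>2)) * sqrt (a'\<^sup>2 + g * (\<Sum>i\<in>I. (v' i)\<^sup>2))"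
proof -
  define z where "z = case_option a (\<lambda>i. sqrt g * v i)"
  define z' where "z' = case_option a' (\<lambda>i. sqrt g * v' i)"
  have sum: "(\<Sum>i\<in>insert None (Some ` I). F i) = F None + (\<Sum>i\<in>I. F (Some i))" for F :: "_ \<Rightarrow> real"
    using I by (subst sum.insert) (auto simp: sum.reindex)
  have m: "sqrt g * a * (sqrt g * b) = g * (a * b)" for a b
  proof -
    have "sqrt g * a * (sqrt g * b) = (sqrt g * sqrt g) * (a * b)" by (simp only: mult_ac)
    then show ?thesis using g by simp
  qed
  have "(\<Sum>i\<in>insert None (Some ` I). z i * z' i) \<le> \<bar>\<Sum>i\<in>insert None (Some ` I). z i * z' i\<bar>" by simp
  also have "\<dots> \<le> sqrt ((\<Sum>i\<in>insert None (Some ` I). (z i)\<^sup>2) * (\<Sum>i\<in>insert None (Some ` I). (z' i)\<^sup>2))"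
    using Cauchy_Schwarz_ineq_sum[of z z' "insert None (Some ` I)"] by (intro real_le_rsqrt) simp
  also have "\<dots> = sqrt (\<Sum>i\<in>insert None (Some ` I). (z i)\<^sup>2) * sqrt (\<Sum>i\<in>insert None (Some ` I). (z' i)\<^sup>2)"
    by (rule real_sqrt_mult)
  finally have "(\<Sum>i\<in>insert None (Some ` I). z i * z' i) \<le>
      sqrt (\<Sum>i\<in>insert None (Some ` I). (z i)\<^sup>2) * sqrt (\<Sum>i\<in>insert None (Some ` I). (z' i)\<^sup>2)" .
  moreover have "(\<Sum>i\<in>insert None (Some ` I). z i * z' i) = a * a' + g * (\<Sum>i\<in>I. v i * v' i)"
    unfolding sum by (simp add: z_def z'_def sum_distrib_left m)
  moreover have "(\<Sum>i\<in>insert None (Some ` I). (z i)\<^sup>2) = a\<^sup>2 + g * (\<Sum>i\<in>I. (v i)\<^sup>2)"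
    unfolding sum using g by (simp add: z_def sum_distrib_left power_mult_distrib)
  moreover have "(\<Sum>i\<in>insert None (Some ` I). (z' i)\<^sup>2) = a'\<^sup>2 + g * (\<Sum>i\<in>I. (v' i)\<^sup>2)"
    unfolding sum using g by (simp add: z'_def sum_distrib_left power_mult_distrib)
  ultimately show ?thesis by simp
qed

abbreviation "\<Gamma> \<equiv> Gamma_star n J"

definition bobkov_fun :: "real \<Rightarrow> ((nat \<Rightarrow> real) \<Rightarrow> real) \<Rightarrow> (nat \<Rightarrow> real) \<Rightarrow> real" where
  "bobkov_fun g u x = sqrt ((gauss_profile (u x))\<^sup>2 + g * \<Gamma> u x)"

lemma \<Gamma>_nonneg: "\<Gamma> u x \<ge> 0"
  by (simp add: Gamma_star_def sum_nonneg)

lemma bobkov_fun_pos: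
  assumes "0 < u x" "u x < 1" "0 \<le> g"
  shows "bobkov_fun g u x > 0"
  unfolding bobkov_fun_def using gauss_profile_pos[OF assms(1,2)] \<Gamma>_nonneg[of u x] assms(3)
  by (simp add: add_pos_nonneg)

text \<open>
  The function is the Euclidean norm of the vector \<open>(I(u), sqrt g \<delta>\<^sub>1 u, \<dots>, sqrt g \<delta>\<^sub>n u)\<close>. By Cauchy--Schwarz
  the generator may be applied to each component of the vector separately. The first component then
  produces the Bregman divergences of the profile, each at most \<open>4 (u(x\<^sup>j) - u(x))\<^sup>2\<close>; the others produce
  the commutators of \<open>\<delta>_generator\<close>.
\<close>
lemma bobkov_generator:
  assumes u: "\<And>y. y \<in> \<Omega> \<Longrightarrow> 0 < u y \<and> u y < 1" and g: "0 \<le> g" and x: "x \<in> \<Omega>"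
  shows "- gauss_profile (u x) * gauss_quantile (u x) * L u x + g * (\<Sum>i\<in>I. \<delta> i u x * \<delta> i (L u) x)
     - (2 * \<kappa> * g + 8 * exp C) * \<Gamma> u x \<le> bobkov_fun g u x * L (bobkov_fun g u) x"
proof -
  let ?G = "bobkov_fun g u"
  let ?p = "\<lambda>y. gauss_profile (u y)"
  have G2: "?G x * ?G x = ?p x * ?p x + g * (\<Sum>i\<in>I. \<delta> i u x * \<delta> i u x)"
  proof -
    have "?G x * ?G x = (?p x)\<^sup>2 + g * \<Gamma> u x"
      unfolding bobkov_fun_def using g \<Gamma>_nonneg[of u x] by simp
    then show ?thesis by (simp add: Gamma_star_def power2_eq_square)
  qed
  have pt: "?G x * (?G (flip j x) - ?G x) \<ge>
      - ?p x * gauss_quantile (u x) * (u (flip j x) - u x) - 4 * (u (flip j x) - u x)\<^sup>2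
      + g * (\<Sum>i\<in>I. \<delta> i u x * (\<delta> i u (flip j x) - \<delta> i u x))" if j: "j \<in> I" for j
  proof -
    have "?p x * ?p (flip j x) + g * (\<Sum>i\<in>I. \<delta> i u x * \<delta> i u (flip j x)) \<le> ?G x * ?G (flip j x)"
      unfolding bobkov_fun_def Gamma_star_def by (rule sqrt_cauchy_schwarz[OF g]) simp
    moreover have "?p x * (?p x - ?p (flip j x) - gauss_quantile (u x) * (u (flip j x) - u x)) \<le> 4 * (u (flip j x) - u x)\<^sup>2"
      using u[OF x] u[OF flip_in_cube[OF x j]] by (intro gauss_profile_bregman) auto
    ultimately show ?thesis
      using G2 by (simp add: algebra_simps sum_subtractf)
  qed
  have "?G x * L ?G x = (\<Sum>j\<in>I. q j x * (?G x * (?G (flip j x) - ?G x)))"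
    by (simp add: generator_def sum_distrib_left mult_ac)
  also have "\<dots> \<ge> (\<Sum>j\<in>I. q j x * (- ?p x * gauss_quantile (u x) * (u (flip j x) - u x)
      - 4 * (u (flip j x) - u x)\<^sup>2 + g * (\<Sum>i\<in>I. \<delta> i u x * (\<delta> i u (flip j x) - \<delta> i u x))))"
    by (intro sum_mono mult_left_mono pt less_imp_le[OF q_bounds(3)[OF x]])
  also have "(\<Sum>j\<in>I. q j x * (- ?p x * gauss_quantile (u x) * (u (flip j x) - u x)
      - 4 * (u (flip j x) - u x)\<^sup>2 + g * (\<Sum>i\<in>I. \<delta> i u x * (\<delta> i u (flip j x) - \<delta> i u x))))
    = - ?p x * gauss_quantile (u x) * L u x - 4 * (\<Sum>j\<in>I. q j x * (u (flip j x) - u x)\<^sup>2)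
      + g * (\<Sum>j\<in>I. \<Sum>i\<in>I. q j x * (\<delta> i u x * (\<delta> i u (flip j x) - \<delta> i u x)))"
    unfolding generator_def
    by (simp add: sum.distrib sum_subtractf sum_negf sum_distrib_left algebra_simps)
  also have "(\<Sum>j\<in>I. \<Sum>i\<in>I. q j x * (\<delta> i u x * (\<delta> i u (flip j x) - \<delta> i u x))) =
      (\<Sum>i\<in>I. \<delta> i u x * L (\<delta> i u) x)"
    by (subst sum.swap) (simp add: generator_def sum_distrib_left mult_ac)
  finally have 1: "- ?p x * gauss_quantile (u x) * L u x - 4 * (\<Sum>j\<in>I. q j x * (u (flip j x) - u x)\<^sup>2)
      + g * (\<Sum>i\<in>I. \<delta> i u x * L (\<delta> i u) x) \<le> ?G x * L ?G x" .
  have 2: "(\<Sum>j\<in>I. q j x * (u (flip j x) - u x)\<^sup>2) \<le> 2 * exp C * \<Gamma> u x"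
  proof -
    have "q j x * (u (flip j x) - u x)\<^sup>2 \<le> 2 * exp C * (\<delta> j u x)\<^sup>2" if j: "j \<in> I" for j
    proof -
      have "q j x * 1 \<le> q j x * (2 * exp C * q j x)"
      proof (rule mult_left_mono)
        have "1 = 2 * exp C * (exp (- C) / 2)" by (simp add: exp_minus)
        also have "\<dots> \<le> 2 * exp C * q j x" by (intro mult_left_mono q_bounds x j) auto
        finally show "1 \<le> 2 * exp C * q j x" .
      qed (use q_bounds(3)[OF x j] in simp)
      then have "q j x * (u (flip j x) - u x)\<^sup>2 \<le> (q j x * (2 * exp C * q j x)) * (u (flip j x) - u x)\<^sup>2"
        by (intro mult_right_mono) auto
      also have "\<dots> = 2 * exp C * (\<delta> j u x)\<^sup>2" by (simp add: delta_star_def power2_eq_square mult_ac)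
      finally show ?thesis .
    qed
    then show ?thesis unfolding Gamma_star_def sum_distrib_left by (rule sum_mono)
  qed
  have 3: "(\<Sum>i\<in>I. \<delta> i u x * \<delta> i (L u) x) - 2 * \<kappa> * \<Gamma> u x \<le> (\<Sum>i\<in>I. \<delta> i u x * L (\<delta> i u) x)"
    using drift_bound[OF x, of "\<lambda>i. \<delta> i u x"]
    by (simp add: \<delta>_generator[OF x] Gamma_star_def sum.distrib distrib_left)
  have "g * ((\<Sum>i\<in>I. \<delta> i u x * \<delta> i (L u) x) - 2 * \<kappa> * \<Gamma> u x) \<le> g * (\<Sum>i\<in>I. \<delta> i u x * L (\<delta> i u) x)"
    by (rule mult_left_mono[OF 3 g])
  with 1 2 show ?thesis by (simp add: algebra_simps)
qed

text \<open>
  With these values, \<open>\<gamma>\<close> is the solution of \<open>\<gamma>' / 2 = 2 \<kappa> \<gamma> + 8 exp C\<close> that vanishes at \<open>0\<close>, which is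
  exactly the coefficient of \<open>\<Gamma>\<close> lost in \<open>bobkov_generator\<close>.
\<close>
definition b_const :: real where "b_const = exp (- C) / 4"
definition \<rho>_const :: real where "\<rho>_const = - 2 * \<kappa>"
abbreviation "\<gamma> \<equiv> bobkov_gamma b_const \<rho>_const"

lemma \<gamma>_eq: "\<gamma> s = 4 * exp C * (exp (4 * \<kappa> * s) - 1) / \<kappa>"
  using \<kappa>_pos by (simp add: bobkov_gamma_def b_const_def \<rho>_const_def exp_minus field_simps)

lemma \<gamma>_deriv: "(\<gamma> has_real_derivative 4 * \<kappa> * \<gamma> s + 16 * exp C) (at s)"
  unfolding \<gamma>_eq[abs_def] using \<kappa>_pos
  by (auto intro!: derivative_eq_intros simp: field_simps)

lemma \<gamma>_nonneg: "0 \<le> s \<Longrightarrow> 0 \<le> \<gamma> s"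
  unfolding \<gamma>_eq using \<kappa>_pos by simp

lemma \<gamma>_zero: "\<gamma> 0 = 0"
  by (simp add: \<gamma>_eq)

lemma \<delta>_P_deriv:
  assumes "x \<in> \<Omega>" "i \<in> I"
  shows "((\<lambda>t. \<delta> i (P t f) x) has_real_derivative \<delta> i (L (P t f)) x) (at t)"
  unfolding delta_star_def
  by (intro DERIV_cmult DERIV_diff P_deriv) (use assms flip_in_cube in auto)

lemma P_bounds:
  assumes "x \<in> \<Omega>" "0 \<le> t" "\<And>y. y \<in> \<Omega> \<Longrightarrow> a \<le> f y \<and> f y \<le> b"
  shows "a \<le> P t f x \<and> P t f x \<le> b"
  using P_mono[OF assms(1,2), of "\<lambda>_. a" f] P_mono[OF assms(1,2), of f "\<lambda>_. b"] assms
  by (simp add: P_const)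

text \<open>
  The difference between \<open>P\<^sub>\<tau> G\<^sub>0\<close> and \<open>G\<^sub>\<tau> = sqrt (I(P\<^sub>\<tau> f)\<^sup>2 + \<gamma>(t - \<tau>) \<Gamma>(P\<^sub>\<tau> f))\<close> is a supersolution that starts
  at \<open>0\<close>. Keeping the values of \<open>f\<close> away from \<open>0\<close> and \<open>1\<close> makes \<open>G\<close> positive, hence differentiable in \<open>\<tau>\<close>.
\<close>
lemma local_bobkov_interior:
  assumes f: "\<And>y. y \<in> \<Omega> \<Longrightarrow> e \<le> f y \<and> f y \<le> 1 - e" and e: "e > 0"
    and x: "x \<in> \<Omega>" and t: "0 \<le> t"
  shows "gauss_profile (P t f x) \<le> P t (bobkov_fun (\<gamma> t) f) x"
proof -
  define G0 where "G0 = bobkov_fun (\<gamma> t) f"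
  define G where "G = (\<lambda>s. bobkov_fun (\<gamma> (t - s)) (P s f))"
  define G' where "G' = (\<lambda>s x. (- gauss_profile (P s f x) * gauss_quantile (P s f x) * L (P s f) x
      + \<gamma> (t - s) * (\<Sum>i\<in>I. \<delta> i (P s f) x * \<delta> i (L (P s f)) x)
      - (2 * \<kappa> * \<gamma> (t - s) + 8 * exp C) * \<Gamma> (P s f) x) / G s x)"
  have u: "0 < P s f y \<and> P s f y < 1" if "y \<in> \<Omega>" "0 \<le> s" for s y
  proof -
    have "e \<le> P s f y \<and> P s f y \<le> 1 - e" by (rule P_bounds[OF that f])
    then show ?thesis using e by auto
  qed
  have Gpos: "0 < G s y" if "y \<in> \<Omega>" "0 \<le> s" "s \<le> t" for s y
    unfolding G_def using u[OF that(1,2)] \<gamma>_nonneg[of "t - s"] that by (intro bobkov_fun_pos) auto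
  have Gder: "((\<lambda>s. G s y) has_real_derivative G' s y) (at s)" if y: "y \<in> \<Omega>" and s: "0 \<le> s" "s \<le> t" for s y
  proof -
    define a where "a = (\<lambda>s. (gauss_profile (P s f y))\<^sup>2 + \<gamma> (t - s) * \<Gamma> (P s f) y)"
    have 1: "((\<lambda>s. gauss_profile (P s f y)) has_real_derivative - gauss_quantile (P s f y) * L (P s f) y) (at s)"
      by (rule DERIV_chain2[OF gauss_profile_deriv P_deriv[OF y]]) (use u[OF y s(1)] in auto)
    have 2: "((\<lambda>s. \<gamma> (t - s)) has_real_derivative - (4 * \<kappa> * \<gamma> (t - s) + 16 * exp C)) (at s)"
      using DERIV_chain2[OF \<gamma>_deriv DERIV_diff[OF DERIV_const DERIV_ident], of t s] by simp
    have 3: "((\<lambda>s. \<Gamma> (P s f) y) has_real_derivative (\<Sum>i\<in>I. 2 * (\<delta> i (P s f) y * \<delta> i (L (P s f)) y))) (at s)"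
      unfolding Gamma_star_def
      by (intro DERIV_sum DERIV_square \<delta>_P_deriv y)
    have a: "(a has_real_derivative 2 * (gauss_profile (P s f y) * (- gauss_quantile (P s f y) * L (P s f) y))
       + (- (4 * \<kappa> * \<gamma> (t - s) + 16 * exp C) * \<Gamma> (P s f) y +
          (\<Sum>i\<in>I. 2 * (\<delta> i (P s f) y * \<delta> i (L (P s f)) y)) * \<gamma> (t - s))) (at s)"
      unfolding a_def
      by (intro DERIV_add DERIV_mult DERIV_square 1 2 3)
    have pos: "0 < a s"
      using Gpos[OF y s] by (simp add: G_def bobkov_fun_def a_def)
    have sq: "G s y = sqrt (a s)" for s by (simp add: G_def bobkov_fun_def a_def)
    show ?thesis
      unfolding sq
      by (rule DERIV_cong[OF DERIV_chain2[OF DERIV_real_sqrt[OF pos] a]])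
         (use pos in \<open>simp add: G'_def sq sum_distrib_left[symmetric] field_simps\<close>)
  qed
  have "0 \<le> P t G0 x - G t x"
  proof (rule supersolution_nonneg[where u = "\<lambda>s x. P s G0 x - G s x" and T = t and
        u' = "\<lambda>s x. L (P s G0) x - G' s x"])
    fix y s assume y: "y \<in> \<Omega>" and s: "0 < s" "s \<le> t"
    have "G' s y * G s y \<le> G s y * L (G s) y"
      using bobkov_generator[of "P s f" "\<gamma> (t - s)" y] u y s \<gamma>_nonneg[of "t - s"] Gpos[OF y]
      by (simp add: G'_def G_def)
    then have "G' s y \<le> L (G s) y"
      using Gpos[OF y, of s] s by simp
    then show "L (\<lambda>x. P s G0 x - G s x) y \<le> L (P s G0) y - G' s y"
      using generator_linear[of 1 "P s G0" "-1" "G s" y] by simp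
  next
    fix y show "0 \<le> P 0 G0 y - G 0 y"
    proof -
      have "P 0 f = f" by (rule ext) (rule P_zero)
      then show ?thesis by (simp add: P_zero G0_def G_def)
    qed
  qed (use x t in \<open>auto intro!: DERIV_diff P_deriv Gder\<close>)
  moreover have "G t x = gauss_profile (P t f x)"
    by (simp add: G_def bobkov_fun_def \<gamma>_zero gauss_profile_nonneg)
  ultimately show ?thesis by (simp add: G0_def)
qed

lemma P_kernel:
  assumes "x \<in> \<Omega>" "0 \<le> t"
  shows "P t f x = (\<Sum>y\<in>\<Omega>. f y * P t (\<lambda>z. if z = y then 1 else 0) x)"
proof -
  have "P t f x = P t (\<lambda>z. \<Sum>y\<in>\<Omega>. f y * (if z = y then 1 else 0)) x"
    by (rule P_cong[OF assms]) (simp add: if_distrib cong: if_cong)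
  also have "\<dots> = (\<Sum>y\<in>\<Omega>. P t (\<lambda>z. f y * (if z = y then 1 else 0)) x)"
    by (rule P_sum[OF assms]) simp
  also have "\<dots> = (\<Sum>y\<in>\<Omega>. f y * P t (\<lambda>z. if z = y then 1 else 0) x)"
    using P_linear[OF assms, of "f _" _ 0 "\<lambda>_. 0"] by simp
  finally show ?thesis .
qed

lemma P_tendsto:
  assumes "x \<in> \<Omega>" "0 \<le> t" "\<And>y. y \<in> \<Omega> \<Longrightarrow> ((\<lambda>k. g k y) \<longlongrightarrow> f y) F"
  shows "((\<lambda>k. P t (g k) x) \<longlongrightarrow> P t f x) F"
  unfolding P_kernel[OF assms(1,2), of "g _"] P_kernel[OF assms(1,2), of f]
  by (intro tendsto_sum tendsto_mult tendsto_const assms(3))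

text \<open>
  Approximation of \<open>f\<close> by functions with values in the open interval, using continuity of the profile
  up to the end points.
\<close>
lemma local_bobkov:
  assumes f: "f \<in> \<Omega> \<rightarrow> {0..1}" and x: "x \<in> \<Omega>" and t: "0 \<le> t"
  shows "gauss_profile (P t f x) \<le> P t (\<lambda>y. sqrt ((gauss_profile (f y))\<^sup>2 + \<gamma> t * \<Gamma> f y)) x"
proof -
  define e where "e = (\<lambda>k. inverse (real (Suc (Suc k))))"
  have e0: "e \<longlonglongrightarrow> 0" unfolding e_def by (rule LIMSEQ_Suc[OF LIMSEQ_inverse_real_of_nat])
  have e: "0 < e k" "e k \<le> 1 / 2" for k by (auto simp: e_def field_simps)
  define g where "g = (\<lambda>k y. (1 - 2 * e k) * f y + e k * 1)"
  have f01: "0 \<le> f y" "f y \<le> 1" if "y \<in> \<Omega>" for y using f that by auto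
  have g: "e k \<le> g k y \<and> g k y \<le> 1 - e k" if "y \<in> \<Omega>" for k y
  proof -
    have c: "0 \<le> 1 - 2 * e k" using e[of k] by simp
    have "0 \<le> (1 - 2 * e k) * f y" "(1 - 2 * e k) * f y \<le> (1 - 2 * e k) * 1"
      using mult_nonneg_nonneg[OF c f01(1)[OF that]] mult_left_mono[OF f01(2)[OF that] c] by auto
    then show ?thesis by (simp add: g_def)
  qed
  have glim: "(\<lambda>k. g k y) \<longlonglongrightarrow> f y" for y
    unfolding g_def using tendsto_add[OF tendsto_mult[OF tendsto_diff[OF tendsto_const[of 1]
      tendsto_mult[OF tendsto_const[of 2] e0]] tendsto_const[of "f y"]] tendsto_mult[OF e0 tendsto_const[of 1]]]
    by simp
  have Plim: "(\<lambda>k. P t (g k) x) \<longlonglongrightarrow> P t f x"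
    by (rule P_tendsto[OF x t glim])
  have proflim: "(\<lambda>k. gauss_profile (h k)) \<longlonglongrightarrow> gauss_profile l"
    if "h \<longlonglongrightarrow> l" "\<And>k. h k \<in> {0..1}" "l \<in> {0..1}" for h l
    by (rule continuous_on_tendsto_compose[OF gauss_profile_continuous that(1,3)]) (use that in auto)
  have 1: "(\<lambda>k. gauss_profile (P t (g k) x)) \<longlonglongrightarrow> gauss_profile (P t f x)"
  proof (rule proflim[OF Plim])
    show "P t (g k) x \<in> {0..1}" for k
    proof -
      have "e k \<le> P t (g k) x \<and> P t (g k) x \<le> 1 - e k" by (rule P_bounds[OF x t g])
      then show ?thesis using e[of k] by auto
    qed
    show "P t f x \<in> {0..1}"
    proof -
      have "0 \<le> P t f x \<and> P t f x \<le> 1" by (rule P_bounds[OF x t]) (use f01 in auto)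
      then show ?thesis by auto
    qed
  qed
  have 2: "(\<lambda>k. bobkov_fun (\<gamma> t) (g k) y) \<longlonglongrightarrow> bobkov_fun (\<gamma> t) f y" if y: "y \<in> \<Omega>" for y
  proof -
    have "(\<lambda>k. gauss_profile (g k y)) \<longlonglongrightarrow> gauss_profile (f y)"
    proof (rule proflim[OF glim])
      show "g k y \<in> {0..1}" for k using g[OF y, of k] e[of k] by auto
    qed (use f01[OF y] in auto)
    then show ?thesis
      unfolding bobkov_fun_def Gamma_star_def delta_star_def
      by (intro tendsto_intros glim)
  qed
  have "(\<lambda>k. P t (bobkov_fun (\<gamma> t) (g k)) x) \<longlonglongrightarrow> P t (bobkov_fun (\<gamma> t) f) x"
    by (rule P_tendsto[OF x t 2])
  then have "gauss_profile (P t f x) \<le> P t (bobkov_fun (\<gamma> t) f) x"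
    by (rule LIMSEQ_le[OF 1]) (use local_bobkov_interior[OF g e(1) x t] in auto)
  then show ?thesis by (simp add: bobkov_fun_def[abs_def])
qed

end

section \<open>Conditional expectations and the chain rule of entropy\<close>

context ising_model begin

definition fib :: "nat set \<Rightarrow> (nat \<Rightarrow> real) \<Rightarrow> (nat \<Rightarrow> real) set" where
  "fib S x = {y \<in> \<Omega>. \<forall>i\<in>I - S. y i = x i}"

text \<open>
  The conditional expectation given the spins outside \<open>S\<close>, as an operator on functions of the whole
  configuration; this form makes the tower property an identity between operators.
\<close>
definition cex :: "nat set \<Rightarrow> ((nat \<Rightarrow> real) \<Rightarrow> real) \<Rightarrow> (nat \<Rightarrow> real) \<Rightarrow> real" where
  "cex S f x = (\<Sum>y\<in>fib S x. w y * f y) / (\<Sum>y\<in>fib S x. w y)"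

lemma fib_subset: "fib S x \<subseteq> \<Omega>" by (auto simp: fib_def)
lemma fib_in: "y \<in> fib S x \<Longrightarrow> y \<in> \<Omega>" by (auto simp: fib_def)
lemma fib_finite [simp]: "finite (fib S x)" using fib_subset finite_cube by (rule finite_subset)
lemma fib_refl: "x \<in> \<Omega> \<Longrightarrow> x \<in> fib S x" by (auto simp: fib_def)
lemma fib_eq: "y \<in> fib S x \<Longrightarrow> fib S y = fib S x" by (auto simp: fib_def)
lemma fib_mono: "T \<subseteq> S \<Longrightarrow> fib T x \<subseteq> fib S x" by (auto simp: fib_def)
lemma fib_Z_pos: "x \<in> \<Omega> \<Longrightarrow> 0 < (\<Sum>y\<in>fib S x. w y)"
  using fib_refl[of x S] by (intro sum_pos) (auto simp: w_pos)

lemma fib_empty: "x \<in> \<Omega> \<Longrightarrow> fib {} x = {x}"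
  by (auto simp: fib_def cube_def intro: PiE_ext)

lemma fib_single:
  assumes x: "x \<in> \<Omega>" and i: "i \<in> I"
  shows "fib {i} x = {x, flip i x}"
proof (intro equalityI subsetI)
  fix y assume y: "y \<in> fib {i} x"
  have "y = (if y i = x i then x else flip i x)"
  proof (rule PiE_ext[of y I "\<lambda>_. {-1, 1}"])
    show "y \<in> I \<rightarrow>\<^sub>E {-1, 1}" using fib_in[OF y] by (simp add: cube_def)
    show "(if y i = x i then x else flip i x) \<in> I \<rightarrow>\<^sub>E {-1, 1}"
      using x flip_in_cube[OF x i] by (simp add: cube_def)
    fix j assume j: "j \<in> I"
    show "y j = (if y i = x i then x else flip i x) j"
      using y j cube_cases[OF x i] cube_cases[OF fib_in[OF y] i] by (auto simp: fib_def flip_apply)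
  qed
  then show "y \<in> {x, flip i x}" by (auto split: if_splits)
qed (use x i flip_in_cube in \<open>auto simp: fib_def flip_apply split: if_splits\<close>)

lemma fib_full: "fib I x = \<Omega>" by (auto simp: fib_def)

lemma cex_fib: "y \<in> fib S x \<Longrightarrow> cex S f y = cex S f x"
  by (simp add: cex_def fib_eq)

lemma cex_cong: "(\<And>y. y \<in> fib S x \<Longrightarrow> f y = g y) \<Longrightarrow> cex S f x = cex S g x"
  by (simp add: cex_def cong: sum.cong)

lemma cex_linear: "cex S (\<lambda>y. a * f y + b * g y) x = a * cex S f x + b * cex S g x"
  by (simp add: cex_def sum.distrib sum_distrib_left distrib_left add_divide_distrib mult_ac)

lemma cex_diff: "cex S (\<lambda>y. f y - g y) x = cex S f x - cex S g x"
  using cex_linear[of S 1 f "-1" g x] by simp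

lemma cex_cmult: "cex S (\<lambda>y. a * f y) x = a * cex S f x"
  using cex_linear[of S a f 0 f x] by simp

lemma cex_sum: "finite A \<Longrightarrow> cex S (\<lambda>y. \<Sum>a\<in>A. g a y) x = (\<Sum>a\<in>A. cex S (g a) x)"
proof (induction A rule: finite_induct)
  case empty
  then show ?case by (simp add: cex_def)
next
  case (insert a A)
  then show ?case using cex_linear[of S 1 "g a" 1 "\<lambda>y. \<Sum>a\<in>A. g a y" x] by simp
qed

lemma cex_const: "x \<in> \<Omega> \<Longrightarrow> cex S (\<lambda>_. c) x = c"
  using fib_Z_pos[of x S] by (simp add: cex_def sum_distrib_right[symmetric])

lemma cex_nonneg: "x \<in> \<Omega> \<Longrightarrow> (\<And>y. y \<in> fib S x \<Longrightarrow> 0 \<le> f y) \<Longrightarrow> 0 \<le> cex S f x"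
  using fib_Z_pos[of x S] less_imp_le[OF w_pos]
  unfolding cex_def by (intro divide_nonneg_nonneg sum_nonneg mult_nonneg_nonneg) auto

lemma cex_mono:
  assumes "x \<in> \<Omega>" "\<And>y. y \<in> fib S x \<Longrightarrow> f y \<le> g y"
  shows "cex S f x \<le> cex S g x"
  using cex_nonneg[OF assms(1), of S "\<lambda>y. g y - f y"] assms(2) by (simp add: cex_diff)

lemma cex_abs:
  assumes x: "x \<in> \<Omega>"
  shows "\<bar>cex S f x\<bar> \<le> cex S (\<lambda>y. \<bar>f y\<bar>) x"
proof (rule abs_leI)
  show "cex S f x \<le> cex S (\<lambda>y. \<bar>f y\<bar>) x" by (rule cex_mono[OF x]) simp
  have "cex S (\<lambda>y. (-1) * f y) x \<le> cex S (\<lambda>y. \<bar>f y\<bar>) x" by (rule cex_mono[OF x]) simp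
  then show "- cex S f x \<le> cex S (\<lambda>y. \<bar>f y\<bar>) x" unfolding cex_cmult by simp
qed

lemma cex_pull:
  assumes "\<And>y. y \<in> fib S x \<Longrightarrow> g y = c"
  shows "cex S (\<lambda>y. g y * f y) x = c * cex S f x"
  unfolding cex_cmult[symmetric] by (rule cex_cong) (use assms in auto)

lemma cex_empty: "x \<in> \<Omega> \<Longrightarrow> cex {} f x = f x"
  using w_pos[of x] by (simp add: cex_def fib_empty)

lemma flip_neq:
  assumes "x \<in> \<Omega>" "i \<in> I"
  shows "flip i x \<noteq> x"
proof
  assume "flip i x = x"
  then have "flip i x i = x i" by simp
  then show False using cube_abs[OF assms] by (simp add: flip_apply)
qed

lemma cex_single:
  assumes "x \<in> \<Omega>" "i \<in> I"
  shows "cex {i} f x = (w x * f x + w (flip i x) * f (flip i x)) / (w x + w (flip i x))"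
  using flip_neq[OF assms] by (simp add: cex_def fib_single[OF assms])

lemma cex_full: "cex I f x = (\<Sum>y\<in>\<Omega>. \<mu> y * f y)"
  by (simp add: cex_def fib_full \<mu>_eq sum_divide_distrib)

text \<open>
  For \<open>T \<subseteq> S\<close> the fibers of \<open>T\<close> partition each fiber of \<open>S\<close>; exchange the order of summation.
\<close>
lemma cex_tower:
  assumes TS: "T \<subseteq> S" and x: "x \<in> \<Omega>"
  shows "cex S (cex T f) x = cex S f x"
proof -
  define Z where "Z = (\<lambda>y. \<Sum>z\<in>fib T y. w z)"
  have Zeq: "Z z = Z y" if "z \<in> fib T y" for y z using fib_eq[OF that] by (simp add: Z_def)
  have Zpos: "Z y > 0" if "y \<in> \<Omega>" for y unfolding Z_def by (rule fib_Z_pos[OF that])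
  have "(\<Sum>y\<in>fib S x. w y * cex T f y) = (\<Sum>y\<in>fib S x. \<Sum>z\<in>fib T y. w y * w z * f z / Z y)"
    by (simp add: cex_def Z_def sum_divide_distrib sum_distrib_left mult.assoc)
  also have "\<dots> = (\<Sum>y\<in>fib S x. \<Sum>z\<in>fib S x. if z \<in> fib T y then w y * w z * f z / Z y else 0)"
  proof (rule sum.cong[OF refl])
    fix y assume y: "y \<in> fib S x"
    have "fib T y \<subseteq> fib S x" using fib_mono[OF TS, of y] fib_eq[OF y] by simp
    then have "fib S x \<inter> fib T y = fib T y" by auto
    then show "(\<Sum>z\<in>fib T y. w y * w z * f z / Z y) =
        (\<Sum>z\<in>fib S x. if z \<in> fib T y then w y * w z * f z / Z y else 0)"
      using sum.inter_restrict[of "fib S x" "\<lambda>z. w y * w z * f z / Z y" "fib T y"] by simp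
  qed
  also have "\<dots> = (\<Sum>z\<in>fib S x. \<Sum>y\<in>fib S x. if z \<in> fib T y then w y * w z * f z / Z y else 0)"
    by (rule sum.swap)
  also have "\<dots> = (\<Sum>z\<in>fib S x. \<Sum>y\<in>fib S x. if y \<in> fib T z then w y * (w z * f z / Z z) else 0)"
  proof (intro sum.cong refl)
    fix z y assume zy: "z \<in> fib S x" "y \<in> fib S x"
    have "z \<in> fib T y \<longleftrightarrow> y \<in> fib T z" using fib_in[OF zy(1)] fib_in[OF zy(2)] by (auto simp: fib_def)
    then show "(if z \<in> fib T y then w y * w z * f z / Z y else 0) = (if y \<in> fib T z then w y * (w z * f z / Z z) else 0)"
      using Zeq[of z y] by auto
  qed
  also have "\<dots> = (\<Sum>z\<in>fib S x. w z * f z)"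
  proof (rule sum.cong[OF refl])
    fix z assume z: "z \<in> fib S x"
    have "fib T z \<subseteq> fib S x" using fib_mono[OF TS, of z] fib_eq[OF z] by simp
    then have i: "fib S x \<inter> fib T z = fib T z" by auto
    have "(\<Sum>y\<in>fib S x. if y \<in> fib T z then w y * (w z * f z / Z z) else 0) = (\<Sum>y\<in>fib T z. w y * (w z * f z / Z z))"
      using sum.inter_restrict[of "fib S x" "\<lambda>y. w y * (w z * f z / Z z)" "fib T z"] i by simp
    also have "\<dots> = Z z * (w z * f z / Z z)"
      unfolding Z_def sum_distrib_right ..
    finally show "(\<Sum>y\<in>fib S x. if y \<in> fib T z then w y * (w z * f z / Z z) else 0) = w z * f z"
      using Zpos[OF fib_in[OF z]] by simp
  qed
  finally show ?thesis by (simp add: cex_def)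
qed

lemma cex_cauchy_schwarz:
  assumes x: "x \<in> \<Omega>"
  shows "(cex S (\<lambda>y. f y * g y) x)\<^sup>2 \<le> cex S (\<lambda>y. (f y)\<^sup>2) x * cex S (\<lambda>y. (g y)\<^sup>2) x"
proof -
  define Z where "Z = (\<Sum>y\<in>fib S x. w y)"
  have sq: "sqrt (w y) * sqrt (w y) = w y" for y using w_pos[of y] by simp
  have "(\<Sum>y\<in>fib S x. w y * (f y * g y)) = (\<Sum>y\<in>fib S x. (sqrt (w y) * f y) * (sqrt (w y) * g y))"
  proof (intro sum.cong refl)
    fix y
    have "(sqrt (w y) * f y) * (sqrt (w y) * g y) = (sqrt (w y) * sqrt (w y)) * (f y * g y)"
      by (simp only: mult_ac)
    then show "w y * (f y * g y) = (sqrt (w y) * f y) * (sqrt (w y) * g y)" unfolding sq ..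
  qed
  then have "(\<Sum>y\<in>fib S x. w y * (f y * g y))\<^sup>2 \<le>
      (\<Sum>y\<in>fib S x. (sqrt (w y) * f y)\<^sup>2) * (\<Sum>y\<in>fib S x. (sqrt (w y) * g y)\<^sup>2)"
    by (simp only: Cauchy_Schwarz_ineq_sum)
  also have "\<dots> = (\<Sum>y\<in>fib S x. w y * (f y)\<^sup>2) * (\<Sum>y\<in>fib S x. w y * (g y)\<^sup>2)"
    using less_imp_le[OF w_pos] by (simp add: power_mult_distrib)
  finally have "(\<Sum>y\<in>fib S x. w y * (f y * g y))\<^sup>2 / Z\<^sup>2 \<le>
      (\<Sum>y\<in>fib S x. w y * (f y)\<^sup>2) * (\<Sum>y\<in>fib S x. w y * (g y)\<^sup>2) / Z\<^sup>2"
    by (rule divide_right_mono) simp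
  then show ?thesis by (simp add: cex_def Z_def power_divide power2_eq_square)
qed

lemma cex_jensen_square: "x \<in> \<Omega> \<Longrightarrow> (cex S f x)\<^sup>2 \<le> cex S (\<lambda>y. (f y)\<^sup>2) x"
  using cex_cauchy_schwarz[of x S f "\<lambda>_. 1"] by (simp add: cex_const)

text \<open>
  The conditional \<open>\<phi>\<close>-entropy: \<open>\<phi> z = z ln z\<close> gives the entropy and \<open>\<phi> z = z\<^sup>2\<close> the variance.
\<close>
definition ent :: "(real \<Rightarrow> real) \<Rightarrow> nat set \<Rightarrow> ((nat \<Rightarrow> real) \<Rightarrow> real) \<Rightarrow> (nat \<Rightarrow> real) \<Rightarrow> real" where
  "ent \<phi> S F x = cex S (\<lambda>y. \<phi> (F y)) x - \<phi> (cex S F x)"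

lemma ent_chain:
  assumes "T \<subseteq> S" "x \<in> \<Omega>"
  shows "ent \<phi> S F x = cex S (ent \<phi> T F) x + ent \<phi> S (cex T F) x"
  unfolding ent_def[abs_def] cex_diff
  using cex_tower[OF assms, of F] cex_tower[OF assms, of "\<lambda>y. \<phi> (F y)"] by simp

text \<open>
  Induction on \<open>S\<close>. For each \<open>i \<in> S\<close> the chain rule splits off the entropy of the marginal of the spin
  \<open>i\<close>; averaging over \<open>i\<close>, the induction hypothesis for \<open>S - {i}\<close> accounts for a fraction \<open>1 - 1 / \<bar>S\<bar>\<close> of
  the right side and the hypothesis on the marginals for the rest, so that \<open>K\<close> does not deteriorate.
\<close>
lemma entropy_induction:
  assumes step: "\<And>S x. S \<subseteq> I \<Longrightarrow> x \<in> \<Omega> \<Longrightarrow>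
      (\<Sum>i\<in>S. ent \<phi> S (cex (S - {i}) F) x) \<le> K * (\<Sum>i\<in>S. cex S (D i) x)"
    and S: "S \<subseteq> I" and x: "x \<in> \<Omega>"
  shows "ent \<phi> S F x \<le> K * (\<Sum>i\<in>S. cex S (D i) x)"
proof -
  have "finite S" using S by (rule finite_subset) simp
  then show ?thesis using S x
  proof (induction S arbitrary: x rule: finite_psubset_induct)
    case (psubset S)
    show ?case
    proof (cases "S = {}")
      case True
      then show ?thesis using psubset.prems(2) by (simp add: ent_def cex_empty)
    next
      case False
      let ?a = "\<lambda>i. cex S (D i) x"
      have m: "card S > 0" using False psubset.hyps by (simp add: card_gt_0_iff)
      have 1: "cex S (ent \<phi> (S - {i}) F) x \<le> K * (sum ?a S - ?a i)" if i: "i \<in> S" for i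
      proof -
        have "cex S (ent \<phi> (S - {i}) F) x \<le> cex S (\<lambda>y. K * (\<Sum>j\<in>S - {i}. cex (S - {i}) (D j) y)) x"
          by (rule cex_mono[OF psubset.prems(2)], rule psubset.IH) (use psubset.prems i fib_in in auto)
        also have "\<dots> = K * (\<Sum>j\<in>S - {i}. cex S (cex (S - {i}) (D j)) x)"
          using psubset.hyps by (simp add: cex_cmult cex_sum)
        also have "\<dots> = K * (\<Sum>j\<in>S - {i}. ?a j)"
          using psubset.prems by (simp add: cex_tower)
        also have "\<dots> = K * (sum ?a S - ?a i)"
          using i psubset.hyps by (simp add: sum_diff1)
        finally show ?thesis .
      qed
      have "real (card S) * ent \<phi> S F x = (\<Sum>i\<in>S. ent \<phi> S F x)" by simp
      also have "\<dots> = (\<Sum>i\<in>S. cex S (ent \<phi> (S - {i}) F) x) + (\<Sum>i\<in>S. ent \<phi> S (cex (S - {i}) F) x)"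
        unfolding sum.distrib[symmetric] by (intro sum.cong refl ent_chain psubset.prems) auto
      also have "\<dots> \<le> (\<Sum>i\<in>S. K * (sum ?a S - ?a i)) + K * sum ?a S"
        by (intro add_mono sum_mono 1 step psubset.prems)
      also have "\<dots> = real (card S) * (K * sum ?a S)"
        by (simp add: sum_distrib_left[symmetric] sum_subtractf algebra_simps)
      finally show ?thesis using m by simp
    qed
  qed
qed

section \<open>Covariances and single-site updates\<close>

definition cov :: "nat set \<Rightarrow> ((nat \<Rightarrow> real) \<Rightarrow> real) \<Rightarrow> ((nat \<Rightarrow> real) \<Rightarrow> real) \<Rightarrow> (nat \<Rightarrow> real) \<Rightarrow> real" where
  "cov S f g x = cex S (\<lambda>y. f y * g y) x - cex S f x * cex S g x"

text \<open>
  The product of the conditional probabilities of the two values of the spin \<open>i\<close>.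
\<close>
definition site_var :: "nat \<Rightarrow> (nat \<Rightarrow> real) \<Rightarrow> real" where
  "site_var i x = w x * w (flip i x) / (w x + w (flip i x))\<^sup>2"

lemma cov_single:
  assumes "x \<in> \<Omega>" "i \<in> I"
  shows "cov {i} f g x = site_var i x * ((f x - f (flip i x)) * (g x - g (flip i x)))"
proof -
  define a b where "a = w x" "b = w (flip i x)"
  have "a + b \<noteq> 0" using w_pos[of x] w_pos[of "flip i x"] by (simp add: a_b_def)
  then have "(a * (f x * g x) + b * (f (flip i x) * g (flip i x))) / (a + b) -
     (a * f x + b * f (flip i x)) / (a + b) * ((a * g x + b * g (flip i x)) / (a + b)) =
     a * b / (a + b)\<^sup>2 * ((f x - f (flip i x)) * (g x - g (flip i x)))"
    by (simp add: divide_simps power2_eq_square) (simp add: algebra_simps)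
  then show ?thesis
    unfolding cov_def cex_single[OF assms] site_var_def a_b_def .
qed

lemma site_var_nonneg: "0 \<le> site_var i x"
  using w_pos[of x] w_pos[of "flip i x"] by (simp add: site_var_def)

lemma site_var_le: "site_var i x \<le> 1 / 4"
proof -
  have "4 * (w x * w (flip i x)) \<le> (w x + w (flip i x))\<^sup>2"
    using zero_le_power2[of "w x - w (flip i x)"] unfolding power2_diff power2_sum by simp
  then show ?thesis
    using w_pos[of x] w_pos[of "flip i x"] by (simp add: site_var_def divide_le_eq)
qed

text \<open>
  The two conditional probabilities have ratio \<open>exp (\<plusminus> 2 h\<^sub>i)\<close> with \<open>\<bar>h\<^sub>i\<bar> \<le> C\<close>.
\<close>
lemma site_var_ge:
  assumes "x \<in> \<Omega>" "i \<in> I"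
  shows "exp (- 2 * C) \<le> 4 * site_var i x"
proof -
  define r where "r = exp (- 2 * x i * field i x)"
  define R where "R = exp (2 * C)"
  have "\<bar>x i * field i x\<bar> \<le> C"
    using field_le[OF assms] cube_abs[OF assms] by (simp add: abs_mult)
  then have a: "- (2 * C) \<le> - 2 * x i * field i x" "- 2 * x i * field i x \<le> 2 * C" by auto
  have r: "1 \<le> r * R" "r \<le> R" "0 < r" "1 \<le> R"
    using a Cpos by (auto simp: r_def R_def exp_add[symmetric])
  have rr: "r * r \<le> r * R" "r * 1 \<le> r * R"
    using r by (intro mult_left_mono; simp)+
  have "(1 + r)\<^sup>2 = 1 + 2 * r + r * r" by (simp add: power2_eq_square algebra_simps)
  then have "(1 + r)\<^sup>2 \<le> 4 * (r * R)" using r(1) rr by linarith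
  then have 1: "1 / R \<le> 4 * (r / (1 + r)\<^sup>2)"
    using r by (simp add: field_simps)
  have "site_var i x = (w x * w x) * r / (w x * (1 + r))\<^sup>2"
    unfolding site_var_def w_flip[OF assms(2)] r_def[symmetric] by (simp add: algebra_simps)
  also have "\<dots> = r / (1 + r)\<^sup>2"
    using w_pos[of x] by (simp add: power_mult_distrib power2_eq_square[of "w x"])
  finally show ?thesis using 1 by (simp add: R_def exp_minus divide_inverse)
qed

lemma logistic_lipschitz:
  fixes a b :: real
  shows "\<bar>1 / (1 + exp (- a)) - 1 / (1 + exp (- b))\<bar> \<le> \<bar>a - b\<bar> / 4"
proof -
  have main: "0 \<le> 1 / (1 + exp (- b)) - 1 / (1 + exp (- a)) \<and>
      1 / (1 + exp (- b)) - 1 / (1 + exp (- a)) \<le> (b - a) / 4" if ab: "a \<le> b" for a b :: real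
  proof
    show "0 \<le> 1 / (1 + exp (- b)) - 1 / (1 + exp (- a))"
      using ab by (simp add: divide_left_mono add_pos_pos frac_le)
    define h where "h = (\<lambda>a::real. a / 4 - 1 / (1 + exp (- a)))"
    have "h a \<le> h b"
    proof (rule DERIV_nonneg_imp_nondecreasing[OF ab])
      fix z :: real
      have p: "1 + exp (- z) \<noteq> 0" using exp_gt_zero[of "-z"] by linarith
      have "(h has_real_derivative 1 / 4 - exp (- z) / (1 + exp (- z))\<^sup>2) (at z)"
        unfolding h_def using p
        by (auto intro!: derivative_eq_intros simp: power2_eq_square)
      moreover have "exp (- z) / (1 + exp (- z))\<^sup>2 \<le> 1 / 4"
      proof -
        have "4 * exp (- z) \<le> (1 + exp (- z))\<^sup>2"
          using zero_le_power2[of "1 - exp (- z)"] unfolding power2_diff power2_sum by simp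
        then show ?thesis using p by (simp add: divide_le_eq)
      qed
      ultimately show "\<exists>d. (h has_real_derivative d) (at z) \<and> 0 \<le> d"
        by (intro exI[of _ "1 / 4 - exp (- z) / (1 + exp (- z))\<^sup>2"]) simp
    qed
    then show "1 / (1 + exp (- b)) - 1 / (1 + exp (- a)) \<le> (b - a) / 4"
      by (simp add: h_def diff_divide_distrib)
  qed
  show ?thesis using main[of a b] main[of b a] by (cases "a \<le> b") auto
qed

lemma heat_bath_prob:
  assumes "x \<in> \<Omega>" "i \<in> I"
  shows "w x / (w x + w (flip i x)) = 1 / (1 + exp (- (2 * x i * field i x)))"
proof -
  have "w x + w (flip i x) = w x * (1 + exp (- (2 * x i * field i x)))"
    unfolding w_flip[OF assms(2)] by (simp add: algebra_simps)
  then show ?thesis using w_pos[of x] by simp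
qed

text \<open>
  Averaging over the spin \<open>i\<close> removes the dependence on it, but lets a flip of \<open>j\<close> act through the
  probability of \<open>x\<^sub>i = 1\<close>. This is a logistic function of \<open>2 h\<^sub>i\<close>, with Lipschitz constant \<open>1/4\<close>, and the flip
  changes its argument by \<open>4 \<bar>J\<^sub>i\<^sub>j\<bar>\<close>.
\<close>
lemma heat_bath_osc:
  assumes osc: "\<And>y j. y \<in> \<Omega> \<Longrightarrow> j \<in> S \<Longrightarrow> \<bar>h (flip j y) - h y\<bar> \<le> 2 * b j"
    and S: "S \<subseteq> I" and i: "i \<in> S" and j: "j \<in> S" and y: "y \<in> \<Omega>"
  shows "\<bar>cex {i} h (flip j y) - cex {i} h y\<bar> \<le> 2 * (if j = i then 0 else b j + \<bar>J i j\<bar> * b i)"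
proof (cases "j = i")
  case True
  have "flip i y \<in> fib {i} y" using fib_single[OF y, of i] S i by auto
  then show ?thesis using True by (simp add: cex_fib)
next
  case False
  have iI: "i \<in> I" and jI: "j \<in> I" using S i j by auto
  define p where "p = (\<lambda>y. w y / (w y + w (flip i y)))"
  have ce: "cex {i} h z = p z * h z + (1 - p z) * h (flip i z)" if "z \<in> \<Omega>" for z
  proof -
    have "w z + w (flip i z) \<noteq> 0" using w_pos[of z] w_pos[of "flip i z"] by simp
    then have "1 - p z = w (flip i z) / (w z + w (flip i z))" by (simp add: p_def field_simps)
    then show ?thesis unfolding cex_single[OF that iI] by (simp add: p_def add_divide_distrib)
  qed
  have p01: "0 \<le> p z" "p z \<le> 1" for z
    using w_pos[of z] w_pos[of "flip i z"] by (auto simp: p_def)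
  let ?z = "flip j y"
  have z: "?z \<in> \<Omega>" by (rule flip_in_cube[OF y jI])
  have dp: "\<bar>p ?z - p y\<bar> \<le> \<bar>J i j\<bar>"
  proof -
    have "\<bar>p ?z - p y\<bar> \<le> \<bar>2 * ?z i * field i ?z - 2 * y i * field i y\<bar> / 4"
      unfolding p_def heat_bath_prob[OF z iI] heat_bath_prob[OF y iI] by (rule logistic_lipschitz)
    also have "2 * ?z i * field i ?z - 2 * y i * field i y = - 4 * (y i * y j * J i j)"
      unfolding field_flip[OF jI iI False] using False by (simp add: flip_apply algebra_simps)
    also have "\<bar>- 4 * (y i * y j * J i j)\<bar> / 4 = \<bar>J i j\<bar>"
      using cube_abs[OF y iI] cube_abs[OF y jI] by (simp add: abs_mult)
    finally show ?thesis .
  qed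
  have a1: "\<bar>p ?z\<bar> = p ?z" "\<bar>1 - p ?z\<bar> = 1 - p ?z" using p01[of ?z] by auto
  have eq: "cex {i} h ?z - cex {i} h y = p ?z * (h ?z - h y) + (1 - p ?z) * (h (flip j (flip i y)) - h (flip i y))
      + (p ?z - p y) * (h y - h (flip i y))"
    unfolding ce[OF z] ce[OF y] flip_commute[of i j] by (simp add: algebra_simps)
  have "\<bar>cex {i} h ?z - cex {i} h y\<bar> \<le> \<bar>p ?z * (h ?z - h y)\<bar> +
      \<bar>(1 - p ?z) * (h (flip j (flip i y)) - h (flip i y))\<bar> + \<bar>(p ?z - p y) * (h y - h (flip i y))\<bar>"
    unfolding eq by linarith
  also have "\<dots> = p ?z * \<bar>h ?z - h y\<bar> + (1 - p ?z) * \<bar>h (flip j (flip i y)) - h (flip i y)\<bar>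
      + \<bar>p ?z - p y\<bar> * \<bar>h (flip i y) - h y\<bar>"
    unfolding abs_mult a1 abs_minus_commute[of "h y" "h (flip i y)"] ..
  also have "\<dots> \<le> p ?z * (2 * b j) + (1 - p ?z) * (2 * b j) + \<bar>J i j\<bar> * (2 * b i)"
  proof (intro add_mono)
    show "p ?z * \<bar>h ?z - h y\<bar> \<le> p ?z * (2 * b j)"
      by (rule mult_left_mono[OF osc[OF y j] p01(1)])
    show "(1 - p ?z) * \<bar>h (flip j (flip i y)) - h (flip i y)\<bar> \<le> (1 - p ?z) * (2 * b j)"
      using p01(2)[of ?z] by (intro mult_left_mono osc[OF flip_in_cube[OF y iI] j]) simp
    show "\<bar>p ?z - p y\<bar> * \<bar>h (flip i y) - h y\<bar> \<le> \<bar>J i j\<bar> * (2 * b i)"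
      by (rule mult_mono[OF dp osc[OF y i]]) auto
  qed
  also have "\<dots> = 2 * (b j + \<bar>J i j\<bar> * b i)" by (simp add: algebra_simps)
  finally show ?thesis using False by simp
qed

text \<open>
  Change the free spins one at a time.
\<close>
lemma fib_osc:
  fixes h :: "(nat \<Rightarrow> real) \<Rightarrow> real"
  assumes osc: "\<And>y j. y \<in> \<Omega> \<Longrightarrow> j \<in> S \<Longrightarrow> \<bar>h (flip j y) - h y\<bar> \<le> 2 * b j"
    and S: "S \<subseteq> I" and x: "x \<in> \<Omega>" and y: "y \<in> fib S x"
  shows "\<bar>h y - h x\<bar> \<le> 2 * (\<Sum>i\<in>S. b i)"
proof -
  have "finite S" using S by (rule finite_subset) simp
  then show ?thesis using osc S y
  proof (induction S arbitrary: y rule: finite_induct)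
    case empty
    then show ?case using fib_empty[OF x] by simp
  next
    case (insert i S)
    have iI: "i \<in> I" using insert.prems by auto
    have yO: "y \<in> \<Omega>" using insert.prems(3) by (rule fib_in)
    show ?case
    proof (cases "y i = x i")
      case True
      then have "y \<in> fib S x" using insert.prems(3) by (auto simp: fib_def)
      then have "\<bar>h y - h x\<bar> \<le> 2 * (\<Sum>i\<in>S. b i)" using insert by auto
      moreover have "0 \<le> b i" using insert.prems(1)[OF yO, of i] by simp
      ultimately show ?thesis using insert.hyps by simp
    next
      case False
      then have "flip i y \<in> fib S x"
        using insert.prems(3) flip_in_cube[OF yO iI] cube_cases[OF x iI] cube_cases[OF yO iI]
        by (auto simp: fib_def flip_apply)
      then have "\<bar>h (flip i y) - h x\<bar> \<le> 2 * (\<Sum>i\<in>S. b i)" using insert by auto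
      moreover have "\<bar>h (flip i y) - h y\<bar> \<le> 2 * b i" using insert.prems(1)[OF yO, of i] by simp
      ultimately show ?thesis using insert.hyps by simp
    qed
  qed
qed

end

section \<open>Spectral form of the Dobrushin condition\<close>

lemma L2_set_abs: "L2_set (\<lambda>i. \<bar>f i\<bar>) A = L2_set f A"
  by (simp add: L2_set_def)

lemma L2_set_apply_le_spectral_norm:
  fixes A :: "nat \<Rightarrow> nat \<Rightarrow> real"
  shows "L2_set (\<lambda>i. \<Sum>j\<in>{1..n}. A i j * v j) {1..n} \<le> spectral_norm n A * L2_set v {1..n}"
proof (cases "L2_set v {1..n} = 0")
  case True
  then have "\<And>j. j \<in> {1..n} \<Longrightarrow> v j = 0" using L2_set_eq_0_iff[of "{1..n}" v] by auto
  then have "L2_set (\<lambda>i. \<Sum>j\<in>{1..n}. A i j * v j) {1..n} = 0" by (simp add: L2_set_def)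
  then show ?thesis using True by simp
next
  case False
  define l where "l = L2_set v {1..n}"
  have l: "l > 0" unfolding l_def by (rule le_neq_trans[OF L2_set_nonneg False[symmetric]])
  define u where "u = (\<lambda>i. 1 / l * v i)"
  have u1: "L2_set u {1..n} = 1"
  proof -
    have "L2_set u {1..n} = 1 / l * L2_set v {1..n}"
      unfolding u_def by (rule L2_set_right_distrib[symmetric]) (use l in simp)
    then show ?thesis using l by (simp add: l_def[symmetric])
  qed
  have bdd: "bdd_above ((\<lambda>v. L2_set (\<lambda>i. \<Sum>j\<in>{1..n}. A i j * v j) {1..n}) ` {v. L2_set v {1..n} = 1})"
  proof (rule bdd_aboveI2)
    fix v assume "v \<in> {v. L2_set v {1..n} = 1}"
    then have v: "\<bar>v j\<bar> \<le> 1" if "j \<in> {1..n}" for j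
      using member_le_L2_set[of "{1..n}" j "\<lambda>j. \<bar>v j\<bar>"] that by (simp add: L2_set_abs)
    have "L2_set (\<lambda>i. \<Sum>j\<in>{1..n}. A i j * v j) {1..n} \<le> (\<Sum>i\<in>{1..n}. \<bar>\<Sum>j\<in>{1..n}. A i j * v j\<bar>)"
      by (rule L2_set_le_sum_abs)
    also have "\<dots> \<le> (\<Sum>i\<in>{1..n}. \<Sum>j\<in>{1..n}. \<bar>A i j\<bar> * 1)"
    proof (rule sum_mono)
      fix i
      have "\<bar>\<Sum>j\<in>{1..n}. A i j * v j\<bar> \<le> (\<Sum>j\<in>{1..n}. \<bar>A i j * v j\<bar>)" by (rule sum_abs)
      also have "\<dots> \<le> (\<Sum>j\<in>{1..n}. \<bar>A i j\<bar> * 1)"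
        unfolding abs_mult by (intro sum_mono mult_left_mono v) auto
      finally show "\<bar>\<Sum>j\<in>{1..n}. A i j * v j\<bar> \<le> (\<Sum>j\<in>{1..n}. \<bar>A i j\<bar> * 1)" .
    qed
    finally show "L2_set (\<lambda>i. \<Sum>j\<in>{1..n}. A i j * v j) {1..n} \<le> (\<Sum>i\<in>{1..n}. \<Sum>j\<in>{1..n}. \<bar>A i j\<bar> * 1)" .
  qed
  have "L2_set (\<lambda>i. \<Sum>j\<in>{1..n}. A i j * u j) {1..n} \<le> spectral_norm n A"
    unfolding spectral_norm_def by (rule cSUP_upper[OF _ bdd]) (use u1 in auto)
  moreover have "L2_set (\<lambda>i. \<Sum>j\<in>{1..n}. A i j * u j) {1..n} =
      1 / l * L2_set (\<lambda>i. \<Sum>j\<in>{1..n}. A i j * v j) {1..n}"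
    using L2_set_right_distrib[of "1 / l" "\<lambda>i. \<Sum>j\<in>{1..n}. A i j * v j" "{1..n}"] l
    by (simp add: u_def sum_distrib_left mult.left_commute)
  ultimately have "1 / l * L2_set (\<lambda>i. \<Sum>j\<in>{1..n}. A i j * v j) {1..n} \<le> spectral_norm n A"
    by simp
  then show ?thesis using l unfolding l_def[symmetric] by (simp add: divide_le_eq)
qed

text \<open>
  An upper bound \<open>s\<close> in place of the norm itself, so that \<open>s\<close> may be taken nonnegative.
\<close>
locale subcritical_ising = ising_model +
  fixes s :: real
  assumes s1: "s < 1" and s0: "0 \<le> s"
    and norm_J: "spectral_norm n (\<lambda>i j. \<bar>J i j\<bar>) \<le> s"
begin

text \<open>
  Passing to a principal submatrix and deleting the diagonal can only decrease the norm of a nonnegative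
  matrix on nonnegative vectors.
\<close>
lemma restricted_norm:
  assumes S: "S \<subseteq> I" and b: "\<And>i. i \<in> S \<Longrightarrow> 0 \<le> b i"
  shows "L2_set (\<lambda>j. \<Sum>i\<in>S - {j}. \<bar>J i j\<bar> * b i) S \<le> s * L2_set b S"
proof -
  define b' where "b' = (\<lambda>i. if i \<in> S then b i else 0)"
  have b': "0 \<le> b' i" for i using b by (simp add: b'_def)
  have fS: "finite S" using S by (rule finite_subset) simp
  have "L2_set (\<lambda>j. \<Sum>i\<in>S - {j}. \<bar>J i j\<bar> * b i) S \<le> L2_set (\<lambda>j. \<Sum>i\<in>I. \<bar>J j i\<bar> * b' i) S"
  proof (rule L2_set_mono)
    fix j assume j: "j \<in> S"
    have "(\<Sum>i\<in>S - {j}. \<bar>J i j\<bar> * b i) = (\<Sum>i\<in>S - {j}. \<bar>J j i\<bar> * b' i)"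
      using S j J_sym by (intro sum.cong refl) (auto simp: b'_def subset_iff)
    also have "\<dots> \<le> (\<Sum>i\<in>I. \<bar>J j i\<bar> * b' i)"
      using S b' by (intro sum_mono2) auto
    finally show "(\<Sum>i\<in>S - {j}. \<bar>J i j\<bar> * b i) \<le> (\<Sum>i\<in>I. \<bar>J j i\<bar> * b' i)" .
    show "0 \<le> (\<Sum>i\<in>S - {j}. \<bar>J i j\<bar> * b i)" using b by (intro sum_nonneg) auto
  qed
  also have "\<dots> \<le> L2_set (\<lambda>j. \<Sum>i\<in>I. \<bar>J j i\<bar> * b' i) I"
    unfolding L2_set_def using S by (intro real_sqrt_le_mono sum_mono2) auto
  also have "\<dots> \<le> spectral_norm n (\<lambda>i j. \<bar>J i j\<bar>) * L2_set b' I"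
    by (rule L2_set_apply_le_spectral_norm)
  also have "\<dots> \<le> s * L2_set b' I"
    by (rule mult_right_mono[OF norm_J L2_set_nonneg])
  also have "L2_set b' I = L2_set b S"
  proof -
    have "(\<Sum>i\<in>I. (b' i)\<^sup>2) = (\<Sum>i\<in>S. (b' i)\<^sup>2)"
      using S by (intro sum.mono_neutral_right) (auto simp: b'_def)
    then show ?thesis by (simp add: L2_set_def b'_def)
  qed
  finally show ?thesis .
qed

text \<open>
  A bound for the covariance of \<open>F\<close> with a function that changes by at most \<open>2\<close> when the spin \<open>i\<close> is flipped, computed with the
  other spins fixed and then averaged.
\<close>
definition influence :: "nat set \<Rightarrow> ((nat \<Rightarrow> real) \<Rightarrow> real) \<Rightarrow> (nat \<Rightarrow> real) \<Rightarrow> nat \<Rightarrow> real" where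
  "influence S F x i = cex S (\<lambda>y. 2 * site_var i y * \<bar>F y - F (flip i y)\<bar>) x"

section \<open>The covariance bound, Poincare and log-Sobolev inequalities\<close>

text \<open>
  Let \<open>Kh\<close> be the average of the heat-bath updates of \<open>h\<close> over the \<open>m\<close> sites of \<open>S\<close>. Since \<open>Kh\<close> and \<open>h\<close> have
  the same conditional expectation, \<open>Cov(F, h)\<close> is the average of \<open>F (h - Kh)\<close> plus \<open>Cov(F, Kh)\<close>. The first term is at most
  \<open>1 / m\<close> times the inner product of the influences of \<open>F\<close> with the oscillations of \<open>h\<close>, and the oscillation vector
  of \<open>Kh\<close> is shorter by the factor \<open>r = 1 - (1 - s) / m\<close>. Iterating, the constant \<open>T / (1 - s)\<close> is the fixed
  point, and the contribution of any crude initial bound is multiplied by \<open>r\<close> at each step.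
\<close>
lemma dobrushin_covariance_bound:
  assumes S: "S \<subseteq> I" and x: "x \<in> \<Omega>"
    and osc: "\<And>y j. y \<in> \<Omega> \<Longrightarrow> j \<in> S \<Longrightarrow> \<bar>h (flip j y) - h y\<bar> \<le> 2 * b j"
  shows "\<bar>cov S F h x\<bar> \<le> L2_set (influence S F x) S / (1 - s) * L2_set b S"
proof (cases "S = {}")
  case True
  then show ?thesis using x by (simp add: cov_def cex_empty)
next
  case False
  have fS: "finite S" using S by (rule finite_subset) simp
  define m where "m = real (card S)"
  have "0 < card S" using False fS by (simp add: card_gt_0_iff)
  then have "1 \<le> card S" by linarith
  then have m: "m \<ge> 1" by (simp add: m_def)
  define T where "T = L2_set (influence S F x) S"
  \<comment> \<open>The contraction rate of oscillation vectors under the averaged update.\<close>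
  define r where "r = 1 - (1 - s) / m"
  have r: "0 \<le> r" "r < 1" using m s1 s0 by (auto simp: r_def field_simps)
  define R where "R = 4 * m * (\<Sum>y\<in>\<Omega>. \<bar>F y\<bar>)"
  have R: "0 \<le> R" using m by (simp add: R_def sum_nonneg)
  have "\<bar>cov S F h x\<bar> \<le> (T / (1 - s) + R * r ^ k) * L2_set b S" for k
    using osc
  proof (induction k arbitrary: h b)
    case 0
    define B where "B = 2 * m * L2_set b S"
    have b0: "0 \<le> b i" if "i \<in> S" for i using 0[OF x that] by linarith
    have "(\<Sum>i\<in>S. b i) \<le> (\<Sum>i\<in>S. L2_set b S)"
      by (intro sum_mono member_le_L2_set fS)
    then have sb: "2 * (\<Sum>i\<in>S. b i) \<le> B" by (simp add: B_def m_def)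
    have hB: "\<bar>h y - h x\<bar> \<le> B" if "y \<in> fib S x" for y
      using fib_osc[OF 0 S x that] sb by (rule order_trans)
    have B: "0 \<le> B" using m L2_set_nonneg[of b S] by (simp add: B_def)
    have FM: "\<bar>F y\<bar> \<le> (\<Sum>y\<in>\<Omega>. \<bar>F y\<bar>)" if "y \<in> fib S x" for y
      using fib_in[OF that] by (intro member_le_sum) auto
    have "cov S F h x = cex S (\<lambda>y. F y * (h y - h x)) x - cex S F x * cex S (\<lambda>y. h y - h x) x"
    proof -
      have 1: "cex S (\<lambda>y. F y * (h y - h x)) x = cex S (\<lambda>y. F y * h y) x - cex S F x * h x"
        using cex_linear[of S 1 "\<lambda>y. F y * h y" "- h x" F x] by (simp add: algebra_simps)
      have 2: "cex S (\<lambda>y. h y - h x) x = cex S h x - h x"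
        using x by (simp add: cex_diff cex_const)
      show ?thesis unfolding cov_def 1 2 by (simp add: algebra_simps)
    qed
    moreover have "\<bar>cex S (\<lambda>y. F y * (h y - h x)) x\<bar> \<le> (\<Sum>y\<in>\<Omega>. \<bar>F y\<bar>) * B"
    proof -
      have "\<bar>cex S (\<lambda>y. F y * (h y - h x)) x\<bar> \<le> cex S (\<lambda>y. \<bar>F y * (h y - h x)\<bar>) x" by (rule cex_abs[OF x])
      also have "\<dots> \<le> cex S (\<lambda>_. (\<Sum>y\<in>\<Omega>. \<bar>F y\<bar>) * B) x"
        unfolding abs_mult by (intro cex_mono x mult_mono FM hB) (auto intro: sum_nonneg)
      finally show ?thesis by (simp add: cex_const[OF x])
    qed
    moreover have "\<bar>cex S F x * cex S (\<lambda>y. h y - h x) x\<bar> \<le> (\<Sum>y\<in>\<Omega>. \<bar>F y\<bar>) * B"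
      unfolding abs_mult
    proof (rule mult_mono)
      have "\<bar>cex S F x\<bar> \<le> cex S (\<lambda>y. \<bar>F y\<bar>) x" by (rule cex_abs[OF x])
      also have "\<dots> \<le> cex S (\<lambda>_. \<Sum>y\<in>\<Omega>. \<bar>F y\<bar>) x" by (intro cex_mono x FM)
      finally show "\<bar>cex S F x\<bar> \<le> (\<Sum>y\<in>\<Omega>. \<bar>F y\<bar>)" by (simp add: cex_const[OF x])
      have "\<bar>cex S (\<lambda>y. h y - h x) x\<bar> \<le> cex S (\<lambda>y. \<bar>h y - h x\<bar>) x" by (rule cex_abs[OF x])
      also have "\<dots> \<le> cex S (\<lambda>_. B) x" by (intro cex_mono x hB)
      finally show "\<bar>cex S (\<lambda>y. h y - h x) x\<bar> \<le> B" by (simp add: cex_const[OF x])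
    qed (auto intro: sum_nonneg)
    ultimately have "\<bar>cov S F h x\<bar> \<le> 2 * ((\<Sum>y\<in>\<Omega>. \<bar>F y\<bar>) * B)" by linarith
    also have "\<dots> = R * L2_set b S" by (simp add: R_def B_def)
    also have "\<dots> \<le> (T / (1 - s) + R * r ^ 0) * L2_set b S"
      using s1 by (intro mult_right_mono) (auto simp: T_def L2_set_nonneg)
    finally show ?case .
  next
    case (Suc k)
    define Kh where "Kh = (\<lambda>y. 1 / m * (\<Sum>i\<in>S. cex {i} h y))"
    define b' where "b' = (\<lambda>j. 1 / m * ((m - 1) * b j + (\<Sum>i\<in>S - {j}. \<bar>J i j\<bar> * b i)))"
    have b0: "0 \<le> b i" if "i \<in> S" for i using Suc.prems[OF x that] by linarith
    have osc': "\<bar>Kh (flip j y) - Kh y\<bar> \<le> 2 * b' j" if y: "y \<in> \<Omega>" and j: "j \<in> S" for y j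
    proof -
      have eq: "Kh (flip j y) - Kh y = 1 / m * (\<Sum>i\<in>S. cex {i} h (flip j y) - cex {i} h y)"
        by (simp add: Kh_def sum_subtractf right_diff_distrib)
      have "\<bar>Kh (flip j y) - Kh y\<bar> \<le> 1 / m * (\<Sum>i\<in>S. \<bar>cex {i} h (flip j y) - cex {i} h y\<bar>)"
        unfolding eq abs_mult using m by (intro mult_mono sum_abs) auto
      also have "\<dots> \<le> 1 / m * (\<Sum>i\<in>S. 2 * (if j = i then 0 else b j + \<bar>J i j\<bar> * b i))"
        using m by (intro mult_left_mono sum_mono heat_bath_osc[OF Suc.prems S _ j y]) auto
      also have "(\<Sum>i\<in>S. 2 * (if j = i then 0 else b j + \<bar>J i j\<bar> * b i)) =
          2 * (\<Sum>i\<in>S - {j}. b j + \<bar>J i j\<bar> * b i)"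
        unfolding sum_distrib_left[symmetric] using j fS by (simp add: sum.remove[of S j])
      also have "(\<Sum>i\<in>S - {j}. b j + \<bar>J i j\<bar> * b i) = (m - 1) * b j + (\<Sum>i\<in>S - {j}. \<bar>J i j\<bar> * b i)"
        using j fS m by (simp add: sum.distrib m_def of_nat_diff)
      finally show ?thesis by (simp add: b'_def)
    qed
    have nb': "L2_set b' S \<le> r * L2_set b S"
    proof -
      have "L2_set b' S = 1 / m * L2_set (\<lambda>j. (m - 1) * b j + (\<Sum>i\<in>S - {j}. \<bar>J i j\<bar> * b i)) S"
        unfolding b'_def by (rule L2_set_right_distrib[symmetric]) (use m in simp)
      also have "\<dots> \<le> 1 / m * ((m - 1) * L2_set b S + s * L2_set b S)"
      proof (rule mult_left_mono)
        have "L2_set (\<lambda>j. (m - 1) * b j + (\<Sum>i\<in>S - {j}. \<bar>J i j\<bar> * b i)) S \<le>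
            L2_set (\<lambda>j. (m - 1) * b j) S + L2_set (\<lambda>j. \<Sum>i\<in>S - {j}. \<bar>J i j\<bar> * b i) S"
          by (rule L2_set_triangle_ineq)
        also have "\<dots> \<le> (m - 1) * L2_set b S + s * L2_set b S"
        proof (rule add_mono)
          show "L2_set (\<lambda>j. (m - 1) * b j) S \<le> (m - 1) * L2_set b S"
            using m by (subst L2_set_right_distrib) auto
          show "L2_set (\<lambda>j. \<Sum>i\<in>S - {j}. \<bar>J i j\<bar> * b i) S \<le> s * L2_set b S"
            by (rule restricted_norm[OF S]) (rule b0)
        qed
        finally show "L2_set (\<lambda>j. (m - 1) * b j + (\<Sum>i\<in>S - {j}. \<bar>J i j\<bar> * b i)) S
            \<le> (m - 1) * L2_set b S + s * L2_set b S" .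
      qed (use m in simp)
      also have "\<dots> = r * L2_set b S" using m by (simp add: r_def field_simps)
      finally show ?thesis .
    qed
    have KhS: "cex S Kh x = cex S h x"
    proof -
      have "cex S Kh x = 1 / m * (\<Sum>i\<in>S. cex S (cex {i} h) x)"
        unfolding Kh_def cex_cmult by (simp add: cex_sum fS)
      also have "\<dots> = 1 / m * (\<Sum>i\<in>S. cex S h x)"
        using x by (simp add: cex_tower)
      finally show ?thesis using m by (simp add: m_def)
    qed
    have one: "\<bar>cex S (\<lambda>y. F y * (h y - cex {i} h y)) x\<bar> \<le> influence S F x i * b i" if i: "i \<in> S" for i
    proof -
      have iI: "i \<in> I" using S i by auto
      have "cex S (\<lambda>y. F y * cex {i} h y) x = cex S (cex {i} (\<lambda>y. F y * cex {i} h y)) x"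
        using i x by (simp add: cex_tower)
      also have "\<dots> = cex S (\<lambda>y. cex {i} F y * cex {i} h y) x"
      proof (rule cex_cong)
        fix y
        have "cex {i} (\<lambda>z. cex {i} h z * F z) y = cex {i} h y * cex {i} F y"
          by (rule cex_pull) (rule cex_fib)
        then show "cex {i} (\<lambda>y. F y * cex {i} h y) y = cex {i} F y * cex {i} h y"
          by (simp add: mult.commute)
      qed
      finally have 1: "cex S (\<lambda>y. F y * cex {i} h y) x = cex S (\<lambda>y. cex {i} F y * cex {i} h y) x" .
      have "cex S (\<lambda>y. F y * (h y - cex {i} h y)) x =
          cex S (\<lambda>y. F y * h y) x - cex S (\<lambda>y. F y * cex {i} h y) x"
        unfolding right_diff_distrib by (rule cex_diff)
      also have "\<dots> = cex S (cex {i} (\<lambda>y. F y * h y)) x - cex S (\<lambda>y. cex {i} F y * cex {i} h y) x"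
        unfolding 1 using i x by (simp add: cex_tower)
      also have "\<dots> = cex S (cov {i} F h) x"
        unfolding cov_def[abs_def] cex_diff ..
      finally have "\<bar>cex S (\<lambda>y. F y * (h y - cex {i} h y)) x\<bar> \<le> cex S (\<lambda>y. \<bar>cov {i} F h y\<bar>) x"
        using cex_abs[OF x] by simp
      also have "\<dots> \<le> cex S (\<lambda>y. b i * (2 * site_var i y * \<bar>F y - F (flip i y)\<bar>)) x"
      proof (rule cex_mono[OF x])
        fix y assume "y \<in> fib S x"
        then have y: "y \<in> \<Omega>" by (rule fib_in)
        have "\<bar>cov {i} F h y\<bar> = site_var i y * (\<bar>F y - F (flip i y)\<bar> * \<bar>h (flip i y) - h y\<bar>)"
          using site_var_nonneg[of i y]
          by (simp add: cov_single[OF y iI] abs_mult abs_minus_commute[of "h y" "h (flip i y)"])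
        also have "\<dots> \<le> site_var i y * (\<bar>F y - F (flip i y)\<bar> * (2 * b i))"
          using Suc.prems[OF y i] site_var_nonneg[of i y] by (intro mult_left_mono) auto
        finally show "\<bar>cov {i} F h y\<bar> \<le> b i * (2 * site_var i y * \<bar>F y - F (flip i y)\<bar>)"
          by (simp add: mult_ac)
      qed
      also have "\<dots> = influence S F x i * b i" by (simp add: cex_cmult influence_def)
      finally show ?thesis .
    qed
    have eq: "cex S (\<lambda>y. F y * (h y - Kh y)) x = 1 / m * (\<Sum>i\<in>S. cex S (\<lambda>y. F y * (h y - cex {i} h y)) x)"
    proof -
      have p: "F y * (h y - Kh y) = 1 / m * (\<Sum>i\<in>S. F y * (h y - cex {i} h y))" for y
        using m by (simp add: Kh_def m_def sum_distrib_left[symmetric] sum_subtractf field_simps)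
      show ?thesis unfolding p cex_cmult cex_sum[OF fS] ..
    qed
    have "\<bar>cex S (\<lambda>y. F y * (h y - Kh y)) x\<bar> \<le> 1 / m * (\<Sum>i\<in>S. \<bar>cex S (\<lambda>y. F y * (h y - cex {i} h y)) x\<bar>)"
      unfolding eq abs_mult using m by (intro mult_mono sum_abs) auto
    also have "\<dots> \<le> 1 / m * (\<Sum>i\<in>S. \<bar>influence S F x i\<bar> * \<bar>b i\<bar>)"
    proof (intro mult_left_mono sum_mono)
      fix i assume i: "i \<in> S"
      show "\<bar>cex S (\<lambda>y. F y * (h y - cex {i} h y)) x\<bar> \<le> \<bar>influence S F x i\<bar> * \<bar>b i\<bar>"
        using one[OF i] abs_ge_self[of "influence S F x i * b i"] by (simp only: abs_mult)
    qed (use m in simp)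
    also have "\<dots> \<le> 1 / m * (T * L2_set b S)"
      unfolding T_def using m by (intro mult_left_mono L2_set_mult_ineq) auto
    finally have 2: "\<bar>cex S (\<lambda>y. F y * (h y - Kh y)) x\<bar> \<le> 1 / m * (T * L2_set b S)" .
    have "cov S F h x = cex S (\<lambda>y. F y * (h y - Kh y)) x + cov S F Kh x"
      unfolding right_diff_distrib cex_diff cov_def KhS by simp
    then have "\<bar>cov S F h x\<bar> \<le> 1 / m * (T * L2_set b S) + (T / (1 - s) + R * r ^ k) * L2_set b' S"
      using 2 Suc.IH[OF osc'] by linarith
    also have "\<dots> \<le> 1 / m * (T * L2_set b S) + (T / (1 - s) + R * r ^ k) * (r * L2_set b S)"
      using s1 R r by (intro add_left_mono mult_left_mono nb') (auto simp: T_def L2_set_nonneg)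
    also have "\<dots> = (T / (1 - s) + R * r ^ Suc k) * L2_set b S"
    proof -
      have "1 / m * T + T / (1 - s) * r = T / (1 - s)"
        using m s1 by (simp add: r_def field_simps)
      then have "(1 / m * T + T / (1 - s) * r) * L2_set b S = T / (1 - s) * L2_set b S" by simp
      then show ?thesis by (simp add: algebra_simps)
    qed
    finally show ?case .
  qed
  moreover have "(\<lambda>k. (T / (1 - s) + R * r ^ k) * L2_set b S) \<longlonglongrightarrow> (T / (1 - s) + R * 0) * L2_set b S"
    by (intro tendsto_intros LIMSEQ_realpow_zero r)
  ultimately have "\<bar>cov S F h x\<bar> \<le> (T / (1 - s) + R * 0) * L2_set b S"
    by (intro LIMSEQ_le_const[where X = "\<lambda>k. (T / (1 - s) + R * r ^ k) * L2_set b S"]) auto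
  then show ?thesis by (simp add: T_def)
qed

text \<open>
  Test the covariance bound with the linear function whose coefficients are the covariances themselves.
\<close>
lemma covariance_spin_sum:
  assumes S: "S \<subseteq> I" and x: "x \<in> \<Omega>"
  shows "(\<Sum>i\<in>S. (cov S F (\<lambda>y. y i) x)\<^sup>2) \<le> (\<Sum>i\<in>S. (influence S F x i)\<^sup>2) / (1 - s)\<^sup>2"
proof -
  have fS: "finite S" using S by (rule finite_subset) simp
  define a where "a = (\<lambda>i. cov S F (\<lambda>y. y i) x)"
  define h where "h = (\<lambda>y :: nat \<Rightarrow> real. \<Sum>i\<in>S. a i * y i)"
  have osc: "\<bar>h (flip j y) - h y\<bar> \<le> 2 * \<bar>a j\<bar>" if y: "y \<in> \<Omega>" and j: "j \<in> S" for y j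
  proof -
    have "h (flip j y) - h y = (\<Sum>i\<in>S. if i = j then - 2 * a j * y j else 0)"
      unfolding h_def sum_subtractf[symmetric] by (intro sum.cong refl) (auto simp: flip_apply)
    also have "\<dots> = - 2 * a j * y j" using fS j by simp
    finally show ?thesis using cube_abs[OF y, of j] S j by (auto simp: abs_mult subset_iff)
  qed
  have "cov S F h x = (\<Sum>i\<in>S. a i * a i)"
  proof -
    have "cex S (\<lambda>y. F y * h y) x = (\<Sum>i\<in>S. a i * cex S (\<lambda>y. F y * y i) x)"
      unfolding h_def sum_distrib_left mult.left_commute[of "F _"] cex_sum[OF fS] cex_cmult ..
    moreover have "cex S h x = (\<Sum>i\<in>S. a i * cex S (\<lambda>y. y i) x)"
      unfolding h_def by (simp add: cex_sum fS cex_cmult)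
    ultimately show ?thesis
      by (simp add: cov_def a_def sum_distrib_left sum_subtractf[symmetric] right_diff_distrib mult.left_commute)
  qed
  then have cv: "cov S F h x = (L2_set a S)\<^sup>2"
    by (simp add: L2_set_def sum_nonneg power2_eq_square[symmetric])
  have "\<bar>cov S F h x\<bar> \<le> L2_set (influence S F x) S / (1 - s) * L2_set (\<lambda>i. \<bar>a i\<bar>) S"
    by (rule dobrushin_covariance_bound[OF S x osc])
  then have "L2_set a S * L2_set a S \<le> L2_set (influence S F x) S / (1 - s) * L2_set a S"
    by (simp add: cv L2_set_abs power2_eq_square)
  then have "L2_set a S \<le> L2_set (influence S F x) S / (1 - s)"
  proof (cases "L2_set a S = 0")
    case False
    then have "0 < L2_set a S" using L2_set_nonneg[of a S] by linarith
    then show ?thesis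
      using \<open>L2_set a S * L2_set a S \<le> L2_set (influence S F x) S / (1 - s) * L2_set a S\<close>
      by (rule mult_right_le_imp_le[rotated])
  next
    case True
    then show ?thesis using s1 L2_set_nonneg[of "influence S F x" S] by simp
  qed
  then have "(L2_set a S)\<^sup>2 \<le> (L2_set (influence S F x) S / (1 - s))\<^sup>2"
    by (intro power_mono L2_set_nonneg)
  then show ?thesis
    by (simp add: L2_set_def sum_nonneg power_divide a_def)
qed

text \<open>
  On a fiber of \<open>S\<close> the function \<open>g = E(F | S - {i})\<close> depends on \<open>x\<^sub>i\<close> only and is thus affine, \<open>\<alpha> + \<beta> x\<^sub>i\<close>.
  Hence \<open>Var g = \<beta>\<^sup>2 V\<close> and \<open>Cov(F, x\<^sub>i) = \<beta> V\<close>, where \<open>V = Var x\<^sub>i\<close> is bounded below by the mean of the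
  single-site variances.
\<close>
lemma variance_marginal:
  assumes S: "S \<subseteq> I" and x: "x \<in> \<Omega>" and i: "i \<in> S"
  shows "cov S (cex (S - {i}) F) (cex (S - {i}) F) x \<le> exp (2 * C) * (cov S F (\<lambda>y. y i) x)\<^sup>2"
proof -
  have iI: "i \<in> I" using S i by auto
  define g where "g = cex (S - {i}) F"
  define c where "c = (\<lambda>y :: nat \<Rightarrow> real. y i)"
  define \<beta> where "\<beta> = (g x - g (flip i x)) / (2 * x i)"
  define \<alpha> where "\<alpha> = (g x + g (flip i x)) / 2"
  have xi: "x i = 1 \<or> x i = -1" using cube_cases[OF x iI] by auto
  have g: "g y = \<alpha> + \<beta> * c y" if y: "y \<in> fib S x" for y
  proof (cases "y i = x i")
    case True
    then have "y \<in> fib (S - {i}) x" using y by (auto simp: fib_def)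
    then have "g y = g x" unfolding g_def by (rule cex_fib)
    then show ?thesis using True xi by (auto simp: \<alpha>_def \<beta>_def c_def field_simps)
  next
    case False
    then have yi: "y i = - x i" using cube_cases[OF fib_in[OF y] iI] xi by auto
    then have "y \<in> fib (S - {i}) (flip i x)" using y by (auto simp: fib_def flip_apply)
    then have "g y = g (flip i x)" unfolding g_def by (rule cex_fib)
    then show ?thesis using yi xi by (auto simp: \<alpha>_def \<beta>_def c_def field_simps)
  qed
  have 1: "cov S F c x = cov S g c x"
  proof -
    have "cex S (\<lambda>y. F y * c y) x = cex S (cex (S - {i}) (\<lambda>y. F y * c y)) x"
      using x by (simp add: cex_tower)
    also have "\<dots> = cex S (\<lambda>y. g y * c y) x"
    proof (rule cex_cong)
      fix y
      have "cex (S - {i}) (\<lambda>z. c z * F z) y = c y * g y"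
        unfolding g_def by (rule cex_pull) (use iI in \<open>auto simp: c_def fib_def\<close>)
      then show "cex (S - {i}) (\<lambda>y. F y * c y) y = g y * c y" by (simp add: mult.commute)
    qed
    finally show ?thesis using x by (simp add: cov_def g_def cex_tower)
  qed
  have e1: "cex S g x = \<alpha> + \<beta> * cex S c x"
  proof -
    have "cex S g x = cex S (\<lambda>y. \<alpha> * 1 + \<beta> * c y) x" by (rule cex_cong) (simp add: g)
    then show ?thesis using x unfolding cex_linear by (simp add: cex_const)
  qed
  have e2: "cex S (\<lambda>y. g y * c y) x = \<alpha> * cex S c x + \<beta> * cex S (\<lambda>y. c y * c y) x"
  proof -
    have "cex S (\<lambda>y. g y * c y) x = cex S (\<lambda>y. \<alpha> * c y + \<beta> * (c y * c y)) x"
      by (rule cex_cong) (simp add: g algebra_simps)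
    then show ?thesis unfolding cex_linear .
  qed
  have e3: "cex S (\<lambda>y. g y * g y) x = \<alpha> * cex S g x + \<beta> * cex S (\<lambda>y. g y * c y) x"
  proof -
    have "cex S (\<lambda>y. g y * g y) x = cex S (\<lambda>y. \<alpha> * g y + \<beta> * (g y * c y)) x"
      by (rule cex_cong) (simp add: g algebra_simps)
    then show ?thesis unfolding cex_linear .
  qed
  define V where "V = cov S c c x"
  have gc: "cov S g c x = \<beta> * V"
    unfolding cov_def V_def e1 e2 by (simp add: algebra_simps)
  have gg: "cov S g g x = \<beta> * (\<beta> * V)"
    unfolding gc[symmetric] unfolding cov_def e3 e1 by (simp add: algebra_simps)
  have Vge: "exp (- 2 * C) \<le> V"
  proof -
    have sq: "ent (\<lambda>z. z\<^sup>2) T f y = cov T f f y" for T f y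
      by (simp add: ent_def cov_def power2_eq_square)
    have "V = cex S (cov {i} c c) x + cov S (cex {i} c) (cex {i} c) x"
      using ent_chain[of "{i}" S x "\<lambda>z. z\<^sup>2" c] i x unfolding sq V_def by simp
    moreover have "0 \<le> cov S (cex {i} c) (cex {i} c) x"
      using cex_jensen_square[OF x, of S "cex {i} c"] by (simp add: cov_def power2_eq_square)
    moreover have "cex S (\<lambda>_. exp (- 2 * C)) x \<le> cex S (cov {i} c c) x"
    proof (rule cex_mono[OF x])
      fix y assume "y \<in> fib S x"
      then have y: "y \<in> \<Omega>" by (rule fib_in)
      have "(c y - c (flip i y)) * (c y - c (flip i y)) = 4"
        using cube_sq[OF y iI] by (simp add: c_def flip_apply algebra_simps)
      then show "exp (- 2 * C) \<le> cov {i} c c y"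
        using site_var_ge[OF y iI] by (simp add: cov_single[OF y iI])
    qed
    ultimately show ?thesis by (simp add: cex_const[OF x])
  qed
  then have one: "1 \<le> exp (2 * C) * V"
    by (simp add: exp_minus field_simps)
  have "0 < exp (- 2 * C)" by simp
  then have "0 \<le> V" using Vge by linarith
  then have "\<beta>\<^sup>2 * V * 1 \<le> \<beta>\<^sup>2 * V * (exp (2 * C) * V)"
    by (intro mult_left_mono one) simp
  moreover have "\<beta>\<^sup>2 * V * 1 = \<beta> * (\<beta> * V)" "\<beta>\<^sup>2 * V * (exp (2 * C) * V) = exp (2 * C) * (\<beta> * V)\<^sup>2"
    by (simp_all add: power2_eq_square)
  ultimately have "cov S g g x \<le> exp (2 * C) * (cov S g c x)\<^sup>2"
    unfolding gg gc by (simp only:)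
  then show ?thesis unfolding g_def[symmetric] c_def[symmetric] 1 .
qed

lemma marginal_variances:
  assumes S: "S \<subseteq> I" and x: "x \<in> \<Omega>"
  shows "(\<Sum>i\<in>S. cov S (cex (S - {i}) F) (cex (S - {i}) F) x)
    \<le> exp (2 * C) / (1 - s)\<^sup>2 * (\<Sum>i\<in>S. (influence S F x i)\<^sup>2)"
proof -
  have "(\<Sum>i\<in>S. cov S (cex (S - {i}) F) (cex (S - {i}) F) x) \<le> (\<Sum>i\<in>S. exp (2 * C) * (cov S F (\<lambda>y. y i) x)\<^sup>2)"
    by (intro sum_mono variance_marginal S x)
  also have "\<dots> = exp (2 * C) * (\<Sum>i\<in>S. (cov S F (\<lambda>y. y i) x)\<^sup>2)" by (simp add: sum_distrib_left)
  also have "\<dots> \<le> exp (2 * C) * ((\<Sum>i\<in>S. (influence S F x i)\<^sup>2) / (1 - s)\<^sup>2)"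
    by (intro mult_left_mono covariance_spin_sum S x) simp
  finally show ?thesis by simp
qed

definition local_var :: "nat \<Rightarrow> ((nat \<Rightarrow> real) \<Rightarrow> real) \<Rightarrow> (nat \<Rightarrow> real) \<Rightarrow> real" where
  "local_var i f y = site_var i y * (f y - f (flip i y))\<^sup>2"

lemma local_var_nonneg: "0 \<le> local_var i f y"
  by (simp add: local_var_def site_var_nonneg)

lemma poincare_conditional:
  assumes "S \<subseteq> I" "x \<in> \<Omega>"
  shows "ent (\<lambda>z. z\<^sup>2) S f x \<le> exp (2 * C) / (1 - s)\<^sup>2 * (\<Sum>i\<in>S. cex S (local_var i f) x)"
proof (rule entropy_induction[OF _ assms])
  fix S x assume S: "S \<subseteq> I" and x: "x \<in> \<Omega>"
  have "(\<Sum>i\<in>S. ent (\<lambda>z. z\<^sup>2) S (cex (S - {i}) f) x) = (\<Sum>i\<in>S. cov S (cex (S - {i}) f) (cex (S - {i}) f) x)"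
    by (simp add: ent_def cov_def power2_eq_square)
  also have "\<dots> \<le> exp (2 * C) / (1 - s)\<^sup>2 * (\<Sum>i\<in>S. (influence S f x i)\<^sup>2)"
    by (rule marginal_variances[OF S x])
  also have "\<dots> \<le> exp (2 * C) / (1 - s)\<^sup>2 * (\<Sum>i\<in>S. cex S (local_var i f) x)"
  proof (intro mult_left_mono sum_mono)
    fix i assume "i \<in> S"
    have "(influence S f x i)\<^sup>2 \<le> cex S (\<lambda>y. (2 * site_var i y * \<bar>f y - f (flip i y)\<bar>)\<^sup>2) x"
      unfolding influence_def by (rule cex_jensen_square[OF x])
    also have "\<dots> \<le> cex S (local_var i f) x"
    proof (rule cex_mono[OF x])
      fix y
      have "4 * site_var i y * site_var i y \<le> 1 * site_var i y"
        using site_var_le[of i y] site_var_nonneg[of i y] by (intro mult_right_mono) auto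
      then have "4 * site_var i y * site_var i y * (f y - f (flip i y))\<^sup>2 \<le> 1 * site_var i y * (f y - f (flip i y))\<^sup>2"
        by (rule mult_right_mono) simp
      then show "(2 * site_var i y * \<bar>f y - f (flip i y)\<bar>)\<^sup>2 \<le> local_var i f y"
        by (simp add: local_var_def power_mult_distrib power2_eq_square[of "site_var i y"] mult.assoc)
    qed
    finally show "(influence S f x i)\<^sup>2 \<le> cex S (local_var i f) x" .
  qed simp
  finally show "(\<Sum>i\<in>S. ent (\<lambda>z. z\<^sup>2) S (cex (S - {i}) f) x)
      \<le> exp (2 * C) / (1 - s)\<^sup>2 * (\<Sum>i\<in>S. cex S (local_var i f) x)" .
qed

text \<open>
  From \<open>ln z \<le> z - 1\<close> at \<open>z = g / E g\<close>. If \<open>E g = 0\<close> then \<open>g\<close> vanishes on the fiber and both sides are \<open>0\<close>,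
  the right one by the convention for division by \<open>0\<close>.
\<close>
lemma entropy_le_chi_square:
  assumes g: "\<And>y. y \<in> fib S x \<Longrightarrow> 0 \<le> g y" and x: "x \<in> \<Omega>"
  shows "ent (\<lambda>z. z * ln z) S g x \<le> cov S g g x / cex S g x"
proof (cases "cex S g x = 0")
  case True
  then have "(\<Sum>y\<in>fib S x. w y * g y) = 0"
    using fib_Z_pos[OF x, of S] by (simp add: cex_def)
  then have "\<forall>y\<in>fib S x. w y * g y = 0"
    using g less_imp_le[OF w_pos] by (subst (asm) sum_nonneg_eq_0_iff) auto
  then have "\<And>y. y \<in> fib S x \<Longrightarrow> g y = 0" using w_pos by (metis less_irrefl mult_eq_0_iff)
  then have "cex S (\<lambda>y. g y * ln (g y)) x = cex S (\<lambda>y. 0) x"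
    by (intro cex_cong) auto
  then show ?thesis using True cex_const[OF x, of S 0] by (simp add: ent_def)
next
  case False
  define m where "m = cex S g x"
  have m: "m > 0" using False cex_nonneg[OF x g] by (simp add: m_def order.strict_iff_order)
  have "cex S (\<lambda>y. g y * ln (g y)) x \<le> cex S (\<lambda>y. 1 / m * (g y * g y) + (ln m - 1) * g y) x"
  proof (rule cex_mono[OF x])
    fix y assume y: "y \<in> fib S x"
    show "g y * ln (g y) \<le> 1 / m * (g y * g y) + (ln m - 1) * g y"
    proof (cases "g y = 0")
      case False
      then have gy: "g y > 0" using g[OF y] by simp
      have "ln (g y / m) \<le> g y / m - 1" using gy m by (intro ln_le_minus_one) simp
      then have "ln (g y) \<le> g y / m - 1 + ln m" using gy m by (simp add: ln_div)
      then have "g y * ln (g y) \<le> g y * (g y / m - 1 + ln m)" using gy by (intro mult_left_mono) auto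
      then show ?thesis by (simp add: algebra_simps)
    qed simp
  qed
  also have "\<dots> = 1 / m * cex S (\<lambda>y. g y * g y) x + (ln m - 1) * m"
    unfolding cex_linear m_def ..
  finally have "ent (\<lambda>z. z * ln z) S g x \<le> 1 / m * cex S (\<lambda>y. g y * g y) x - m"
    by (simp add: ent_def m_def[symmetric] algebra_simps)
  also have "\<dots> = cov S g g x / m"
    using m by (simp add: cov_def m_def[symmetric] field_simps)
  finally show ?thesis by (simp add: m_def)
qed

text \<open>
  The entropies of the marginals of \<open>F = f\<^sup>2\<close> are bounded by variances divided by \<open>E F\<close>. In the influences
  write \<open>F(y) - F(y\<^sup>i) = (f(y) - f(y\<^sup>i)) (f(y) + f(y\<^sup>i))\<close>; Cauchy--Schwarz separates the gradient of \<open>f\<close> from a factor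
  that is at most a multiple of \<open>E F\<close> and cancels the denominator.
\<close>
lemma log_sobolev_conditional:
  assumes "S \<subseteq> I" "x \<in> \<Omega>"
  shows "ent (\<lambda>z. z * ln z) S (\<lambda>y. (f y)\<^sup>2) x \<le> 8 * exp (2 * C) / (1 - s)\<^sup>2 * (\<Sum>i\<in>S. cex S (local_var i f) x)"
proof (rule entropy_induction[OF _ assms])
  fix S x assume S: "S \<subseteq> I" and x: "x \<in> \<Omega>"
  define F where "F = (\<lambda>y. (f y)\<^sup>2)"
  define m where "m = cex S F x"
  have m: "0 \<le> m" unfolding m_def F_def by (rule cex_nonneg[OF x]) simp
  have "(\<Sum>i\<in>S. ent (\<lambda>z. z * ln z) S (cex (S - {i}) F) x) \<le>
      (\<Sum>i\<in>S. cov S (cex (S - {i}) F) (cex (S - {i}) F) x / m)"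
  proof (rule sum_mono)
    fix i assume "i \<in> S"
    have "ent (\<lambda>z. z * ln z) S (cex (S - {i}) F) x \<le>
        cov S (cex (S - {i}) F) (cex (S - {i}) F) x / cex S (cex (S - {i}) F) x"
      by (intro entropy_le_chi_square x cex_nonneg) (auto simp: F_def dest: fib_in)
    then show "ent (\<lambda>z. z * ln z) S (cex (S - {i}) F) x \<le> cov S (cex (S - {i}) F) (cex (S - {i}) F) x / m"
      using x by (simp add: m_def cex_tower)
  qed
  also have "\<dots> = (\<Sum>i\<in>S. cov S (cex (S - {i}) F) (cex (S - {i}) F) x) / m"
    by (simp add: sum_divide_distrib)
  also have "\<dots> \<le> (exp (2 * C) / (1 - s)\<^sup>2 * (\<Sum>i\<in>S. (influence S F x i)\<^sup>2)) / m"
    by (rule divide_right_mono[OF marginal_variances[OF S x] m])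
  also have "\<dots> \<le> (exp (2 * C) / (1 - s)\<^sup>2 * (\<Sum>i\<in>S. 8 * m * cex S (local_var i f) x)) / m"
  proof (intro divide_right_mono mult_left_mono sum_mono m)
    fix i assume i: "i \<in> S"
    then have iI: "i \<in> I" using S by auto
    have "influence S F x i = cex S (\<lambda>y. (2 * sqrt (site_var i y) * \<bar>f y - f (flip i y)\<bar>) *
        (sqrt (site_var i y) * \<bar>f y + f (flip i y)\<bar>)) x"
      unfolding influence_def
    proof (rule cex_cong)
      fix y
      have "F y - F (flip i y) = (f y - f (flip i y)) * (f y + f (flip i y))"
        by (simp add: F_def power2_eq_square algebra_simps)
      moreover have "sqrt (site_var i y) * sqrt (site_var i y) = site_var i y"
        using site_var_nonneg by simp
      moreover have "(2 * sqrt (site_var i y) * \<bar>f y - f (flip i y)\<bar>) * (sqrt (site_var i y) * \<bar>f y + f (flip i y)\<bar>)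
         = 2 * (sqrt (site_var i y) * sqrt (site_var i y)) * (\<bar>f y - f (flip i y)\<bar> * \<bar>f y + f (flip i y)\<bar>)"
        by (simp only: mult_ac)
      ultimately show "2 * site_var i y * \<bar>F y - F (flip i y)\<bar> = (2 * sqrt (site_var i y) * \<bar>f y - f (flip i y)\<bar>) *
        (sqrt (site_var i y) * \<bar>f y + f (flip i y)\<bar>)"
        by (simp add: abs_mult)
    qed
    then have "(influence S F x i)\<^sup>2 \<le> cex S (\<lambda>y. (2 * sqrt (site_var i y) * \<bar>f y - f (flip i y)\<bar>)\<^sup>2) x *
        cex S (\<lambda>y. (sqrt (site_var i y) * \<bar>f y + f (flip i y)\<bar>)\<^sup>2) x"
      using cex_cauchy_schwarz[OF x] by simp
    also have "cex S (\<lambda>y. (2 * sqrt (site_var i y) * \<bar>f y - f (flip i y)\<bar>)\<^sup>2) x = 4 * cex S (local_var i f) x"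
      unfolding cex_cmult[symmetric]
      by (rule cex_cong) (simp add: local_var_def power_mult_distrib site_var_nonneg)
    also have "cex S (\<lambda>y. (sqrt (site_var i y) * \<bar>f y + f (flip i y)\<bar>)\<^sup>2) x \<le> cex S (\<lambda>y. 2 * cex {i} F y) x"
    proof (rule cex_mono[OF x])
      fix y assume "y \<in> fib S x"
      then have y: "y \<in> \<Omega>" by (rule fib_in)
      define a b where "a = w y" "b = w (flip i y)"
      have ab: "a > 0" "b > 0" using w_pos by (auto simp: a_b_def)
      have "a * b * (f y + f (flip i y))\<^sup>2 \<le> a * b * (2 * (F y + F (flip i y)))"
      proof (rule mult_left_mono)
        show "(f y + f (flip i y))\<^sup>2 \<le> 2 * (F y + F (flip i y))"
          using zero_le_power2[of "f y - f (flip i y)"] unfolding F_def power2_diff power2_sum by simp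
      qed (use ab in simp)
      also have "\<dots> = 2 * (b * (a * F y) + a * (b * F (flip i y)))" by (simp add: algebra_simps)
      also have "\<dots> \<le> 2 * ((a + b) * (a * F y) + (a + b) * (b * F (flip i y)))"
        using ab by (intro mult_left_mono add_mono mult_right_mono) (auto simp: F_def)
      also have "\<dots> = (a + b)\<^sup>2 * (2 * ((a * F y + b * F (flip i y)) / (a + b)))"
        using ab by (simp add: power2_eq_square field_simps)
      finally have "a * b / (a + b)\<^sup>2 * (f y + f (flip i y))\<^sup>2 \<le> 2 * ((a * F y + b * F (flip i y)) / (a + b))"
        using ab by (simp add: divide_le_eq mult.commute)
      then show "(sqrt (site_var i y) * \<bar>f y + f (flip i y)\<bar>)\<^sup>2 \<le> 2 * cex {i} F y"
        using site_var_nonneg[of i y] unfolding cex_single[OF y iI] a_b_def[symmetric]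
        by (simp add: power_mult_distrib) (simp add: site_var_def a_b_def)
    qed
    also have "\<dots> = 2 * m"
      using x i by (simp add: cex_cmult cex_tower m_def)
    finally have "(influence S F x i)\<^sup>2 \<le> 4 * cex S (local_var i f) x * (2 * m)"
      using cex_nonneg[OF x, of S "local_var i f"] by (simp add: local_var_nonneg mult_left_mono)
    then show "(influence S F x i)\<^sup>2 \<le> 8 * m * cex S (local_var i f) x" by (simp add: mult_ac)
  qed simp
  also have "\<dots> \<le> 8 * exp (2 * C) / (1 - s)\<^sup>2 * (\<Sum>i\<in>S. cex S (local_var i f) x)"
  proof (cases "m = 0")
    case False
    then show ?thesis by (simp add: sum_distrib_left[symmetric] mult_ac)
  next
    case True
    have "0 \<le> (\<Sum>i\<in>S. cex S (local_var i f) x)"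
      by (intro sum_nonneg cex_nonneg x local_var_nonneg)
    then show ?thesis using True by simp
  qed
  finally show "(\<Sum>i\<in>S. ent (\<lambda>z. z * ln z) S (cex (S - {i}) F) x)
      \<le> 8 * exp (2 * C) / (1 - s)\<^sup>2 * (\<Sum>i\<in>S. cex S (local_var i f) x)" .
qed

end

section \<open>Reversibility and dissipation of energy\<close>

context ising_model begin

definition E :: "((nat \<Rightarrow> real) \<Rightarrow> real) \<Rightarrow> real" where
  "E f = (\<Sum>x\<in>\<Omega>. \<mu> x * f x)"

lemma expectation_eq: "measure_pmf.expectation (ising n J) f = E f"
proof -
  have "measure_pmf.expectation (ising n J) f = (\<Sum>x\<in>\<Omega>. f x * \<mu> x)"
    by (rule integral_measure_pmf_real) (auto simp: set_pmf_iff pmf_ising split: if_splits)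
  then show ?thesis by (simp add: E_def mult.commute)
qed

lemma E_cex: "E f = cex I f x"
  by (simp add: E_def cex_full)

lemma E_linear: "E (\<lambda>x. a * f x + b * g x) = a * E f + b * E g"
  unfolding E_cex[of _ undefined] by (rule cex_linear)

lemma E_cmult: "E (\<lambda>x. a * f x) = a * E f"
  unfolding E_cex[of _ undefined] by (rule cex_cmult)

lemma E_diff: "E (\<lambda>x. f x - g x) = E f - E g"
  unfolding E_cex[of _ undefined] by (rule cex_diff)

lemma E_const: "E (\<lambda>_. c) = c"
  by (simp add: E_def sum_distrib_right[symmetric] \<mu>_sum)

lemma E_cong: "(\<And>x. x \<in> \<Omega> \<Longrightarrow> f x = g x) \<Longrightarrow> E f = E g"
  by (simp add: E_def)

lemma E_mono: "(\<And>x. x \<in> \<Omega> \<Longrightarrow> f x \<le> g x) \<Longrightarrow> E f \<le> E g"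
  unfolding E_def by (intro sum_mono mult_left_mono less_imp_le[OF \<mu>_pos]) auto

lemma E_nonneg: "(\<And>x. x \<in> \<Omega> \<Longrightarrow> 0 \<le> f x) \<Longrightarrow> 0 \<le> E f"
  unfolding E_def by (intro sum_nonneg mult_nonneg_nonneg less_imp_le[OF \<mu>_pos]) auto

lemma E_eq_0D:
  assumes "\<And>x. x \<in> \<Omega> \<Longrightarrow> 0 \<le> f x" "E f = 0" "x \<in> \<Omega>"
  shows "f x = 0"
proof -
  have "\<forall>x\<in>\<Omega>. \<mu> x * f x = 0"
    using assms(2) unfolding E_def
    by (subst (asm) sum_nonneg_eq_0_iff) (auto intro!: mult_nonneg_nonneg less_imp_le[OF \<mu>_pos] assms(1))
  then show ?thesis using \<mu>_pos[OF assms(3)] assms(3) by auto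
qed

lemma E_sum: "finite A \<Longrightarrow> E (\<lambda>x. \<Sum>a\<in>A. g a x) = (\<Sum>a\<in>A. E (g a))"
  unfolding E_cex[of _ undefined] by (rule cex_sum)

lemma E_cauchy_schwarz: "(E (\<lambda>x. f x * g x))\<^sup>2 \<le> E (\<lambda>x. (f x)\<^sup>2) * E (\<lambda>x. (g x)\<^sup>2)"
proof -
  obtain x where "x \<in> \<Omega>" using cube_nonempty by blast
  then show ?thesis unfolding E_cex[of _ x] by (rule cex_cauchy_schwarz)
qed

lemma E_jensen_square: "(E f)\<^sup>2 \<le> E (\<lambda>x. (f x)\<^sup>2)"
  using E_cauchy_schwarz[of f "\<lambda>_. 1"] by (simp add: E_const)

lemma E_flip: "i \<in> I \<Longrightarrow> (\<Sum>x\<in>\<Omega>. F (flip i x)) = (\<Sum>x\<in>\<Omega>. F x)"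
  by (rule sum_cube_flip)

lemma detailed_balance:
  assumes "x \<in> \<Omega>" "i \<in> I"
  shows "\<mu> (flip i x) * q i (flip i x) = \<mu> x * q i x"
proof -
  have "field i (flip i x) = field i x"
    unfolding field_def by (intro sum.cong) (auto simp: flip_apply)
  then show ?thesis
    unfolding \<mu>_flip[OF assms] q_eq[OF assms] q_eq[OF flip_in_cube[OF assms] assms(2)]
    by (simp add: flip_apply exp_add[symmetric] mult.assoc)
qed

definition Dir :: "((nat \<Rightarrow> real) \<Rightarrow> real) \<Rightarrow> ((nat \<Rightarrow> real) \<Rightarrow> real) \<Rightarrow> real" where
  "Dir f g = (\<Sum>i\<in>I. E (\<lambda>x. 1 / 2 * q i x * ((f (flip i x) - f x) * (g (flip i x) - g x))))"

lemma Dir_sym: "Dir f g = Dir g f"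
  by (simp add: Dir_def mult.commute[of "f _ - f _"])

text \<open>
  Reversibility: symmetrize over \<open>x\<close> and \<open>x\<^sup>i\<close>.
\<close>
lemma E_generator: "E (\<lambda>x. g x * L f x) = - Dir f g"
proof -
  have one: "E (\<lambda>x. g x * (q i x * (f (flip i x) - f x))) =
      - E (\<lambda>x. 1 / 2 * q i x * ((f (flip i x) - f x) * (g (flip i x) - g x)))" if i: "i \<in> I" for i
  proof -
    define S1 where "S1 = E (\<lambda>x. g x * (q i x * (f (flip i x) - f x)))"
    define S2 where "S2 = E (\<lambda>x. g (flip i x) * (q i x * (f x - f (flip i x))))"
    have "S1 = (\<Sum>x\<in>\<Omega>. \<mu> (flip i x) * (g (flip i x) * (q i (flip i x) * (f (flip i (flip i x)) - f (flip i x)))))"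
      unfolding S1_def E_def by (rule E_flip[OF i, symmetric])
    also have "\<dots> = S2"
      unfolding S2_def E_def
    proof (rule sum.cong[OF refl])
      fix x assume x: "x \<in> \<Omega>"
      have "\<mu> (flip i x) * (g (flip i x) * (q i (flip i x) * (f (flip i (flip i x)) - f (flip i x)))) =
        (\<mu> (flip i x) * q i (flip i x)) * (g (flip i x) * (f x - f (flip i x)))" by simp
      also have "\<dots> = \<mu> x * (g (flip i x) * (q i x * (f x - f (flip i x))))"
        unfolding detailed_balance[OF x i] by simp
      finally show "\<mu> (flip i x) * (g (flip i x) * (q i (flip i x) * (f (flip i (flip i x)) - f (flip i x)))) =
        \<mu> x * (g (flip i x) * (q i x * (f x - f (flip i x))))" .
    qed
    finally have S: "S1 = 1 / 2 * S1 + 1 / 2 * S2" by simp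
    also have "\<dots> = E (\<lambda>x. 1 / 2 * (g x * (q i x * (f (flip i x) - f x))) + 1 / 2 * (g (flip i x) * (q i x * (f x - f (flip i x)))))"
      unfolding S1_def S2_def E_linear ..
    also have "\<dots> = E (\<lambda>x. (-1) * (1 / 2 * q i x * ((f (flip i x) - f x) * (g (flip i x) - g x))))"
      by (rule E_cong) (simp add: algebra_simps)
    also have "\<dots> = - E (\<lambda>x. 1 / 2 * q i x * ((f (flip i x) - f x) * (g (flip i x) - g x)))"
      unfolding E_cmult by simp
    finally show ?thesis unfolding S1_def .
  qed
  have "E (\<lambda>x. g x * L f x) = (\<Sum>i\<in>I. E (\<lambda>x. g x * (q i x * (f (flip i x) - f x))))"
    unfolding generator_def sum_distrib_left by (rule E_sum) simp
  also have "\<dots> = - Dir f g"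
    unfolding Dir_def sum_negf[symmetric] by (intro sum.cong refl one)
  finally show ?thesis .
qed

lemma Dir_nonneg: "0 \<le> Dir f f"
  unfolding Dir_def
proof (intro sum_nonneg E_nonneg)
  fix i x assume "i \<in> I" "x \<in> \<Omega>"
  then show "0 \<le> 1 / 2 * q i x * ((f (flip i x) - f x) * (f (flip i x) - f x))"
    using q_bounds(3)[of x i] by (intro mult_nonneg_nonneg[OF _ zero_le_square]) simp
qed

lemma q_lower: "x \<in> \<Omega> \<Longrightarrow> i \<in> I \<Longrightarrow> 1 \<le> 2 * exp C * q i x"
proof -
  assume "x \<in> \<Omega>" "i \<in> I"
  then have "2 * exp C * (exp (- C) / 2) \<le> 2 * exp C * q i x" by (intro mult_left_mono q_bounds) auto
  then show ?thesis by (simp add: exp_minus)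
qed

lemma E_\<Gamma>: "E (\<Gamma> f) = (\<Sum>i\<in>I. E (\<lambda>x. (\<delta> i f x)\<^sup>2))"
  unfolding Gamma_star_def[abs_def] by (rule E_sum) simp

lemma E_\<Gamma>_le_Dir: "E (\<Gamma> f) \<le> exp C * Dir f f"
  unfolding E_\<Gamma> Dir_def sum_distrib_left
proof (rule sum_mono)
  fix i assume i: "i \<in> I"
  show "E (\<lambda>x. (\<delta> i f x)\<^sup>2) \<le> exp C * E (\<lambda>x. 1 / 2 * q i x * ((f (flip i x) - f x) * (f (flip i x) - f x)))"
    unfolding E_cmult[symmetric]
  proof (rule E_mono)
    fix x assume x: "x \<in> \<Omega>"
    have "q i x * (q i x * (f (flip i x) - f x)\<^sup>2) \<le> exp C / 2 * (q i x * (f (flip i x) - f x)\<^sup>2)"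
      using q_bounds[OF x i] by (intro mult_right_mono) auto
    then show "(\<delta> i f x)\<^sup>2 \<le> exp C * (1 / 2 * q i x * ((f (flip i x) - f x) * (f (flip i x) - f x)))"
      by (simp add: delta_star_def power2_eq_square mult_ac)
  qed
qed

lemma Dir_le_E_\<Gamma>: "Dir f f \<le> exp C * E (\<Gamma> f)"
  unfolding E_\<Gamma> Dir_def sum_distrib_left
proof (rule sum_mono)
  fix i assume i: "i \<in> I"
  show "E (\<lambda>x. 1 / 2 * q i x * ((f (flip i x) - f x) * (f (flip i x) - f x))) \<le> exp C * E (\<lambda>x. (\<delta> i f x)\<^sup>2)"
    unfolding E_cmult[symmetric]
  proof (rule E_mono)
    fix x assume x: "x \<in> \<Omega>"
    have "1 * (1 / 2 * (q i x * (f (flip i x) - f x)\<^sup>2)) \<le> (2 * exp C * q i x) * (1 / 2 * (q i x * (f (flip i x) - f x)\<^sup>2))"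
      using q_bounds(3)[OF x i] by (intro mult_right_mono q_lower[OF x i]) auto
    then show "1 / 2 * q i x * ((f (flip i x) - f x) * (f (flip i x) - f x)) \<le> exp C * (\<delta> i f x)\<^sup>2"
      by (simp add: delta_star_def power2_eq_square mult_ac)
  qed
qed

lemma E_deriv:
  assumes "\<And>x. x \<in> \<Omega> \<Longrightarrow> ((\<lambda>t. g t x) has_real_derivative g' x) (at t)"
  shows "((\<lambda>t. E (g t)) has_real_derivative E g') (at t)"
  unfolding E_def by (intro DERIV_sum DERIV_cmult assms)

lemma E_P: "E (P t f) = E f"
proof -
  have "((\<lambda>t. E (P t f)) has_real_derivative 0) (at t)" for t
  proof -
    have "((\<lambda>t. E (P t f)) has_real_derivative E (L (P t f))) (at t)"
      by (rule E_deriv) (rule P_deriv)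
    moreover have "E (L (P t f)) = 0"
      using E_generator[of "\<lambda>_. 1" "P t f"] by (simp add: Dir_def E_const)
    ultimately show ?thesis by simp
  qed
  then have "E (P t f) = E (P 0 f)" by (intro DERIV_isconst_all allI)
  then show ?thesis by (simp add: P_zero E_def)
qed

definition energy :: "((nat \<Rightarrow> real) \<Rightarrow> real) \<Rightarrow> real \<Rightarrow> real" where
  "energy f t = E (\<lambda>x. (P t f x)\<^sup>2)"

lemma energy_deriv: "(energy f has_real_derivative - 2 * Dir (P t f) (P t f)) (at t)"
proof -
  have "((\<lambda>t. E (\<lambda>x. (P t f x)\<^sup>2)) has_real_derivative E (\<lambda>x. 2 * (P t f x * L (P t f) x))) (at t)"
    by (rule E_deriv) (intro DERIV_square P_deriv)
  then show ?thesis unfolding energy_def[abs_def] E_cmult E_generator by simp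
qed

lemma energy_zero: "energy f 0 = E (\<lambda>x. (f x)\<^sup>2)"
  by (simp add: energy_def P_zero)

lemma P_self_adjoint: "E (\<lambda>x. P s f x * g x) = E (\<lambda>x. f x * P s g x)"
proof -
  define h where "h = (\<lambda>r. E (\<lambda>x. P r f x * P (s - r) g x))"
  have "(h has_real_derivative 0) (at r)" for r
  proof -
    have "((\<lambda>r. P (s - r) g x) has_real_derivative - L (P (s - r) g) x) (at r)" if "x \<in> \<Omega>" for x
    proof -
      have "((\<lambda>r. s - r) has_real_derivative - 1) (at r)" by (auto intro!: derivative_eq_intros)
      from DERIV_chain2[OF P_deriv[OF that] this] show ?thesis by simp
    qed
    then have "(h has_real_derivative E (\<lambda>x. L (P r f) x * P (s - r) g x + - L (P (s - r) g) x * P r f x)) (at r)"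
      unfolding h_def by (intro E_deriv DERIV_mult P_deriv)
    moreover have "E (\<lambda>x. L (P r f) x * P (s - r) g x + - L (P (s - r) g) x * P r f x) =
       E (\<lambda>x. 1 * (P (s - r) g x * L (P r f) x) + (-1) * (P r f x * L (P (s - r) g) x))"
      by (rule E_cong) simp
    ultimately show ?thesis unfolding E_linear E_generator using Dir_sym[of "P r f"] by simp
  qed
  then have "h s = h 0" by (intro DERIV_isconst_all allI)
  then show ?thesis by (simp add: h_def P_zero)
qed

text \<open>
  Log-convexity of the second moment along the semigroup, at a midpoint: \<open>E (P\<^sub>t\<^sub>/\<^sub>2 g)\<^sup>2 = E (g P\<^sub>t g)\<close>.
\<close>
lemma energy_half:
  assumes "0 \<le> t"
  shows "(energy g (t / 2))\<^sup>2 \<le> energy g 0 * energy g t"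
proof -
  have "energy g (t / 2) = E (\<lambda>x. P (t / 2) g x * P (t / 2) g x)"
    by (simp add: energy_def power2_eq_square)
  also have "\<dots> = E (\<lambda>x. g x * P (t / 2) (P (t / 2) g) x)" by (rule P_self_adjoint)
  also have "\<dots> = E (\<lambda>x. g x * P t g x)"
    by (rule E_cong) (use assms P_semigroup[of _ "t/2" "t/2" g] in simp)
  finally show ?thesis using E_cauchy_schwarz[of g "P t g"] by (simp add: energy_zero) (simp add: energy_def)
qed

text \<open>
  The Dirichlet form decreases along the semigroup, since its derivative is \<open>- 2 E (L P\<^sub>t f)\<^sup>2\<close>, and the
  energy has derivative \<open>- 2\<close> times the Dirichlet form.
\<close>
lemma Dir_decreasing:
  assumes "0 \<le> t"
  shows "2 * t * Dir (P t f) (P t f) \<le> energy f 0 - energy f t"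
proof -
  have L_deriv: "((\<lambda>t. L (P t f) x) has_real_derivative L (L (P t f)) x) (at t)" if "x \<in> \<Omega>" for x t
  proof -
    have eq: "L g x = (\<Sum>i\<in>I. q i x * (g (flip i x) - g x))" for g
      by (simp add: generator_def)
    have "((\<lambda>t. \<Sum>i\<in>I. q i x * (P t f (flip i x) - P t f x)) has_real_derivative
        (\<Sum>i\<in>I. q i x * (L (P t f) (flip i x) - L (P t f) x))) (at t)"
      by (intro DERIV_sum DERIV_cmult DERIV_diff P_deriv) (use that flip_in_cube in auto)
    then show ?thesis by (simp only: eq)
  qed
  have dD: "((\<lambda>t. Dir (P t f) (P t f)) has_real_derivative - (2 * E (\<lambda>x. (L (P t f) x)\<^sup>2))) (at t)" for t
  proof -
    let ?u = "P t f"
    have "((\<lambda>t. E (\<lambda>x. P t f x * L (P t f) x)) has_real_derivative E (\<lambda>x. L ?u x * L ?u x + L (L ?u) x * ?u x)) (at t)"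
      by (intro E_deriv DERIV_mult P_deriv L_deriv)
    moreover have "E (\<lambda>x. L ?u x * L ?u x + L (L ?u) x * ?u x) =
        E (\<lambda>x. 1 * (L ?u x)\<^sup>2 + 1 * (?u x * L (L ?u) x))"
      by (rule E_cong) (simp add: power2_eq_square)
    moreover have "E (\<lambda>x. ?u x * L (L ?u) x) = E (\<lambda>x. (L ?u x)\<^sup>2)"
      unfolding power2_eq_square E_generator by (rule arg_cong[where f = uminus, OF Dir_sym])
    ultimately have "((\<lambda>t. E (\<lambda>x. P t f x * L (P t f) x)) has_real_derivative 2 * E (\<lambda>x. (L ?u x)\<^sup>2)) (at t)"
      unfolding E_linear by simp
    from DERIV_minus[OF this] show ?thesis unfolding E_generator by simp
  qed
  have mono: "Dir (P t f) (P t f) \<le> Dir (P r f) (P r f)" if "r \<le> t" for r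
    by (rule DERIV_nonpos_imp_nonincreasing[OF that])
       (use dD E_nonneg[of "\<lambda>x. (L (P _ f) x)\<^sup>2"] in force)
  define d where "d = Dir (P t f) (P t f)"
  have "energy f t + 2 * d * t \<le> energy f 0 + 2 * d * 0"
  proof (rule DERIV_nonpos_imp_nonincreasing[OF assms, where f = "\<lambda>r. energy f r + 2 * d * r"])
    fix r assume "0 \<le> r" "r \<le> t"
    have "((\<lambda>r. energy f r + 2 * d * r) has_real_derivative - 2 * Dir (P r f) (P r f) + 2 * d) (at r)"
      by (auto intro!: derivative_eq_intros energy_deriv)
    then show "\<exists>y. ((\<lambda>r. energy f r + 2 * d * r) has_real_derivative y) (at r) \<and> y \<le> 0"
      using mono[OF \<open>r \<le> t\<close>] by (auto simp: d_def)
  qed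
  then have "2 * t * d \<le> energy f 0 - energy f t" by (simp add: mult_ac)
  then show ?thesis by (simp only: d_def)
qed

definition Var :: "((nat \<Rightarrow> real) \<Rightarrow> real) \<Rightarrow> real" where
  "Var f = E (\<lambda>x. (f x)\<^sup>2) - (E f)\<^sup>2"

lemma Var_ising_eq: "Var_ising n J f = Var f"
proof -
  have "Var_ising n J f = E (\<lambda>x. (f x - E f)\<^sup>2)"
    by (simp add: Var_ising_def expectation_eq)
  also have "\<dots> = E (\<lambda>x. 1 * (f x)\<^sup>2 + (- 1) * (2 * E f * f x + - (E f)\<^sup>2 * 1))"
    by (rule E_cong) (simp add: power2_eq_square algebra_simps)
  also have "\<dots> = Var f"
    unfolding E_linear E_const Var_def by (simp add: power2_eq_square)
  finally show ?thesis .
qed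

lemma Var_centered: "Var f = E (\<lambda>x. (f x - E f)\<^sup>2)"
  using Var_ising_eq[of f] by (simp add: Var_ising_def expectation_eq)

lemma Var_nonneg: "0 \<le> Var f"
  unfolding Var_centered by (rule E_nonneg) simp

lemma Var_P: "Var (P t f) = energy f t - (E f)\<^sup>2"
  by (simp add: Var_def energy_def E_P)

lemma Var_P_centered:
  assumes "0 \<le> t"
  shows "Var (P t f) = energy (\<lambda>x. f x - E f) t"
proof -
  have "P t (\<lambda>x. f x - E f) x = P t f x - E f" if x: "x \<in> \<Omega>" for x
    using P_linear[OF x assms, of 1 f "- 1" "\<lambda>_. E f"] by (simp add: P_const[OF x assms])
  then show ?thesis unfolding Var_centered E_P energy_def by (intro E_cong) simp
qed

section \<open>The Neumann series of the coupling matrix\<close>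

text \<open>
  Multiplication by \<open>M / (2 \<kappa>)\<close>, which halves the maximum norm.
\<close>
definition resolvent_step :: "(nat \<Rightarrow> real) \<Rightarrow> nat \<Rightarrow> real" where
  "resolvent_step g i = (\<Sum>k\<in>I. M i k * g k) / (2 * \<kappa>)"

lemma resolvent_step_bound:
  assumes "\<And>k. k \<in> I \<Longrightarrow> 0 \<le> g k \<and> g k \<le> c" "i \<in> I"
  shows "0 \<le> resolvent_step g i \<and> resolvent_step g i \<le> c / 2"
proof
  show "0 \<le> resolvent_step g i"
    unfolding resolvent_step_def using assms \<kappa>_pos
    by (intro divide_nonneg_pos sum_nonneg mult_nonneg_nonneg M_nonneg) auto
  have c: "0 \<le> c" using assms by fastforce
  have "(\<Sum>k\<in>I. M i k * g k) \<le> (\<Sum>k\<in>I. M i k * c)"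
    using assms by (intro sum_mono mult_left_mono M_nonneg) auto
  also have "\<dots> = (\<Sum>k\<in>I. M i k) * c" by (simp add: sum_distrib_right)
  also have "\<dots> \<le> \<kappa> * c" by (intro mult_right_mono M_row assms c)
  finally show "resolvent_step g i \<le> c / 2"
    unfolding resolvent_step_def using \<kappa>_pos by (simp add: divide_le_eq mult.commute)
qed

lemma resolvent_exists:
  obtains R :: "nat \<Rightarrow> nat \<Rightarrow> real" where
    "\<And>i j. i \<in> I \<Longrightarrow> 0 \<le> R i j"
    "\<And>i j. i \<in> I \<Longrightarrow> R i j = (if i = j then 1 else 0) + resolvent_step (\<lambda>k. R k j) i"
proof
  define e where "e = (\<lambda>j i :: nat. if i = j then 1 else 0 :: real)"
  define T where "T = (\<lambda>j m. (resolvent_step ^^ m) (e j))"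
  have T: "0 \<le> T j m i \<and> T j m i \<le> (1 / 2) ^ m" if "i \<in> I" for i j m
    using that
  proof (induction m arbitrary: i)
    case 0
    then show ?case by (simp add: T_def e_def)
  next
    case (Suc m)
    have "0 \<le> resolvent_step (T j m) i \<and> resolvent_step (T j m) i \<le> (1 / 2) ^ m / 2"
      by (rule resolvent_step_bound[OF Suc.IH Suc.prems])
    then show ?case by (simp add: T_def)
  qed
  have sm: "summable (\<lambda>m. T j m i)" if "i \<in> I" for i j
  proof (rule summable_comparison_test')
    show "summable (\<lambda>m. (1 / 2 :: real) ^ m)" by (rule summable_geometric) simp
    show "norm (T j m i) \<le> (1 / 2) ^ m" for m using T[OF that, of j m] by simp
  qed
  show "0 \<le> (\<Sum>m. T j m i)" if "i \<in> I" for i j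
    using T[OF that] by (intro suminf_nonneg sm that) auto
  show "(\<Sum>m. T j m i) = (if i = j then 1 else 0) + resolvent_step (\<lambda>k. \<Sum>m. T j m k) i" if i: "i \<in> I" for i j
  proof -
    have "resolvent_step (\<lambda>k. \<Sum>m. T j m k) i = (\<Sum>m. resolvent_step (T j m) i)"
    proof -
      have "(\<Sum>m. resolvent_step (T j m) i) = (\<Sum>m. \<Sum>k\<in>I. M i k * T j m k / (2 * \<kappa>))"
        by (simp add: resolvent_step_def sum_divide_distrib)
      also have "\<dots> = (\<Sum>k\<in>I. \<Sum>m. M i k * T j m k / (2 * \<kappa>))"
        by (intro suminf_sum summable_divide summable_mult sm)
      also have "\<dots> = (\<Sum>k\<in>I. M i k * (\<Sum>m. T j m k) / (2 * \<kappa>))"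
        by (intro sum.cong refl) (simp only: suminf_divide[OF summable_mult[OF sm]] suminf_mult[OF sm])
      finally show ?thesis by (simp add: resolvent_step_def sum_divide_distrib)
    qed
    also have "\<dots> = (\<Sum>m. T j (Suc m) i)" by (simp add: T_def)
    finally show ?thesis using suminf_split_head[OF sm[OF i, of j]] by (simp add: T_def e_def)
  qed
qed

text \<open>
  The inverse of \<open>1 - M / (2 \<kappa>)\<close>, a nonnegative matrix with \<open>M R \<le> 2 \<kappa> R\<close> and with diagonal entries at
  least \<open>1\<close>. It serves in place of the exponential of \<open>M\<close> in the comparison of gradients.
\<close>
definition R :: "nat \<Rightarrow> nat \<Rightarrow> real" where
  "R = (SOME R. (\<forall>i\<in>I. \<forall>j. 0 \<le> R i j) \<and>
     (\<forall>i\<in>I. \<forall>j. R i j = (if i = j then 1 else 0) + resolvent_step (\<lambda>k. R k j) i))"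

lemma R_nonneg: "i \<in> I \<Longrightarrow> 0 \<le> R i j"
  and R_eq: "i \<in> I \<Longrightarrow> R i j = (if i = j then 1 else 0) + resolvent_step (\<lambda>k. R k j) i"
proof -
  have "\<exists>R. (\<forall>i\<in>I. \<forall>j. 0 \<le> R i j) \<and>
     (\<forall>i\<in>I. \<forall>j. R i j = (if i = j then 1 else 0) + resolvent_step (\<lambda>k. R k j) i)"
    by (rule resolvent_exists) blast
  from someI_ex[OF this, folded R_def]
  show "i \<in> I \<Longrightarrow> 0 \<le> R i j" "i \<in> I \<Longrightarrow> R i j = (if i = j then 1 else 0) + resolvent_step (\<lambda>k. R k j) i"
    by blast+
qed

lemma M_R_le:
  assumes "i \<in> I"
  shows "(\<Sum>k\<in>I. M i k * R k j) \<le> 2 * \<kappa> * R i j"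
proof -
  have "(\<Sum>k\<in>I. M i k * R k j) = 2 * \<kappa> * resolvent_step (\<lambda>k. R k j) i"
    using \<kappa>_pos by (simp add: resolvent_step_def)
  also have "\<dots> \<le> 2 * \<kappa> * R i j"
    using \<kappa>_pos R_eq[OF assms, of j] by (intro mult_left_mono) auto
  finally show ?thesis .
qed

text \<open>
  If \<open>z = R a\<close> then \<open>z = a + M z / (2 \<kappa>)\<close>, and by Cauchy--Schwarz the last term has at most half the
  Euclidean norm of \<open>z\<close>.
\<close>
lemma R_norm: "(\<Sum>i\<in>I. (\<Sum>j\<in>I. R i j * a j)\<^sup>2) \<le> 4 * (\<Sum>j\<in>I. (a j)\<^sup>2)"
proof -
  define z where "z = (\<lambda>i. \<Sum>j\<in>I. R i j * a j)"
  have zeq: "z i = a i + resolvent_step z i" if i: "i \<in> I" for i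
  proof -
    have "z i = (\<Sum>j\<in>I. (if i = j then a j else 0) + resolvent_step (\<lambda>k. R k j) i * a j)"
      unfolding z_def by (intro sum.cong refl) (subst R_eq[OF i], simp add: algebra_simps)
    also have "\<dots> = a i + (\<Sum>j\<in>I. resolvent_step (\<lambda>k. R k j) i * a j)"
      using i by (simp add: sum.distrib)
    also have "(\<Sum>j\<in>I. resolvent_step (\<lambda>k. R k j) i * a j) = (\<Sum>j\<in>I. \<Sum>k\<in>I. M i k * (R k j * a j) / (2 * \<kappa>))"
      by (simp add: resolvent_step_def sum_divide_distrib sum_distrib_right mult.assoc)
    also have "\<dots> = (\<Sum>k\<in>I. \<Sum>j\<in>I. M i k * (R k j * a j) / (2 * \<kappa>))" by (rule sum.swap)
    also have "\<dots> = resolvent_step z i"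
      unfolding resolvent_step_def z_def sum_distrib_left sum_divide_distrib ..
    finally show ?thesis .
  qed
  have half: "L2_set (resolvent_step z) I \<le> 1 / 2 * L2_set z I"
  proof -
    have "(\<Sum>k\<in>I. M i k * z k)\<^sup>2 \<le> \<kappa> * (\<Sum>k\<in>I. M i k * (z k)\<^sup>2)" if i: "i \<in> I" for i
    proof -
      have "(\<Sum>k\<in>I. M i k * z k) = (\<Sum>k\<in>I. sqrt (M i k) * (sqrt (M i k) * z k))"
        using M_nonneg by (simp add: mult.assoc[symmetric])
      then have "(\<Sum>k\<in>I. M i k * z k)\<^sup>2 \<le> (\<Sum>k\<in>I. (sqrt (M i k))\<^sup>2) * (\<Sum>k\<in>I. (sqrt (M i k) * z k)\<^sup>2)"
        by (simp only: Cauchy_Schwarz_ineq_sum)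
      also have "\<dots> = (\<Sum>k\<in>I. M i k) * (\<Sum>k\<in>I. M i k * (z k)\<^sup>2)"
        using M_nonneg by (simp add: power_mult_distrib)
      also have "\<dots> \<le> \<kappa> * (\<Sum>k\<in>I. M i k * (z k)\<^sup>2)"
        by (intro mult_right_mono M_row i sum_nonneg mult_nonneg_nonneg M_nonneg) auto
      finally show ?thesis .
    qed
    then have "(\<Sum>i\<in>I. (\<Sum>k\<in>I. M i k * z k)\<^sup>2) \<le> (\<Sum>i\<in>I. \<kappa> * (\<Sum>k\<in>I. M i k * (z k)\<^sup>2))"
      by (rule sum_mono)
    also have "\<dots> = \<kappa> * (\<Sum>k\<in>I. (\<Sum>i\<in>I. M k i) * (z k)\<^sup>2)"
    proof -
      have "(\<Sum>i\<in>I. \<Sum>k\<in>I. M i k * (z k)\<^sup>2) = (\<Sum>k\<in>I. \<Sum>i\<in>I. M i k * (z k)\<^sup>2)" by (rule sum.swap)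
      also have "\<dots> = (\<Sum>k\<in>I. (\<Sum>i\<in>I. M k i) * (z k)\<^sup>2)"
        unfolding sum_distrib_right by (intro sum.cong refl arg_cong2[where f = "(*)"] M_sym)
      finally show ?thesis by (simp add: sum_distrib_left[symmetric])
    qed
    also have "\<dots> \<le> \<kappa> * (\<Sum>k\<in>I. \<kappa> * (z k)\<^sup>2)"
      using \<kappa>_pos by (intro mult_left_mono sum_mono mult_right_mono M_row) auto
    also have "\<dots> = (\<kappa> * L2_set z I)\<^sup>2"
      by (simp add: L2_set_def sum_nonneg power_mult_distrib sum_distrib_left[symmetric] power2_eq_square[of \<kappa>])
    finally have "L2_set (\<lambda>i. \<Sum>k\<in>I. M i k * z k) I \<le> \<kappa> * L2_set z I"
      unfolding L2_set_def[of "\<lambda>i. \<Sum>k\<in>I. M i k * z k"]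
      using \<kappa>_pos L2_set_nonneg[of z I] by (intro real_le_lsqrt) auto
    moreover have "L2_set (resolvent_step z) I = 1 / (2 * \<kappa>) * L2_set (\<lambda>i. \<Sum>k\<in>I. M i k * z k) I"
    proof -
      have r: "resolvent_step z = (\<lambda>i. 1 / (2 * \<kappa>) * (\<Sum>k\<in>I. M i k * z k))"
        by (simp add: fun_eq_iff resolvent_step_def)
      show ?thesis unfolding r by (rule L2_set_right_distrib[symmetric]) (use \<kappa>_pos in simp)
    qed
    ultimately have "L2_set (resolvent_step z) I \<le> 1 / (2 * \<kappa>) * (\<kappa> * L2_set z I)"
      using \<kappa>_pos by (simp only:) (intro mult_left_mono, auto)
    then show ?thesis using \<kappa>_pos by simp
  qed
  have "L2_set z I = L2_set (\<lambda>i. a i + resolvent_step z i) I"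
    by (rule L2_set_cong) (auto simp: zeq)
  also have "\<dots> \<le> L2_set a I + L2_set (resolvent_step z) I" by (rule L2_set_triangle_ineq)
  finally have "L2_set z I \<le> 2 * L2_set a I" using half by simp
  then have "(L2_set z I)\<^sup>2 \<le> (2 * L2_set a I)\<^sup>2" by (intro power_mono L2_set_nonneg)
  then show ?thesis by (simp add: L2_set_def sum_nonneg power_mult_distrib z_def)
qed

end

section \<open>Comparison of gradients along the semigroup\<close>

context ising_model begin

text \<open>
  The right side \<open>W\<^sub>i\<close> satisfies \<open>W' = L W + 3 \<kappa> W\<close>, and \<open>3 \<kappa> W\<^sub>i \<ge> \<kappa> W\<^sub>i + (M W)\<^sub>i\<close> dominates the zeroth-order
  terms in the equation for the gradients. The minimum principle is applied to the functions
  \<open>W\<^sub>i \<plusminus> \<delta>\<^sub>i P\<^sub>t f\<close>, indexed by sign, site and configuration: if their common minimum is \<open>- m\<close>, then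
  \<open>\<bar>\<delta>\<^sub>j P\<^sub>t f\<bar> \<le> W\<^sub>j + m\<close> for all \<open>j\<close> at the configuration where it is attained.
\<close>
lemma gradient_comparison:
  assumes x: "x \<in> \<Omega>" and i: "i \<in> I" and t: "0 \<le> t"
  shows "\<bar>\<delta> i (P t f) x\<bar> \<le> exp (3 * \<kappa> * t) * (\<Sum>j\<in>I. R i j * P t (\<lambda>y. \<bar>\<delta> j f y\<bar>) x)"
proof -
  define h where "h = (\<lambda>j y. \<bar>\<delta> j f y\<bar>)"
  define V where "V = (\<lambda>i t x. \<Sum>j\<in>I. R i j * P t (h j) x)"
  define W where "W = (\<lambda>i t x. exp (3 * \<kappa> * t) * V i t x)"
  define drift where "drift = (\<lambda>i t x. \<Sum>j\<in>I - {i}. (coupling i j x - 1) * (q i x * \<delta> j (P t f) x - q j x * \<delta> i (P t f) x))"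
  define y where "y = (\<lambda>(\<sigma>, i, x) t. W i t x - \<sigma> * \<delta> i (P t f) x)"
  define y' where "y' = (\<lambda>(\<sigma>, i, x) t. 3 * \<kappa> * W i t x + L (W i t) x - \<sigma> * (L (\<delta> i (P t f)) x + drift i t x))"
  let ?A = "{- 1, 1 :: real} \<times> I \<times> \<Omega>"
  have W0: "0 \<le> W i t x" if "i \<in> I" "x \<in> \<Omega>" "0 \<le> t" for i t x
    unfolding W_def V_def using that
    by (intro mult_nonneg_nonneg sum_nonneg R_nonneg P_nonneg) (auto simp: h_def)
  have LV: "L (V i t) x = (\<Sum>j\<in>I. R i j * L (P t (h j)) x)" for i t x
  proof -
    have "L (V i t) x = (\<Sum>k\<in>I. \<Sum>j\<in>I. q k x * (R i j * (P t (h j) (flip k x) - P t (h j) x)))"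
      unfolding generator_def V_def sum_subtractf[symmetric] right_diff_distrib[symmetric] sum_distrib_left ..
    also have "\<dots> = (\<Sum>j\<in>I. \<Sum>k\<in>I. q k x * (R i j * (P t (h j) (flip k x) - P t (h j) x)))" by (rule sum.swap)
    finally show ?thesis by (simp add: generator_def sum_distrib_left mult.left_commute)
  qed
  have LW: "L (W i t) x = exp (3 * \<kappa> * t) * L (V i t) x" for i t x
    using generator_linear[of "exp (3 * \<kappa> * t)" "V i t" 0 "V i t" x] by (simp add: W_def)
  have Wder: "((\<lambda>t. W i t x) has_real_derivative 3 * \<kappa> * W i t x + L (W i t) x) (at t)" if "x \<in> \<Omega>" for i t x
  proof -
    have 1: "((\<lambda>t. V i t x) has_real_derivative L (V i t) x) (at t)"
      unfolding LV unfolding V_def by (intro DERIV_sum DERIV_cmult P_deriv that)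
    have 2: "((\<lambda>t. exp (3 * \<kappa> * t)) has_real_derivative 3 * \<kappa> * exp (3 * \<kappa> * t)) (at t)"
      by (auto intro!: derivative_eq_intros)
    show ?thesis
      using DERIV_mult[OF 2 1] unfolding LW unfolding W_def by (simp add: mult_ac)
  qed
  have yder: "(y a has_real_derivative y' a t) (at t)" if "a \<in> ?A" for a t
  proof -
    obtain \<sigma> i x where a: "a = (\<sigma>, i, x)" "i \<in> I" "x \<in> \<Omega>" using \<open>a \<in> ?A\<close> by auto
    have "((\<lambda>t. W i t x - \<sigma> * \<delta> i (P t f) x) has_real_derivative
        (3 * \<kappa> * W i t x + L (W i t) x) - \<sigma> * \<delta> i (L (P t f)) x) (at t)"
      by (intro DERIV_diff DERIV_cmult Wder \<delta>_P_deriv a)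
    then show ?thesis
      by (simp add: y_def y'_def a(1) \<delta>_generator[OF a(3,2)] drift_def)
  qed
  have main: "0 \<le> y a t" if a: "a \<in> ?A" for a
  proof (rule touching_minimum_principle[where A = ?A and T = t and y = y and a = a and t = t and y' = y' and \<kappa> = "2 * \<kappa>"])
    show "finite ?A" by simp
    show "continuous_on {0..t} (y a)" if "a \<in> ?A" for a
      by (intro continuous_at_imp_continuous_on ballI DERIV_isCont[OF yder[OF that]])
    show "0 \<le> y a 0" if "a \<in> ?A" for a
    proof -
      obtain \<sigma> i x where a: "a = (\<sigma>, i, x)" "i \<in> I" "x \<in> \<Omega>" "\<sigma> = - 1 \<or> \<sigma> = 1" using \<open>a \<in> ?A\<close> by auto
      have P0: "P 0 g = g" for g by (rule ext) (rule P_zero)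
      have 1: "1 \<le> R i i"
        using R_eq[OF a(2), of i] resolvent_step_bound[OF _ a(2), of "\<lambda>k. R k i" "Max ((\<lambda>k. R k i) ` I)"]
        R_nonneg by auto
      have "1 * h i x \<le> R i i * h i x" by (intro mult_right_mono 1) (simp add: h_def)
      also have "\<dots> \<le> (\<Sum>j\<in>I. R i j * h j x)"
        using a R_nonneg[OF a(2)] by (intro member_le_sum[of i I "\<lambda>j. R i j * h j x"]) (auto simp: h_def)
      finally have "\<bar>\<delta> i f x\<bar> \<le> W i 0 x" by (simp add: W_def V_def P0 h_def)
      then show ?thesis using a(4) by (auto simp: y_def a(1) P0)
    qed
    show "(y a has_real_derivative y' a s) (at s)" if "a \<in> ?A" for a s by (rule yder[OF that])
    fix a s assume a: "a \<in> ?A" and s: "0 < s" "s \<le> t" and neg: "y a s < 0"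
      and min: "\<And>b. b \<in> ?A \<Longrightarrow> y a s \<le> y b s"
    obtain \<sigma> i x where ai: "a = (\<sigma>, i, x)" "i \<in> I" "x \<in> \<Omega>" "\<sigma> = - 1 \<or> \<sigma> = 1" using a by auto
    define m where "m = - y a s"
    have m: "0 < m" using neg by (simp add: m_def)
    let ?u = "P s f"
    have bd: "\<bar>\<delta> j ?u x\<bar> \<le> W j s x + m" if "j \<in> I" for j
      using min[of "(1, j, x)"] min[of "(-1, j, x)"] that ai(3) by (auto simp: y_def m_def)
    have Ly: "0 \<le> L (\<lambda>x. 1 * W i s x + (- \<sigma>) * \<delta> i ?u x) x"
    proof (rule L_at_min[OF ai(3)])
      fix z assume "z \<in> \<Omega>"
      then show "1 * W i s x + - \<sigma> * \<delta> i ?u x \<le> 1 * W i s z + - \<sigma> * \<delta> i ?u z"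
        using min[of "(\<sigma>, i, z)"] ai by (auto simp: y_def)
    qed
    have "\<sigma> * drift i s x \<le> \<bar>drift i s x\<bar>" using ai(4) by auto
    also have "\<dots> \<le> (\<Sum>j\<in>I - {i}. \<bar>(coupling i j x - 1) * (q i x * \<delta> j ?u x - q j x * \<delta> i ?u x)\<bar>)"
      unfolding drift_def by (rule sum_abs)
    also have "\<dots> \<le> (\<Sum>j\<in>I - {i}. M i j * (W j s x + m) + M i j * (W i s x + m))"
    proof (rule sum_mono)
      fix j assume "j \<in> I - {i}"
      then have j: "j \<in> I" by auto
      define r where "r = coupling i j x - 1"
      have b: "\<bar>r\<bar> * q i x \<le> M i j" "\<bar>r\<bar> * q j x \<le> M i j"
        unfolding r_def using coupling_bound[OF ai(3,2) j] ai(2) j by auto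
      have "\<bar>r * (q i x * \<delta> j ?u x - q j x * \<delta> i ?u x)\<bar> \<le> \<bar>r * q i x * \<delta> j ?u x\<bar> + \<bar>r * q j x * \<delta> i ?u x\<bar>"
        by (simp add: right_diff_distrib mult.assoc[symmetric] abs_triangle_ineq4)
      also have "\<dots> = (\<bar>r\<bar> * q i x) * \<bar>\<delta> j ?u x\<bar> + (\<bar>r\<bar> * q j x) * \<bar>\<delta> i ?u x\<bar>"
        using q_bounds(3)[OF ai(3,2)] q_bounds(3)[OF ai(3) j] by (simp add: abs_mult)
      also have "\<dots> \<le> M i j * (W j s x + m) + M i j * (W i s x + m)"
        by (intro add_mono mult_mono b bd j ai(2) M_nonneg) auto
      finally show "\<bar>(coupling i j x - 1) * (q i x * \<delta> j ?u x - q j x * \<delta> i ?u x)\<bar>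
          \<le> M i j * (W j s x + m) + M i j * (W i s x + m)" by (simp only: r_def)
    qed
    also have "\<dots> \<le> (\<Sum>j\<in>I. M i j * (W j s x + m) + M i j * (W i s x + m))"
      using W0[OF _ ai(3)] s m M_nonneg W0[OF ai(2,3)]
      by (intro sum_mono2) (auto intro!: add_nonneg_nonneg mult_nonneg_nonneg)
    also have "\<dots> = (\<Sum>j\<in>I. M i j * W j s x) + (\<Sum>j\<in>I. M i j) * (W i s x + 2 * m)"
      unfolding sum_distrib_right sum.distrib[symmetric]
      by (intro sum.cong refl) (simp add: algebra_simps)
    also have "\<dots> \<le> 2 * \<kappa> * W i s x + \<kappa> * (W i s x + 2 * m)"
    proof (rule add_mono)
      have "(\<Sum>j\<in>I. M i j * W j s x) = exp (3 * \<kappa> * s) * (\<Sum>j\<in>I. \<Sum>k\<in>I. M i j * R j k * P s (h k) x)"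
        by (simp add: W_def V_def sum_distrib_left mult_ac)
      also have "(\<Sum>j\<in>I. \<Sum>k\<in>I. M i j * R j k * P s (h k) x) = (\<Sum>k\<in>I. (\<Sum>j\<in>I. M i j * R j k) * P s (h k) x)"
        unfolding sum_distrib_right by (rule sum.swap)
      also have "exp (3 * \<kappa> * s) * \<dots> \<le> exp (3 * \<kappa> * s) * (\<Sum>k\<in>I. 2 * \<kappa> * R i k * P s (h k) x)"
        using s by (intro mult_left_mono sum_mono mult_right_mono M_R_le ai P_nonneg) (auto simp: h_def)
      also have "\<dots> = 2 * \<kappa> * W i s x"
        by (simp add: W_def V_def sum_distrib_left mult_ac)
      finally show "(\<Sum>j\<in>I. M i j * W j s x) \<le> 2 * \<kappa> * W i s x" .
      show "(\<Sum>j\<in>I. M i j) * (W i s x + 2 * m) \<le> \<kappa> * (W i s x + 2 * m)"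
        using W0[OF ai(2,3)] s m by (intro mult_right_mono M_row ai) auto
    qed
    finally have dr: "\<sigma> * drift i s x \<le> 3 * \<kappa> * W i s x + 2 * \<kappa> * m" by (simp add: algebra_simps)
    have "y' a s = L (\<lambda>x. 1 * W i s x + (- \<sigma>) * \<delta> i ?u x) x + 3 * \<kappa> * W i s x - \<sigma> * drift i s x"
      unfolding generator_linear by (simp add: y'_def ai(1) algebra_simps)
    then have "- (2 * \<kappa> * m) \<le> y' a s" using Ly dr by linarith
    then show "2 * \<kappa> * y a s \<le> y' a s" by (simp add: m_def)
  qed (use that t in auto)
  have "0 \<le> y (1, i, x) t" "0 \<le> y (- 1, i, x) t" using main x i by auto
  then show ?thesis by (auto simp: y_def W_def V_def h_def abs_le_iff)
qed

definition nrm :: "((nat \<Rightarrow> real) \<Rightarrow> real) \<Rightarrow> real" where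
  "nrm f = sqrt (E (\<lambda>x. (f x)\<^sup>2))"

lemma nrm_sq: "(nrm f)\<^sup>2 = E (\<lambda>x. (f x)\<^sup>2)"
  unfolding nrm_def by (rule real_sqrt_pow2) (rule E_nonneg, simp)

lemma nrm_nonneg: "0 \<le> nrm f"
  unfolding nrm_def by (intro real_sqrt_ge_zero E_nonneg) simp

lemma nrm_mono: "(\<And>x. x \<in> \<Omega> \<Longrightarrow> \<bar>f x\<bar> \<le> g x) \<Longrightarrow> nrm f \<le> nrm g"
  unfolding nrm_def by (intro real_sqrt_le_mono E_mono) (metis abs_ge_zero power2_abs power_mono)

lemma nrm_cmult: "0 \<le> c \<Longrightarrow> nrm (\<lambda>x. c * f x) = c * nrm f"
  by (simp add: nrm_def power_mult_distrib E_cmult real_sqrt_mult)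

lemma nrm_triangle: "nrm (\<lambda>x. f x + g x) \<le> nrm f + nrm g"
proof (rule power2_le_imp_le)
  have "(E (\<lambda>x. f x * g x))\<^sup>2 \<le> (nrm f * nrm g)\<^sup>2"
    unfolding power_mult_distrib nrm_sq by (rule E_cauchy_schwarz)
  then have "E (\<lambda>x. f x * g x) \<le> nrm f * nrm g"
    using nrm_nonneg[of f] nrm_nonneg[of g] by (meson mult_nonneg_nonneg power2_le_imp_le)
  moreover have "(nrm (\<lambda>x. f x + g x))\<^sup>2 = E (\<lambda>x. 1 * (f x)\<^sup>2 + 1 * (2 * (f x * g x) + 1 * (g x)\<^sup>2))"
    unfolding nrm_sq by (rule E_cong) (simp add: power2_eq_square algebra_simps)
  moreover have "\<dots> = (nrm f)\<^sup>2 + (2 * E (\<lambda>x. f x * g x) + (nrm g)\<^sup>2)"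
    unfolding E_linear nrm_sq by simp
  ultimately show "(nrm (\<lambda>x. f x + g x))\<^sup>2 \<le> (nrm f + nrm g)\<^sup>2"
    by (simp add: power2_sum)
qed (simp add: nrm_nonneg)

lemma nrm_sum:
  assumes "finite A" "\<And>j. j \<in> A \<Longrightarrow> 0 \<le> c j"
  shows "nrm (\<lambda>x. \<Sum>j\<in>A. c j * g j x) \<le> (\<Sum>j\<in>A. c j * nrm (g j))"
  using assms
proof (induction A rule: finite_induct)
  case empty
  then show ?case by (simp add: nrm_def E_const)
next
  case (insert a A)
  have "nrm (\<lambda>x. \<Sum>j\<in>insert a A. c j * g j x) \<le> nrm (\<lambda>x. c a * g a x) + nrm (\<lambda>x. \<Sum>j\<in>A. c j * g j x)"
    using insert.hyps nrm_triangle[of "\<lambda>x. c a * g a x" "\<lambda>x. \<Sum>j\<in>A. c j * g j x"] by simp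
  then show ?case using insert.IH insert.hyps insert.prems nrm_cmult[of "c a" "g a"] by simp
qed

lemma gradient_L2:
  assumes t: "0 \<le> t"
  shows "E (\<Gamma> (P t f)) \<le> 4 * exp (6 * \<kappa> * t) * (\<Sum>j\<in>I. energy (\<lambda>y. \<bar>\<delta> j f y\<bar>) t)"
proof -
  define a where "a = (\<lambda>j. nrm (P t (\<lambda>y. \<bar>\<delta> j f y\<bar>)))"
  have 1: "E (\<lambda>x. (\<delta> i (P t f) x)\<^sup>2) \<le> exp (6 * \<kappa> * t) * (\<Sum>j\<in>I. R i j * a j)\<^sup>2" if i: "i \<in> I" for i
  proof -
    have "nrm (\<delta> i (P t f)) \<le> nrm (\<lambda>x. exp (3 * \<kappa> * t) * (\<Sum>j\<in>I. R i j * P t (\<lambda>y. \<bar>\<delta> j f y\<bar>) x))"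
      by (intro nrm_mono gradient_comparison i t)
    also have "\<dots> = exp (3 * \<kappa> * t) * nrm (\<lambda>x. \<Sum>j\<in>I. R i j * P t (\<lambda>y. \<bar>\<delta> j f y\<bar>) x)"
      by (rule nrm_cmult) simp
    also have "\<dots> \<le> exp (3 * \<kappa> * t) * (\<Sum>j\<in>I. R i j * a j)"
      unfolding a_def by (intro mult_left_mono nrm_sum R_nonneg i) auto
    finally have "(nrm (\<delta> i (P t f)))\<^sup>2 \<le> (exp (3 * \<kappa> * t) * (\<Sum>j\<in>I. R i j * a j))\<^sup>2"
      by (intro power_mono nrm_nonneg)
    also have "\<dots> = exp (6 * \<kappa> * t) * (\<Sum>j\<in>I. R i j * a j)\<^sup>2"
      unfolding power_mult_distrib exp_double[symmetric] by (simp add: mult.assoc)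
    finally show ?thesis unfolding nrm_sq .
  qed
  have "E (\<Gamma> (P t f)) \<le> (\<Sum>i\<in>I. exp (6 * \<kappa> * t) * (\<Sum>j\<in>I. R i j * a j)\<^sup>2)"
    unfolding E_\<Gamma> by (intro sum_mono 1)
  also have "\<dots> = exp (6 * \<kappa> * t) * (\<Sum>i\<in>I. (\<Sum>j\<in>I. R i j * a j)\<^sup>2)" by (simp add: sum_distrib_left)
  also have "\<dots> \<le> exp (6 * \<kappa> * t) * (4 * (\<Sum>j\<in>I. (a j)\<^sup>2))"
    by (intro mult_left_mono R_norm) simp
  finally show ?thesis by (simp add: a_def nrm_sq energy_def mult_ac)
qed

lemma gradient_L1:
  assumes t: "0 \<le> t"
  shows "(\<Sum>i\<in>I. (E (\<lambda>x. \<bar>\<delta> i (P t f) x\<bar>))\<^sup>2) \<le> 4 * exp (6 * \<kappa> * t) * (\<Sum>j\<in>I. (E (\<lambda>x. \<bar>\<delta> j f x\<bar>))\<^sup>2)"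
proof -
  define a where "a = (\<lambda>j. E (\<lambda>y. \<bar>\<delta> j f y\<bar>))"
  have 1: "(E (\<lambda>x. \<bar>\<delta> i (P t f) x\<bar>))\<^sup>2 \<le> exp (6 * \<kappa> * t) * (\<Sum>j\<in>I. R i j * a j)\<^sup>2" if i: "i \<in> I" for i
  proof -
    have "E (\<lambda>x. \<bar>\<delta> i (P t f) x\<bar>) \<le> E (\<lambda>x. exp (3 * \<kappa> * t) * (\<Sum>j\<in>I. R i j * P t (\<lambda>y. \<bar>\<delta> j f y\<bar>) x))"
      by (intro E_mono gradient_comparison i t)
    also have "\<dots> = exp (3 * \<kappa> * t) * (\<Sum>j\<in>I. R i j * a j)"
      by (simp add: E_cmult E_sum E_P a_def)
    finally have "(E (\<lambda>x. \<bar>\<delta> i (P t f) x\<bar>))\<^sup>2 \<le> (exp (3 * \<kappa> * t) * (\<Sum>j\<in>I. R i j * a j))\<^sup>2"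
      by (intro power_mono E_nonneg) auto
    also have "\<dots> = exp (6 * \<kappa> * t) * (\<Sum>j\<in>I. R i j * a j)\<^sup>2"
      unfolding power_mult_distrib exp_double[symmetric] by (simp add: mult.assoc)
    finally show ?thesis .
  qed
  have "(\<Sum>i\<in>I. (E (\<lambda>x. \<bar>\<delta> i (P t f) x\<bar>))\<^sup>2) \<le> (\<Sum>i\<in>I. exp (6 * \<kappa> * t) * (\<Sum>j\<in>I. R i j * a j)\<^sup>2)"
    by (intro sum_mono 1)
  also have "\<dots> = exp (6 * \<kappa> * t) * (\<Sum>i\<in>I. (\<Sum>j\<in>I. R i j * a j)\<^sup>2)" by (simp add: sum_distrib_left)
  also have "\<dots> \<le> exp (6 * \<kappa> * t) * (4 * (\<Sum>j\<in>I. (a j)\<^sup>2))"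
    by (intro mult_left_mono R_norm) simp
  finally show ?thesis by (simp add: a_def mult_ac)
qed

section \<open>Decay of second moments\<close>

text \<open>
  The entropy of a squared density controls the logarithm of the ratio of its second moment to its squared
  mean; this is Jensen's inequality for \<open>ln\<close> under the measure with density \<open>h\<^sup>2 / N\<close>.
\<close>
lemma entropy_lower_bound:
  assumes h: "\<And>x. x \<in> \<Omega> \<Longrightarrow> 0 \<le> h x" and l: "0 < E h"
  defines "N \<equiv> E (\<lambda>x. (h x)\<^sup>2)"
  shows "N * ln (N / (E h)\<^sup>2) \<le> E (\<lambda>x. (h x)\<^sup>2 * ln ((h x)\<^sup>2)) - N * ln N"
proof -
  have N: "0 < N" using E_jensen_square[of h] zero_less_power[OF l, of 2] unfolding N_def by linarith
  let ?l = "E h"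
  \<comment> \<open>The tangent bound \<open>ln z \<ge> 1 - 1 / z\<close> at \<open>z = h l / N\<close>.\<close>
  have pt: "2 * ((ln N - ln ?l) * (h x)\<^sup>2) + 2 * (1 * (h x)\<^sup>2 + (- (N / ?l)) * h x) \<le> (h x)\<^sup>2 * ln ((h x)\<^sup>2)" if x: "x \<in> \<Omega>" for x
  proof (cases "h x = 0")
    case False
    then have hx: "0 < h x" using h[OF x] by simp
    have "ln (N / (h x * ?l)) \<le> N / (h x * ?l) - 1"
      using N hx l by (intro ln_le_minus_one) simp
    then have a: "ln N - ln ?l + 1 - N / (h x * ?l) \<le> ln (h x)"
      using N hx l by (simp add: ln_div ln_mult)
    have "(h x)\<^sup>2 * (ln N - ln ?l + 1 - N / (h x * ?l)) \<le> (h x)\<^sup>2 * ln (h x)"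
      by (intro mult_left_mono a) simp
    moreover have "(h x)\<^sup>2 * (N / (h x * ?l)) = N / ?l * h x"
      using hx l by (simp add: power2_eq_square)
    moreover have "(h x)\<^sup>2 * ln ((h x)\<^sup>2) = 2 * ((h x)\<^sup>2 * ln (h x))"
      using hx by (simp add: ln_realpow)
    moreover have "2 * (X * a) + 2 * (1 * a + (- U) * b) \<le> c"
      if "a * (X + 1 - T) \<le> a * Y" "a * T = U * b" "c = 2 * (a * Y)" for a b c X T U Y :: real
      using that by (simp add: algebra_simps)
    ultimately show ?thesis by blast
  qed simp
  have "E (\<lambda>x. 2 * ((ln N - ln ?l) * (h x)\<^sup>2) + 2 * (1 * (h x)\<^sup>2 + (- (N / ?l)) * h x)) \<le> E (\<lambda>x. (h x)\<^sup>2 * ln ((h x)\<^sup>2))"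
    by (rule E_mono) (rule pt)
  moreover have "E (\<lambda>x. 2 * ((ln N - ln ?l) * (h x)\<^sup>2) + 2 * (1 * (h x)\<^sup>2 + (- (N / ?l)) * h x)) = 2 * ((ln N - ln ?l) * N)"
    unfolding E_linear E_cmult N_def[symmetric] using l by simp
  ultimately have "2 * ((ln N - ln ?l) * N) \<le> E (\<lambda>x. (h x)\<^sup>2 * ln ((h x)\<^sup>2))" by simp
  moreover have "N * ln (N / ?l\<^sup>2) = 2 * ((ln N - ln ?l) * N) - N * ln N"
    using N l by (simp add: ln_div ln_realpow algebra_simps)
  ultimately show ?thesis by simp
qed

end

lemma exp_convex_01:
  fixes a :: real
  assumes "0 \<le> t" "t \<le> 1"
  shows "exp (t * a) \<le> 1 - t + t * exp a"
proof -
  have "convex_on UNIV (exp :: real \<Rightarrow> real)" by (rule exp_convex)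
  from convex_onD[OF this assms, of 0 a] show ?thesis by simp
qed

context subcritical_ising begin

text \<open>
  A common constant for the Poincare and the log-Sobolev inequality.
\<close>
definition \<Lambda> :: real where "\<Lambda> = 8 * exp (5 * C) / (1 - s)\<^sup>2"
definition gap :: real where "gap = 1 - exp (- 2 / \<Lambda>)"

lemma \<Lambda>_ge: "1 \<le> \<Lambda>"
proof -
  have "(1 - s)\<^sup>2 \<le> 1" using s0 s1 by (simp add: power_le_one)
  moreover have "1 \<le> exp (5 * C)" using Cpos by simp
  ultimately have "(1 - s)\<^sup>2 \<le> 8 * exp (5 * C)" by linarith
  then show ?thesis using s1 by (simp add: \<Lambda>_def)
qed

lemma \<Lambda>_pos: "0 < \<Lambda>"
  using \<Lambda>_ge by simp

lemma gap_bounds: "0 < gap" "gap \<le> 1"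
  using \<Lambda>_ge by (auto simp: gap_def)

lemma sum_local_var: "(\<Sum>i\<in>I. E (local_var i f)) \<le> exp (3 * C) * Dir f f"
proof -
  have "(\<Sum>i\<in>I. E (local_var i f)) \<le> (\<Sum>i\<in>I. exp (2 * C) * E (\<lambda>x. (\<delta> i f x)\<^sup>2))"
  proof (rule sum_mono)
    fix i assume i: "i \<in> I"
    show "E (local_var i f) \<le> exp (2 * C) * E (\<lambda>x. (\<delta> i f x)\<^sup>2)"
      unfolding E_cmult[symmetric]
    proof (rule E_mono)
      fix x assume x: "x \<in> \<Omega>"
      have "1 * 1 \<le> (2 * exp C * q i x) * (2 * exp C * q i x)"
        by (intro mult_mono q_lower x i) (use q_bounds(3)[OF x i] in auto)
      also have "\<dots> = 4 * (exp (2 * C) * (q i x)\<^sup>2)"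
        unfolding exp_double by (simp add: power2_eq_square)
      finally have "site_var i x \<le> exp (2 * C) * (q i x)\<^sup>2" using site_var_le[of i x] by simp
      then have "site_var i x * (f x - f (flip i x))\<^sup>2 \<le> exp (2 * C) * (q i x)\<^sup>2 * (f x - f (flip i x))\<^sup>2"
        by (rule mult_right_mono) simp
      then show "local_var i f x \<le> exp (2 * C) * (\<delta> i f x)\<^sup>2"
        by (simp add: local_var_def delta_star_def power_mult_distrib power2_commute[of "f x"] mult.assoc)
    qed
  qed
  also have "\<dots> = exp (2 * C) * E (\<Gamma> f)" by (simp add: E_\<Gamma> sum_distrib_left)
  also have "\<dots> \<le> exp (2 * C) * (exp C * Dir f f)" by (intro mult_left_mono E_\<Gamma>_le_Dir) simp
  also have "\<dots> = exp (3 * C) * Dir f f" using exp_add[of "2 * C" C] by simp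
  finally show ?thesis .
qed

lemma log_sobolev:
  "E (\<lambda>x. (f x)\<^sup>2 * ln ((f x)\<^sup>2)) - E (\<lambda>x. (f x)\<^sup>2) * ln (E (\<lambda>x. (f x)\<^sup>2)) \<le> \<Lambda> * Dir f f"
proof -
  obtain x where x: "x \<in> \<Omega>" using cube_nonempty by blast
  have "ent (\<lambda>z. z * ln z) I (\<lambda>y. (f y)\<^sup>2) x \<le> 8 * exp (2 * C) / (1 - s)\<^sup>2 * (\<Sum>i\<in>I. E (local_var i f))"
    using log_sobolev_conditional[OF subset_refl x, of f] by (simp only: E_cex[of _ x])
  also have "\<dots> \<le> 8 * exp (2 * C) / (1 - s)\<^sup>2 * (exp (3 * C) * Dir f f)"
    by (intro mult_left_mono sum_local_var) simp
  also have "\<dots> = \<Lambda> * Dir f f"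
    using exp_add[of "2 * C" "3 * C"] by (simp add: \<Lambda>_def)
  finally show ?thesis by (simp only: ent_def E_cex[of _ x])
qed

lemma poincare: "Var f \<le> \<Lambda> * Dir f f"
proof -
  obtain x where x: "x \<in> \<Omega>" using cube_nonempty by blast
  have "ent (\<lambda>z. z\<^sup>2) I f x \<le> exp (2 * C) / (1 - s)\<^sup>2 * (\<Sum>i\<in>I. E (local_var i f))"
    using poincare_conditional[OF subset_refl x, of f] by (simp only: E_cex[of _ x])
  also have "\<dots> \<le> exp (2 * C) / (1 - s)\<^sup>2 * (exp (3 * C) * Dir f f)"
    by (intro mult_left_mono sum_local_var) simp
  also have "\<dots> = \<Lambda> / 8 * Dir f f"
    using exp_add[of "2 * C" "3 * C"] by (simp add: \<Lambda>_def)
  also have "\<dots> \<le> \<Lambda> * Dir f f"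
    using \<Lambda>_ge by (intro mult_right_mono Dir_nonneg) auto
  finally show ?thesis by (simp only: ent_def Var_def E_cex[of _ x])
qed

lemma variance_decay: "Var (P 1 f) \<le> exp (- 2 / \<Lambda>) * Var f"
proof -
  define h where "h = (\<lambda>t. exp (2 / \<Lambda> * t) * (energy f t - (E f)\<^sup>2))"
  have "h 1 \<le> h 0"
  proof (rule DERIV_nonpos_imp_nonincreasing[of 0 1 h])
    fix t
    have "(h has_real_derivative (2 / \<Lambda>) * exp (2 / \<Lambda> * t) * (energy f t - (E f)\<^sup>2) +
        exp (2 / \<Lambda> * t) * (- 2 * Dir (P t f) (P t f))) (at t)"
      unfolding h_def using \<Lambda>_pos by (auto intro!: derivative_eq_intros energy_deriv)
    moreover have "(2 / \<Lambda>) * exp (2 / \<Lambda> * t) * (energy f t - (E f)\<^sup>2) +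
        exp (2 / \<Lambda> * t) * (- 2 * Dir (P t f) (P t f)) \<le> 0"
    proof -
      have "(energy f t - (E f)\<^sup>2) / \<Lambda> \<le> Dir (P t f) (P t f)"
        using poincare[of "P t f"] \<Lambda>_ge by (simp add: Var_P divide_le_eq mult.commute)
      then have "2 * exp (2 / \<Lambda> * t) * ((energy f t - (E f)\<^sup>2) / \<Lambda>) \<le> 2 * exp (2 / \<Lambda> * t) * Dir (P t f) (P t f)"
        by (rule mult_left_mono) simp
      then show ?thesis by simp
    qed
    ultimately show "\<exists>d. (h has_real_derivative d) (at t) \<and> d \<le> 0" by blast
  qed simp
  then have "exp (2 / \<Lambda>) * Var (P 1 f) \<le> Var f"
    unfolding Var_P Var_def[of f] by (simp add: h_def energy_zero)
  then have "exp (- 2 / \<Lambda>) * (exp (2 / \<Lambda>) * Var (P 1 f)) \<le> exp (- 2 / \<Lambda>) * Var f"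
    by (rule mult_left_mono) simp
  moreover have "exp (- 2 / \<Lambda>) * (exp (2 / \<Lambda>) * Var (P 1 f)) = Var (P 1 f)"
    unfolding mult.assoc[symmetric] exp_add[symmetric] by simp
  ultimately show ?thesis by (simp only:)
qed

text \<open>
  Let \<open>N\<close> be the energy and \<open>l\<close> the mean, which is conserved. Log-Sobolev and \<open>entropy_lower_bound\<close> give
  \<open>N' \<le> - (2 / \<Lambda>) N ln (N / l\<^sup>2)\<close>, so that \<open>exp (2 t / \<Lambda>) ln (N / l\<^sup>2)\<close> is nonincreasing.
\<close>
lemma nash:
  assumes g: "\<And>x. x \<in> \<Omega> \<Longrightarrow> 0 \<le> g x" and l: "0 < E g" and t: "0 \<le> t"
  shows "energy g t \<le> energy g 0 * exp (- (1 - exp (- 2 / \<Lambda> * t)) * ln (energy g 0 / (E g)\<^sup>2))"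
proof -
  let ?l = "E g"
  have Nl: "?l\<^sup>2 \<le> energy g r" for r
    using E_jensen_square[of "P r g"] by (simp add: energy_def E_P)
  have l2: "0 < ?l\<^sup>2" using l by simp
  have N: "0 < energy g r" for r using Nl[of r] l2 by linarith
  define h where "h = (\<lambda>r. exp (2 / \<Lambda> * r) * ln (energy g r / ?l\<^sup>2))"
  have "h t \<le> h 0"
  proof (rule DERIV_nonpos_imp_nonincreasing[OF t])
    fix r assume r: "0 \<le> r" "r \<le> t"
    let ?D = "Dir (P r g) (P r g)"
    have 1: "((\<lambda>r. ln (energy g r / ?l\<^sup>2)) has_real_derivative (- 2 * ?D / energy g r)) (at r)"
      by (rule DERIV_cong, rule DERIV_chain2[where f = ln, OF DERIV_ln DERIV_cdivide[OF energy_deriv]])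
         (use N[of r] l2 in \<open>auto simp: field_simps\<close>)
    have 2: "((\<lambda>r. exp (2 / \<Lambda> * r)) has_real_derivative 2 / \<Lambda> * exp (2 / \<Lambda> * r)) (at r)"
      using \<Lambda>_pos by (auto intro!: derivative_eq_intros)
    have "(h has_real_derivative 2 / \<Lambda> * exp (2 / \<Lambda> * r) * ln (energy g r / ?l\<^sup>2) +
        (- 2 * ?D / energy g r) * exp (2 / \<Lambda> * r)) (at r)"
      unfolding h_def by (rule DERIV_mult[OF 2 1])
    moreover have "2 / \<Lambda> * exp (2 / \<Lambda> * r) * ln (energy g r / ?l\<^sup>2) +
        (- 2 * ?D / energy g r) * exp (2 / \<Lambda> * r) \<le> 0"
    proof -
      have "energy g r * ln (energy g r / ?l\<^sup>2) \<le> \<Lambda> * ?D"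
        using entropy_lower_bound[of "P r g"] log_sobolev[of "P r g"] P_nonneg[OF _ r(1) g] l
        by (simp add: energy_def E_P)
      then have "ln (energy g r / ?l\<^sup>2) / \<Lambda> \<le> ?D / energy g r"
        using N[of r] \<Lambda>_ge by (simp add: field_simps)
      then have "2 * exp (2 / \<Lambda> * r) * (ln (energy g r / ?l\<^sup>2) / \<Lambda>) \<le> 2 * exp (2 / \<Lambda> * r) * (?D / energy g r)"
        by (rule mult_left_mono) simp
      then show ?thesis by (simp add: mult_ac)
    qed
    ultimately show "\<exists>d. (h has_real_derivative d) (at r) \<and> d \<le> 0" by blast
  qed
  then have "exp (2 / \<Lambda> * t) * ln (energy g t / ?l\<^sup>2) \<le> ln (energy g 0 / ?l\<^sup>2)" by (simp add: h_def)
  then have "exp (- 2 / \<Lambda> * t) * (exp (2 / \<Lambda> * t) * ln (energy g t / ?l\<^sup>2)) \<le> exp (- 2 / \<Lambda> * t) * ln (energy g 0 / ?l\<^sup>2)"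
    by (rule mult_left_mono) simp
  moreover have "exp (- 2 / \<Lambda> * t) * (exp (2 / \<Lambda> * t) * ln (energy g t / ?l\<^sup>2)) = ln (energy g t / ?l\<^sup>2)"
    unfolding mult.assoc[symmetric] exp_add[symmetric] by simp
  ultimately have "ln (energy g t / ?l\<^sup>2) \<le> exp (- 2 / \<Lambda> * t) * ln (energy g 0 / ?l\<^sup>2)" by (simp only:)
  then have "exp (ln (energy g t / ?l\<^sup>2)) \<le> exp (exp (- 2 / \<Lambda> * t) * ln (energy g 0 / ?l\<^sup>2))"
    by (simp only: exp_le_cancel_iff)
  moreover have "exp (ln (energy g t / ?l\<^sup>2)) = energy g t / ?l\<^sup>2" using N[of t] l2 by simp
  ultimately have "energy g t / ?l\<^sup>2 \<le> exp (exp (- 2 / \<Lambda> * t) * ln (energy g 0 / ?l\<^sup>2))"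
    by (simp only:)
  also have "\<dots> = exp (ln (energy g 0 / ?l\<^sup>2)) * exp (- (1 - exp (- 2 / \<Lambda> * t)) * ln (energy g 0 / ?l\<^sup>2))"
    unfolding exp_add[symmetric] by (simp add: algebra_simps)
  also have "exp (ln (energy g 0 / ?l\<^sup>2)) = energy g 0 / ?l\<^sup>2" using N[of 0] l2 by simp
  finally show ?thesis using l2 by (simp add: divide_le_eq)
qed

end

section \<open>The inequality between first and second moments of influences\<close>

context subcritical_ising begin

lemma energy_decreasing: "0 \<le> t \<Longrightarrow> energy f t \<le> energy f 0"
  using Dir_decreasing[of t f] mult_nonneg_nonneg[of "2 * t" "Dir (P t f) (P t f)", OF _ Dir_nonneg]
  by linarith

lemma energy_abs: "0 \<le> t \<Longrightarrow> energy f t \<le> energy (\<lambda>x. \<bar>f x\<bar>) t"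
  unfolding energy_def by (rule E_mono) (metis P_abs abs_ge_zero power2_abs power_mono)

text \<open>
  By convexity of the exponential, \<open>1 - exp (- 2 t / \<Lambda>)\<close> is at least \<open>t\<close> times its value at \<open>1\<close>.
\<close>
lemma nash_unit_time:
  assumes g: "\<And>x. x \<in> \<Omega> \<Longrightarrow> 0 \<le> g x" and l: "0 < E g" and t: "0 \<le> t" "t \<le> 1"
  shows "energy g t \<le> energy g 0 * exp (- (gap * t * ln (energy g 0 / (E g)\<^sup>2)))"
proof -
  have N: "(E g)\<^sup>2 \<le> energy g 0" using E_jensen_square[of g] by (simp add: energy_zero)
  have l2: "0 < (E g)\<^sup>2" using l by simp
  then have N0: "0 < energy g 0" using N by linarith
  have A: "0 \<le> ln (energy g 0 / (E g)\<^sup>2)" using N l2 by (intro ln_ge_zero) (simp add: le_divide_eq)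
  have "exp (t * (- 2 / \<Lambda>)) \<le> 1 - t + t * exp (- 2 / \<Lambda>)" by (rule exp_convex_01[OF t])
  then have "gap * t \<le> 1 - exp (- 2 / \<Lambda> * t)" by (simp add: gap_def algebra_simps)
  then have "gap * t * ln (energy g 0 / (E g)\<^sup>2) \<le> (1 - exp (- 2 / \<Lambda> * t)) * ln (energy g 0 / (E g)\<^sup>2)"
    by (rule mult_right_mono[OF _ A])
  then have "energy g 0 * exp (- (1 - exp (- 2 / \<Lambda> * t)) * ln (energy g 0 / (E g)\<^sup>2)) \<le>
      energy g 0 * exp (- (gap * t * ln (energy g 0 / (E g)\<^sup>2)))"
    using N0 by (intro mult_left_mono) (simp_all add: algebra_simps)
  then show ?thesis using nash[OF g l t(1)] by linarith
qed

definition infl2 :: "nat \<Rightarrow> ((nat \<Rightarrow> real) \<Rightarrow> real) \<Rightarrow> real" where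
  "infl2 i f = E (\<lambda>x. (\<delta> i f x)\<^sup>2)"

definition infl1 :: "nat \<Rightarrow> ((nat \<Rightarrow> real) \<Rightarrow> real) \<Rightarrow> real" where
  "infl1 i f = E (\<lambda>x. \<bar>\<delta> i f x\<bar>)"

lemma infl2_nonneg: "0 \<le> infl2 i f" unfolding infl2_def by (rule E_nonneg) simp
lemma infl1_nonneg: "0 \<le> infl1 i f" unfolding infl1_def by (rule E_nonneg) simp

lemma infl1_sq_le: "(infl1 i f)\<^sup>2 \<le> infl2 i f"
  using E_jensen_square[of "\<lambda>x. \<bar>\<delta> i f x\<bar>"] by (simp add: infl1_def infl2_def)

lemma infl1_pos: "0 < infl2 i f \<Longrightarrow> 0 < infl1 i f"
proof (rule ccontr)
  assume pos: "0 < infl2 i f" and "\<not> 0 < infl1 i f"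
  then have "infl1 i f = 0" using infl1_nonneg[of i f] by simp
  then have z: "E (\<lambda>x. \<bar>\<delta> i f x\<bar>) = 0" by (simp only: infl1_def)
  have "\<bar>\<delta> i f x\<bar> = 0" if "x \<in> \<Omega>" for x
    by (rule E_eq_0D[of "\<lambda>x. \<bar>\<delta> i f x\<bar>", OF _ z that]) simp
  then have "infl2 i f = E (\<lambda>_. 0)" unfolding infl2_def by (intro E_cong) simp
  then show False using pos by (simp add: E_const)
qed

lemma energy_infl2: "energy (\<lambda>y. \<bar>\<delta> i f y\<bar>) 0 = infl2 i f"
  by (simp add: energy_zero infl2_def)

lemma infl_decay:
  assumes t: "0 \<le> t" "t \<le> 1"
  shows "energy (\<lambda>y. \<bar>\<delta> i f y\<bar>) t \<le> infl2 i f * exp (- (gap * t * ln (infl2 i f / (infl1 i f)\<^sup>2)))"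
proof (cases "infl2 i f = 0")
  case True
  then show ?thesis using energy_decreasing[OF t(1), of "\<lambda>y. \<bar>\<delta> i f y\<bar>"] by (simp add: energy_infl2)
next
  case False
  then have "0 < infl1 i f" using infl2_nonneg[of i f] by (intro infl1_pos) simp
  then show ?thesis
    using nash_unit_time[of "\<lambda>y. \<bar>\<delta> i f y\<bar>", OF _ _ t] by (simp add: energy_infl2 infl1_def)
qed

text \<open>
  For vanishing influences the argument is \<open>0 / 0 = 0\<close> and \<open>ln 0 = 0\<close>.
\<close>
lemma log_ratio_nonneg: "0 \<le> ln (infl2 i f / (infl1 i f)\<^sup>2)"
proof (cases "infl2 i f = 0")
  case False
  then have "0 < infl1 i f" using infl2_nonneg[of i f] by (intro infl1_pos) simp
  then show ?thesis using infl1_sq_le[of i f] by (intro ln_ge_zero) (simp add: le_divide_eq)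
qed simp

lemma variance_drop: "gap * Var f \<le> energy f 0 - energy f 1"
proof -
  have "Var f - Var (P 1 f) = energy f 0 - energy f 1"
    unfolding Var_P Var_def[of f] by (simp add: energy_zero)
  then show ?thesis using variance_decay[of f] by (simp add: gap_def algebra_simps)
qed

definition c_talagrand :: real where "c_talagrand = gap\<^sup>2 / (8 * exp (C + 6 * \<kappa>) * exp 1)"

lemma c_talagrand_pos: "0 < c_talagrand" using gap_bounds by (simp add: c_talagrand_def)

text \<open>
  The variance is at most \<open>1 / gap\<close> times the energy lost up to time \<open>1\<close>, and the dissipation at time \<open>t\<close> is
  controlled by the second moments of \<open>P\<^sub>t \<bar>\<delta>\<^sub>i f\<bar>\<close>. These decay like \<open>exp (- gap A\<^sub>i t)\<close> with \<open>A\<^sub>i\<close> the logarithm of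
  the ratio of moments, and for \<open>t \<le> 1\<close> also like \<open>e\<close> times \<open>exp (- B\<^sub>i t)\<close> with \<open>B\<^sub>i = 1 + gap A\<^sub>i\<close>, whose
  integral is at most \<open>e / B\<^sub>i\<close>, uniformly down to \<open>A\<^sub>i = 0\<close>. Comparison with an explicit antiderivative
  takes the place of integration.
\<close>
lemma talagrand_L1_L2:
  "c_talagrand * Var f \<le> (\<Sum>i\<in>I. if infl2 i f = 0 then 0 else infl2 i f / (1 + ln (sqrt (infl2 i f) / infl1 i f)))"
proof -
  define D where "D = 8 * exp (C + 6 * \<kappa>)"
  define A where "A = (\<lambda>i. ln (infl2 i f / (infl1 i f)\<^sup>2))"
  define B where "B = (\<lambda>i. 1 + gap * A i)"
  have A: "0 \<le> A i" for i unfolding A_def by (rule log_ratio_nonneg)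
  have B: "1 \<le> B i" for i using A[of i] gap_bounds by (simp add: B_def)
  define e where "e = exp (1 :: real)"
  have decay: "energy (\<lambda>y. \<bar>\<delta> i f y\<bar>) t \<le> e * infl2 i f * exp (- B i * t)" if t: "0 \<le> t" "t \<le> 1" for i t
  proof -
    have "exp (- (gap * t * A i)) = exp t * exp (- B i * t)"
      unfolding exp_add[symmetric] by (simp add: B_def algebra_simps)
    also have "\<dots> \<le> e * exp (- B i * t)" using t by (simp add: e_def)
    finally have "infl2 i f * exp (- (gap * t * A i)) \<le> infl2 i f * (e * exp (- B i * t))"
      by (intro mult_left_mono infl2_nonneg)
    moreover have "energy (\<lambda>y. \<bar>\<delta> i f y\<bar>) t \<le> infl2 i f * exp (- (gap * t * A i))"
      using infl_decay[OF t, of i f] by (simp only: A_def)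
    ultimately show ?thesis by (simp add: mult_ac)
  qed
  define H where "H = (\<lambda>t. energy f t - D * (\<Sum>i\<in>I. e * infl2 i f / B i * exp (- B i * t)))"
  have "H 0 \<le> H 1"
  proof (rule DERIV_nonneg_imp_nondecreasing[of 0 1 H])
    fix t :: real assume t: "0 \<le> t" "t \<le> 1"
    have "((\<lambda>t. e * infl2 i f / B i * exp (- B i * t)) has_real_derivative - (e * infl2 i f * exp (- B i * t))) (at t)" for i
      using B[of i] by (auto intro!: derivative_eq_intros)
    then have "(H has_real_derivative - 2 * Dir (P t f) (P t f) - D * (\<Sum>i\<in>I. - (e * infl2 i f * exp (- B i * t)))) (at t)"
      unfolding H_def by (intro DERIV_diff energy_deriv DERIV_cmult DERIV_sum)
    moreover have "2 * Dir (P t f) (P t f) \<le> D * (\<Sum>i\<in>I. e * infl2 i f * exp (- B i * t))"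
    proof -
      have S0: "0 \<le> (\<Sum>j\<in>I. energy (\<lambda>y. \<bar>\<delta> j f y\<bar>) t)"
        unfolding energy_def by (intro sum_nonneg E_nonneg) simp
      have "2 * Dir (P t f) (P t f) \<le> 2 * (exp C * E (\<Gamma> (P t f)))"
        using Dir_le_E_\<Gamma>[of "P t f"] by simp
      also have "\<dots> \<le> 2 * (exp C * (4 * exp (6 * \<kappa> * t) * (\<Sum>j\<in>I. energy (\<lambda>y. \<bar>\<delta> j f y\<bar>) t)))"
        by (intro mult_left_mono gradient_L2 t) auto
      also have "\<dots> \<le> 2 * (exp C * (4 * exp (6 * \<kappa>) * (\<Sum>j\<in>I. energy (\<lambda>y. \<bar>\<delta> j f y\<bar>) t)))"
        using t \<kappa>_pos S0 by (intro mult_left_mono mult_right_mono) auto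
      also have "\<dots> = D * (\<Sum>j\<in>I. energy (\<lambda>y. \<bar>\<delta> j f y\<bar>) t)"
        by (simp add: D_def exp_add)
      also have "\<dots> \<le> D * (\<Sum>i\<in>I. e * infl2 i f * exp (- B i * t))"
        by (intro mult_left_mono sum_mono decay t) (simp add: D_def)
      finally show ?thesis .
    qed
    ultimately show "\<exists>d. (H has_real_derivative d) (at t) \<and> 0 \<le> d"
      by (intro exI conjI) (assumption, simp add: sum_negf)
  qed simp
  then have "energy f 0 - energy f 1 \<le> D * (\<Sum>i\<in>I. e * infl2 i f / B i) - D * (\<Sum>i\<in>I. e * infl2 i f / B i * exp (- B i))"
    by (simp add: H_def)
  also have "\<dots> \<le> D * (\<Sum>i\<in>I. e * infl2 i f / B i)"
  proof -
    have "0 \<le> e * infl2 i f / B i * exp (- B i)" for i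
      using B[of i] infl2_nonneg[of i f] by (simp add: e_def)
    then have "0 \<le> D * (\<Sum>i\<in>I. e * infl2 i f / B i * exp (- B i))"
      by (intro mult_nonneg_nonneg[OF _ sum_nonneg]) (auto simp: D_def)
    then show ?thesis by simp
  qed
  finally have 1: "gap * Var f \<le> D * (\<Sum>i\<in>I. e * infl2 i f / B i)"
    using variance_drop[of f] by linarith
  define T where "T = (\<lambda>i. if infl2 i f = 0 then 0 else infl2 i f / (1 + ln (sqrt (infl2 i f) / infl1 i f)))"
  have 2: "e * infl2 i f / B i \<le> e / gap * T i" for i
  proof (cases "infl2 i f = 0")
    case True
    then show ?thesis by (simp add: T_def)
  next
    case False
    then have i2: "0 < infl2 i f" using infl2_nonneg[of i f] by simp
    then have i1: "0 < infl1 i f" by (rule infl1_pos)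
    define a where "a = ln (sqrt (infl2 i f) / infl1 i f)"
    have "A i = 2 * a"
      using i1 i2 by (simp add: A_def a_def ln_div ln_realpow ln_sqrt)
    then have a: "0 \<le> a" "B i = 1 + 2 * (gap * a)" using A[of i] by (auto simp: B_def)
    have "0 \<le> gap * a" using a(1) gap_bounds by simp
    moreover have "gap * (1 + a) = gap + gap * a" by (simp add: algebra_simps)
    ultimately have "gap * (1 + a) \<le> B i" using a(2) gap_bounds by linarith
    moreover have "0 < gap * (1 + a) * B i" "0 \<le> e * infl2 i f"
      using a(1) gap_bounds i2 B[of i] by (auto simp: e_def intro!: mult_pos_pos)
    ultimately have "e * infl2 i f / B i \<le> e * infl2 i f / (gap * (1 + a))"
      by (intro divide_left_mono) (auto simp: mult.commute)
    then show ?thesis using False by (simp add: T_def a_def)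
  qed
  have "D * (\<Sum>i\<in>I. e * infl2 i f / B i) \<le> D * (\<Sum>i\<in>I. e / gap * T i)"
    by (intro mult_left_mono sum_mono 2) (simp add: D_def)
  then have "gap * Var f \<le> D * (\<Sum>i\<in>I. e / gap * T i)" using 1 by linarith
  also have "\<dots> = D * (e / gap) * (\<Sum>i\<in>I. T i)" by (simp add: sum_distrib_left mult.assoc)
  finally have "gap * (gap * Var f) \<le> gap * (D * (e / gap) * (\<Sum>i\<in>I. T i))"
    using gap_bounds by (intro mult_left_mono) auto
  also have "\<dots> = D * e * (\<Sum>i\<in>I. T i)" using gap_bounds by simp
  finally have "gap * (gap * Var f) / (D * e) \<le> (\<Sum>i\<in>I. T i)"
    by (simp add: D_def e_def divide_le_eq mult.commute)
  then show ?thesis by (simp add: c_talagrand_def D_def e_def T_def power2_eq_square)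
qed

definition c_kkl :: real where "c_kkl = c_talagrand / (2 * (1 + C))"

text \<open>
  A nonzero value of \<open>\<bar>\<delta>\<^sub>i f\<bar>\<close> is \<open>2 q\<^sub>i\<close>, which lies between \<open>exp (- C)\<close> and \<open>exp C\<close>; hence the first moment is at
  most \<open>exp C\<close> times the second one. So each denominator \<open>d\<close> in \<open>talagrand_L1_L2\<close> satisfies \<open>d \<ge> 1\<close> and
  \<open>d \<ge> 1 - C + m / 2\<close> with \<open>m = ln (1 / b)\<close>, and a combination of the two gives \<open>2 (1 + C) d \<ge> m\<close>.
\<close>
lemma kkl:
  assumes f: "f \<in> \<Omega> \<rightarrow> {- 1, 1}" and b: "\<And>i. i \<in> I \<Longrightarrow> infl2 i f \<le> b"
  shows "c_kkl * ln (1 / b) * Var f \<le> (\<Sum>i\<in>I. infl2 i f)"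
proof (cases "0 < ln (1 / b)")
  case False
  then have "c_kkl * ln (1 / b) * Var f \<le> 0"
    using c_talagrand_pos Cpos Var_nonneg[of f] by (intro mult_nonpos_nonneg mult_nonneg_nonpos) (auto simp: c_kkl_def)
  also have "0 \<le> (\<Sum>i\<in>I. infl2 i f)" by (intro sum_nonneg infl2_nonneg)
  finally show ?thesis .
next
  case True
  define m where "m = ln (1 / b)"
  have m: "0 < m" using True by (simp add: m_def)
  have bound: "(if infl2 i f = 0 then 0 else infl2 i f / (1 + ln (sqrt (infl2 i f) / infl1 i f))) \<le> 2 * (1 + C) / m * infl2 i f"
    if i: "i \<in> I" for i
  proof (cases "infl2 i f = 0")
    case False
    then have i2: "0 < infl2 i f" using infl2_nonneg[of i f] by simp
    then have i1: "0 < infl1 i f" by (rule infl1_pos)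
    define d where "d = 1 + ln (sqrt (infl2 i f) / infl1 i f)"
    have "ln (sqrt (infl2 i f) / infl1 i f) = ln (infl2 i f / (infl1 i f)\<^sup>2) / 2"
      using i1 i2 by (simp add: ln_div ln_realpow ln_sqrt)
    then have d1: "1 \<le> d" using log_ratio_nonneg[of i f] by (simp add: d_def)
    have "infl1 i f \<le> exp C * infl2 i f"
      unfolding infl1_def infl2_def E_cmult[symmetric]
    proof (rule E_mono)
      fix x assume x: "x \<in> \<Omega>"
      have "f x \<in> {- 1, 1}" "f (flip i x) \<in> {- 1, 1}" using f x flip_in_cube[OF x i] by auto
      then have "f (flip i x) - f x = 0 \<or> \<bar>f (flip i x) - f x\<bar> = 2" by auto
      then show "\<bar>\<delta> i f x\<bar> \<le> exp C * (\<delta> i f x)\<^sup>2"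
      proof
        assume "\<bar>f (flip i x) - f x\<bar> = 2"
        then have a: "\<bar>\<delta> i f x\<bar> = 2 * q i x" using q_bounds(3)[OF x i] by (simp add: delta_star_def abs_mult)
        have "1 * \<bar>\<delta> i f x\<bar> \<le> (2 * exp C * q i x) * \<bar>\<delta> i f x\<bar>"
          by (intro mult_right_mono q_lower x i) simp
        also have "\<dots> = exp C * (\<bar>\<delta> i f x\<bar> * \<bar>\<delta> i f x\<bar>)" by (simp add: a)
        finally show ?thesis by (simp add: power2_eq_square)
      qed (simp add: delta_star_def)
    qed
    then have "ln (infl1 i f) \<le> ln (exp C * infl2 i f)" using i1 by (intro ln_mono) auto
    also have "\<dots> = C + ln (infl2 i f)" using i2 by (simp add: ln_mult)
    finally have 1: "ln (infl1 i f) \<le> C + ln (infl2 i f)" .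
    have bpos: "0 < b" using b[OF i] i2 by linarith
    have "ln (infl2 i f) \<le> ln b" using b[OF i] i2 by (intro ln_mono) auto
    then have 2: "ln (infl2 i f) \<le> - m" using bpos by (simp add: m_def ln_div)
    have "d = 1 + ln (infl2 i f) / 2 - ln (infl1 i f)"
      using i1 i2 by (simp add: d_def ln_div ln_sqrt)
    then have 3: "1 - C + m / 2 \<le> d" using 1 2 by linarith
    have "C * 1 \<le> C * d" using d1 Cpos by (intro mult_left_mono) auto
    then have "m \<le> 2 * (1 + C) * d" using 3 by (simp add: algebra_simps)
    then have "1 / d \<le> 2 * (1 + C) / m" using m d1 by (simp add: field_simps)
    then have "1 / d * infl2 i f \<le> 2 * (1 + C) / m * infl2 i f" using i2 by (intro mult_right_mono) auto
    then show ?thesis using False by (simp add: d_def)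
  qed simp
  have "c_talagrand * Var f \<le> (\<Sum>i\<in>I. 2 * (1 + C) / m * infl2 i f)"
    by (rule order_trans[OF talagrand_L1_L2 sum_mono[OF bound]])
  also have "\<dots> = 2 * (1 + C) / m * (\<Sum>i\<in>I. infl2 i f)" by (simp add: sum_distrib_left)
  finally have "m / (2 * (1 + C)) * (c_talagrand * Var f) \<le> m / (2 * (1 + C)) * (2 * (1 + C) / m * (\<Sum>i\<in>I. infl2 i f))"
    using m Cpos by (intro mult_left_mono) auto
  also have "\<dots> = (\<Sum>i\<in>I. infl2 i f)" using m Cpos by simp
  finally show ?thesis by (simp add: c_kkl_def m_def mult_ac)
qed

section \<open>Surface area and the decay of variance\<close>

definition surface :: "((nat \<Rightarrow> real) \<Rightarrow> real) \<Rightarrow> real" where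
  "surface f = E (\<lambda>x. sqrt (\<Gamma> f x))"

lemma surface_nonneg: "0 \<le> surface f"
  unfolding surface_def by (rule E_nonneg) (simp add: \<Gamma>_nonneg)

definition drop_const :: real where "drop_const = 16 * exp (C + 4 * \<kappa>)"

lemma drop_const_pos: "0 < drop_const" by (simp add: drop_const_def)

lemma \<gamma>_le:
  assumes t: "0 \<le> t" "t \<le> 1"
  shows "\<gamma> t \<le> 16 * exp (C + 4 * \<kappa>) * t"
proof -
  have "exp (4 * \<kappa> * t) - 1 \<le> 4 * \<kappa> * t * exp (4 * \<kappa> * t)"
    using abs_exp_minus_one[of "4 * \<kappa> * t"] t \<kappa>_pos by simp
  also have "\<dots> \<le> 4 * \<kappa> * t * exp (4 * \<kappa>)"
    using t \<kappa>_pos by (intro mult_left_mono) auto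
  finally have "4 * exp C * (exp (4 * \<kappa> * t) - 1) / \<kappa> \<le> 4 * exp C * (4 * \<kappa> * t * exp (4 * \<kappa>)) / \<kappa>"
    using \<kappa>_pos by (intro divide_right_mono mult_left_mono) auto
  then show ?thesis using \<kappa>_pos by (simp add: \<gamma>_eq exp_add mult_ac)
qed

text \<open>
  For indicators the profile of \<open>f\<close> vanishes, and the local Bobkov inequality reads
  \<open>I(P\<^sub>t f) \<le> sqrt (\<gamma> t) P\<^sub>t (sqrt (\<Gamma> f))\<close>. Since \<open>I(u) \<ge> u (1 - u) / 4\<close> and \<open>E f = E f\<^sup>2\<close>, taking means compares the
  lost energy with the surface area, and \<open>\<gamma> t\<close> is of order \<open>t\<close>.
\<close>
lemma energy_drop_le_surface:
  assumes f: "f \<in> \<Omega> \<rightarrow> {0, 1}" and t: "0 \<le> t" "t \<le> 1"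
  shows "energy f 0 - energy f t \<le> drop_const * sqrt t * surface f"
proof -
  have f01: "f y = 0 \<or> f y = 1" if "y \<in> \<Omega>" for y using f that by auto
  have pw: "P t f x - (P t f x)\<^sup>2 \<le> 4 * sqrt (\<gamma> t) * P t (\<lambda>y. sqrt (\<Gamma> f y)) x" if x: "x \<in> \<Omega>" for x
  proof -
    have u: "0 \<le> P t f x \<and> P t f x \<le> 1" by (rule P_bounds[OF x t(1)]) (use f01 in force)
    have "P t f x * (1 - P t f x) / 4 \<le> gauss_profile (P t f x)"
      using u by (intro gauss_profile_ge_quarter) auto
    also have "\<dots> \<le> P t (\<lambda>y. sqrt ((gauss_profile (f y))\<^sup>2 + \<gamma> t * \<Gamma> f y)) x"
      by (rule local_bobkov[OF _ x t(1)]) (use f01 in force)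
    also have "\<dots> = P t (\<lambda>y. sqrt (\<gamma> t) * sqrt (\<Gamma> f y) + 0 * sqrt (\<Gamma> f y)) x"
      by (rule P_cong[OF x t(1)]) (use f01 in \<open>force simp: gauss_profile_def real_sqrt_mult\<close>)
    also have "\<dots> = sqrt (\<gamma> t) * P t (\<lambda>y. sqrt (\<Gamma> f y)) x"
      unfolding P_linear[OF x t(1)] by simp
    finally show ?thesis by (simp add: power2_eq_square algebra_simps)
  qed
  have "energy f 0 = E f"
    unfolding energy_zero by (rule E_cong) (use f01 in force)
  then have "energy f 0 - energy f t = E (\<lambda>x. P t f x - (P t f x)\<^sup>2)"
    unfolding E_diff E_P by (simp add: energy_def)
  also have "\<dots> \<le> E (\<lambda>x. 4 * sqrt (\<gamma> t) * P t (\<lambda>y. sqrt (\<Gamma> f y)) x)"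
    by (rule E_mono) (rule pw)
  also have "\<dots> = 4 * sqrt (\<gamma> t) * surface f"
    unfolding E_cmult E_P surface_def ..
  also have "\<dots> \<le> 4 * (4 * exp (C + 4 * \<kappa>) * sqrt t) * surface f"
  proof (intro mult_right_mono mult_left_mono surface_nonneg)
    have e1: "1 \<le> exp (C + 4 * \<kappa>)" using Cpos \<kappa>_pos by simp
    have "\<gamma> t \<le> 16 * exp (C + 4 * \<kappa>) * t" by (rule \<gamma>_le[OF t])
    also have "\<dots> \<le> 16 * (exp (C + 4 * \<kappa>) * exp (C + 4 * \<kappa>)) * t"
      using e1 t by (intro mult_right_mono mult_left_mono) auto
    also have "\<dots> = (4 * exp (C + 4 * \<kappa>) * sqrt t)\<^sup>2"
      using t by (simp add: power2_eq_square algebra_simps)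
    finally show "sqrt (\<gamma> t) \<le> 4 * exp (C + 4 * \<kappa>) * sqrt t"
      using t by (intro real_le_lsqrt) auto
  qed simp
  finally show ?thesis by (simp add: drop_const_def mult_ac)
qed

text \<open>
  With \<open>r k\<close> the fraction of the variance that remains at time \<open>2\<^sup>-\<^sup>k\<close>, log-convexity gives \<open>(r (k + 1))\<^sup>2 \<le> r k\<close>,
  hence \<open>r k\<close> to the power \<open>2\<^sup>k\<close> is at most \<open>r 0\<close>.
\<close>
lemma dyadic_decay:
  assumes V: "0 < Var f" and k: "Var (P 1 f) \<le> (1 / 2) ^ (2 ^ k) * Var f"
  shows "Var f / 2 \<le> energy f 0 - energy f (1 / 2 ^ k)"
proof -
  define g where "g = (\<lambda>x. f x - E f)"
  have g0: "energy g 0 = Var f" unfolding energy_zero g_def Var_centered ..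
  define r where "r = (\<lambda>k. energy g (1 / 2 ^ k) / Var f)"
  have r0: "0 \<le> r k" for k unfolding r_def energy_def using V by (intro divide_nonneg_pos E_nonneg) auto
  have step: "(r (Suc k))\<^sup>2 \<le> r k" for k
  proof -
    have "(energy g (1 / 2 ^ k / 2))\<^sup>2 \<le> energy g 0 * energy g (1 / 2 ^ k)" by (rule energy_half) simp
    then have "(energy g (1 / 2 ^ Suc k))\<^sup>2 \<le> Var f * energy g (1 / 2 ^ k)" by (simp add: g0 mult.commute)
    then have "(energy g (1 / 2 ^ Suc k))\<^sup>2 / (Var f)\<^sup>2 \<le> Var f * energy g (1 / 2 ^ k) / (Var f)\<^sup>2"
      by (rule divide_right_mono) simp
    then show ?thesis using V by (simp add: r_def power_divide power2_eq_square)
  qed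
  have "r k ^ (2 ^ k) \<le> r 0" for k
  proof (induction k)
    case (Suc k)
    have "r (Suc k) ^ (2 ^ Suc k) = ((r (Suc k))\<^sup>2) ^ (2 ^ k)" by (simp add: power_mult)
    also have "\<dots> \<le> r k ^ (2 ^ k)" by (intro power_mono step) simp
    finally show ?case using Suc.IH by simp
  qed simp
  moreover have "r 0 \<le> (1 / 2) ^ (2 ^ k)"
    using k V Var_P_centered[of 1 f] by (simp add: r_def g_def divide_le_eq)
  ultimately have "r k ^ (2 ^ k) \<le> (1 / 2) ^ (2 ^ k)" using order_trans by blast
  then have "r k \<le> 1 / 2"
    using power_strict_mono[of "1 / 2" "r k" "2 ^ k"] by (cases "r k \<le> 1 / 2") auto
  then have "energy g (1 / 2 ^ k) \<le> Var f / 2" using V by (simp add: r_def divide_le_eq)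
  moreover have "Var f - energy g (1 / 2 ^ k) = energy f 0 - energy f (1 / 2 ^ k)"
  proof -
    have "energy g (1 / 2 ^ k) = energy f (1 / 2 ^ k) - (E f)\<^sup>2"
      using Var_P_centered[of "1 / 2 ^ k" f] unfolding Var_P g_def by simp
    then show ?thesis by (simp add: Var_def energy_zero)
  qed
  ultimately show ?thesis by linarith
qed

definition c_surface :: real where "c_surface = gap / (4 * drop_const)"

lemma c_surface_pos: "0 < c_surface" using gap_bounds drop_const_pos by (simp add: c_surface_def)

lemma surface_ge_variance:
  assumes f: "f \<in> \<Omega> \<rightarrow> {0, 1}"
  shows "(c_surface * Var f)\<^sup>2 \<le> (surface f)\<^sup>2"
proof (rule power_mono)
  have "gap * Var f \<le> drop_const * surface f"
    using variance_drop[of f] energy_drop_le_surface[OF f, of 1] by simp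
  define z where "z = gap * Var f / drop_const"
  have "z \<le> surface f"
    using \<open>gap * Var f \<le> drop_const * surface f\<close> drop_const_pos by (simp add: z_def divide_le_eq mult.commute)
  moreover have "c_surface * Var f = z / 4" by (simp add: c_surface_def z_def)
  moreover have "0 \<le> z" using gap_bounds drop_const_pos Var_nonneg by (simp add: z_def)
  ultimately show "c_surface * Var f \<le> surface f" by linarith
  show "0 \<le> c_surface * Var f" using c_surface_pos Var_nonneg by simp
qed

text \<open>
  For \<open>X > 1\<close> choose \<open>k\<close> with \<open>2\<^sup>k \<le> X < 2\<^sup>k\<^sup>+\<^sup>1\<close>. Half of the variance is lost at time \<open>2\<^sup>-\<^sup>k\<close>, and the surface
  area is at least this loss divided by a multiple of \<open>sqrt (2\<^sup>-\<^sup>k)\<close>. For smaller \<open>X\<close>, of either sign, the bound by the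
  variance alone is enough. Both bounds are kept as squares so that they can be combined linearly.
\<close>
lemma surface_ge_log_decay:
  assumes f: "f \<in> \<Omega> \<rightarrow> {0, 1}" and V: "0 < Var f" and X: "Var (P 1 f) \<le> exp (- X) * Var f"
  shows "(c_surface * Var f)\<^sup>2 * X \<le> (surface f)\<^sup>2"
proof (cases "X \<le> 1")
  case True
  have "(c_surface * Var f)\<^sup>2 * X \<le> (c_surface * Var f)\<^sup>2 * 1" using True by (rule mult_left_mono) simp
  then show ?thesis using surface_ge_variance[OF f] by simp
next
  case False
  define j where "j = (LEAST j. X < 2 ^ j)"
  have ex: "\<exists>j. X < 2 ^ j" by (rule real_arch_pow) simp
  have j: "X < 2 ^ j" unfolding j_def by (rule LeastI_ex[OF ex])
  have "j \<noteq> 0" using j False by (cases j) auto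
  then obtain k where k: "j = Suc k" by (cases j) auto
  have kX: "2 ^ k \<le> X" using not_less_Least[of k "\<lambda>j. X < 2 ^ j"] k unfolding j_def by simp
  have "exp (- X) \<le> exp (- (2 ^ k))" using kX by simp
  also have "\<dots> = exp (- 1) ^ (2 ^ k)" using exp_of_nat_mult[of "2 ^ k" "- 1 :: real"] by simp
  also have "\<dots> \<le> (1 / 2) ^ (2 ^ k)"
  proof (rule power_mono)
    show "exp (- 1 :: real) \<le> 1 / 2" using exp_ge_add_one_self[of "1 :: real"] by (simp add: exp_minus field_simps)
  qed simp
  finally have "exp (- X) * Var f \<le> (1 / 2) ^ (2 ^ k) * Var f" using V by (intro mult_right_mono) auto
  then have "Var f / 2 \<le> energy f 0 - energy f (1 / 2 ^ k)"
    using X by (intro dyadic_decay V) linarith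
  also have "\<dots> \<le> drop_const * sqrt (1 / 2 ^ k) * surface f"
    by (rule energy_drop_le_surface[OF f]) (auto simp: divide_le_eq)
  finally have "(Var f / 2)\<^sup>2 \<le> (drop_const * sqrt (1 / 2 ^ k) * surface f)\<^sup>2"
    using V by (intro power_mono) auto
  also have "\<dots> = drop_const\<^sup>2 * (surface f)\<^sup>2 / 2 ^ k"
    by (simp add: power_mult_distrib)
  finally have 1: "2 ^ k * (Var f)\<^sup>2 \<le> 4 * drop_const\<^sup>2 * (surface f)\<^sup>2"
    by (simp add: field_simps power2_eq_square)
  have "(Var f)\<^sup>2 * X \<le> (Var f)\<^sup>2 * (2 * 2 ^ k)" using j k by (intro mult_left_mono) auto
  also have "\<dots> = 2 * (2 ^ k * (Var f)\<^sup>2)" by simp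
  also have "\<dots> \<le> 2 * (4 * drop_const\<^sup>2 * (surface f)\<^sup>2)" by (intro mult_left_mono 1) simp
  finally have "(Var f)\<^sup>2 * X \<le> 8 * drop_const\<^sup>2 * (surface f)\<^sup>2" by simp
  define W where "W = (Var f)\<^sup>2 * X / (16 * drop_const\<^sup>2)"
  have 2: "W \<le> (surface f)\<^sup>2 / 2"
    using \<open>(Var f)\<^sup>2 * X \<le> 8 * drop_const\<^sup>2 * (surface f)\<^sup>2\<close> drop_const_pos by (simp add: W_def field_simps)
  have "gap\<^sup>2 \<le> 1" using gap_bounds by (simp add: power_le_one)
  then have "gap\<^sup>2 * W \<le> 1 * W" using False by (intro mult_right_mono) (auto simp: W_def)
  moreover have "(c_surface * Var f)\<^sup>2 * X = gap\<^sup>2 * W"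
    by (simp add: c_surface_def W_def power_mult_distrib power_divide)
  ultimately show ?thesis using 2 zero_le_power2[of "surface f"] by linarith
qed

lemma from_squares:
  assumes K: "1 \<le> K" and Y: "0 \<le> Y" and le: "(c_surface * Var f)\<^sup>2 * Y \<le> K * (surface f)\<^sup>2"
  shows "c_surface / K * Var f * sqrt Y \<le> surface f"
proof (rule power2_le_imp_le[OF _ surface_nonneg])
  have "(c_surface / K * Var f * sqrt Y)\<^sup>2 = (c_surface * Var f)\<^sup>2 * Y / K\<^sup>2"
    using Y by (simp add: power_mult_distrib power_divide)
  also have "\<dots> \<le> K * (surface f)\<^sup>2 / K\<^sup>2" by (intro divide_right_mono le) simp
  also have "\<dots> = (surface f)\<^sup>2 / K" using K by (simp add: power2_eq_square)
  also have "\<dots> \<le> (surface f)\<^sup>2 / 1" using K by (intro divide_left_mono) auto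
  finally show "(c_surface / K * Var f * sqrt Y)\<^sup>2 \<le> (surface f)\<^sup>2" by simp
qed

section \<open>Variance against surface area\<close>

text \<open>
  The function \<open>\<bar>f - E f\<bar>\<close> has mean \<open>2 Var f\<close> and second moment \<open>Var f\<close>.
\<close>
lemma indicator_decay:
  assumes f: "f \<in> \<Omega> \<rightarrow> {0, 1}" and V: "0 < Var f"
  shows "Var (P 1 f) \<le> exp (- (gap * (ln (1 / Var f) - ln 4))) * Var f"
proof -
  have f01: "f y = 0 \<or> f y = 1" if "y \<in> \<Omega>" for y using f that by auto
  define p where "p = E f"
  have p: "0 \<le> p" "p \<le> 1"
    unfolding p_def using E_mono[of f "\<lambda>_. 1"] E_nonneg[of f] f01 by (force simp: E_const)+
  have Vp: "Var f = p * (1 - p)"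
  proof -
    have "E (\<lambda>x. (f x)\<^sup>2) = p" unfolding p_def by (rule E_cong) (use f01 in force)
    then show ?thesis by (simp add: Var_def p_def[symmetric] power2_eq_square algebra_simps)
  qed
  define h where "h = (\<lambda>x. \<bar>f x - p\<bar>)"
  have "E h = E (\<lambda>x. (1 - 2 * p) * f x + p * 1)"
    unfolding h_def by (rule E_cong) (use f01 p in force)
  also have "\<dots> = 2 * Var f" unfolding E_linear E_const Vp p_def[symmetric] by (simp add: algebra_simps)
  finally have Eh: "E h = 2 * Var f" .
  have h0: "energy h 0 = Var f" unfolding energy_zero h_def Var_centered p_def by simp
  have "Var (P 1 f) \<le> energy h 1"
    unfolding h_def p_def using energy_abs[of 1 "\<lambda>x. f x - E f"] by (simp add: Var_P_centered)
  also have "\<dots> \<le> energy h 0 * exp (- (gap * 1 * ln (energy h 0 / (E h)\<^sup>2)))"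
    by (rule nash_unit_time) (use V in \<open>auto simp: h_def Eh[unfolded h_def]\<close>)
  also have "energy h 0 / (E h)\<^sup>2 = (1 / Var f) / 4"
    unfolding h0 Eh using V by (simp add: power2_eq_square)
  also have "ln ((1 / Var f) / 4) = ln (1 / Var f) - ln 4" using V by (subst ln_div) auto
  finally show ?thesis unfolding h0 by (simp add: mult.commute)
qed

definition K_surface :: real where "K_surface = 1 / gap + (1 + ln 4)"

lemma K_surface_ge: "1 \<le> K_surface"
  using gap_bounds by (simp add: K_surface_def add_increasing)

lemma indicator_log_nonneg:
  assumes f: "f \<in> \<Omega> \<rightarrow> {0, 1}" and V: "0 < Var f"
  shows "0 \<le> ln (1 / Var f)"
proof -
  have "E (\<lambda>x. (f x)\<^sup>2) \<le> E (\<lambda>_. 1)" by (rule E_mono) (use f in force)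
  then have "Var f \<le> 1" unfolding Var_def E_const using zero_le_power2[of "E f"] by linarith
  then show ?thesis using V by (intro ln_ge_zero) simp
qed

lemma talagrand_surface:
  assumes f: "f \<in> \<Omega> \<rightarrow> {0, 1}"
  shows "c_surface / K_surface * Var f * sqrt (ln (exp 1 / Var f)) \<le> surface f"
proof (cases "Var f = 0")
  case True
  then show ?thesis by (simp add: surface_nonneg)
next
  case False
  then have V: "0 < Var f" using Var_nonneg[of f] by simp
  define l where "l = ln (1 / Var f)"
  have l: "0 \<le> l" unfolding l_def by (rule indicator_log_nonneg[OF f V])
  have Y: "ln (exp 1 / Var f) = 1 + l" using V by (simp add: l_def ln_div)
  define X where "X = gap * (l - ln 4)"
  have 1: "(c_surface * Var f)\<^sup>2 * X \<le> (surface f)\<^sup>2"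
    unfolding X_def l_def by (rule surface_ge_log_decay[OF f V indicator_decay[OF f V]])
  have "(c_surface * Var f)\<^sup>2 * (1 + l) = 1 / gap * ((c_surface * Var f)\<^sup>2 * X) + (1 + ln 4) * (c_surface * Var f)\<^sup>2"
    using gap_bounds by (simp add: X_def field_simps)
  also have "\<dots> \<le> 1 / gap * (surface f)\<^sup>2 + (1 + ln 4) * (surface f)\<^sup>2"
    using gap_bounds by (intro add_mono mult_left_mono 1 surface_ge_variance f) auto
  also have "\<dots> = K_surface * (surface f)\<^sup>2" by (simp add: K_surface_def algebra_simps)
  finally show ?thesis unfolding Y using l K_surface_ge by (intro from_squares) auto
qed

section \<open>Influences against surface area\<close>

definition half_gap :: real where "half_gap = 1 - exp (- 1 / \<Lambda>)"
definition D_influence :: real where "D_influence = 16 * \<Lambda> * exp (2 * C + 6 * \<kappa>)"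

lemma half_gap_bounds: "0 < half_gap" "half_gap \<le> 1"
  using \<Lambda>_pos by (auto simp: half_gap_def)

lemma D_influence_ge: "1 \<le> D_influence"
proof -
  have "1 * 1 \<le> (16 * \<Lambda>) * exp (2 * C + 6 * \<kappa>)"
    using \<Lambda>_ge Cpos \<kappa>_pos by (intro mult_mono) auto
  then show ?thesis by (simp add: D_influence_def)
qed

definition infl1_sq :: "((nat \<Rightarrow> real) \<Rightarrow> real) \<Rightarrow> real" where
  "infl1_sq f = (\<Sum>i\<in>I. (infl1 i f)\<^sup>2)"

text \<open>
  Start from \<open>u = P\<^sub>1\<^sub>/\<^sub>2 f\<close>: the sum of its second-moment influences is of order \<open>Var f\<close> by dissipation, whatever
  the regularity of \<open>f\<close>, and the sum of its squared first moments is of order \<open>J\<^sup>*(f)\<close>. Over the remaining half unit of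
  time \<open>nash\<close> interpolates between the two for every site. The geometric means are then linearized with a
  common parameter \<open>b\<close>, which makes the sum over the sites explicit.
\<close>
lemma influence_decay:
  assumes V: "0 < Var f" and J: "0 < infl1_sq f"
  shows "Var (P 1 f) \<le> exp (- (half_gap * ln (Var f / infl1_sq f) - ln D_influence)) * Var f"
proof -
  define u where "u = P (1 / 2) f"
  define b where "b = ln (Var f / infl1_sq f)"
  define \<theta> where "\<theta> = exp (- 1 / \<Lambda>)"
  have \<theta>: "0 \<le> \<theta>" "\<theta> \<le> 1" using \<Lambda>_pos by (auto simp: \<theta>_def)
  have eb: "exp b = Var f / infl1_sq f" "exp (- b) = infl1_sq f / Var f"
    using V J by (auto simp: b_def exp_minus)
  have e: "energy (\<lambda>y. \<bar>\<delta> i u y\<bar>) (1 / 2) \<le> exp (\<theta> * b) * ((1 - \<theta>) * (infl1 i u)\<^sup>2 + \<theta> * exp (- b) * infl2 i u)" for i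
  proof (cases "infl2 i u = 0")
    case True
    then have "energy (\<lambda>y. \<bar>\<delta> i u y\<bar>) (1 / 2) \<le> 0"
      using energy_decreasing[of "1 / 2" "\<lambda>y. \<bar>\<delta> i u y\<bar>"] by (simp add: energy_infl2)
    also have "0 \<le> exp (\<theta> * b) * ((1 - \<theta>) * (infl1 i u)\<^sup>2 + \<theta> * exp (- b) * infl2 i u)"
      using \<theta> True by simp
    finally show ?thesis .
  next
    case False
    then have i2: "0 < infl2 i u" using infl2_nonneg[of i u] by simp
    then have i1: "0 < infl1 i u" by (rule infl1_pos)
    define a where "a = ln (infl2 i u / (infl1 i u)\<^sup>2)"
    have ea: "infl2 i u = (infl1 i u)\<^sup>2 * exp a" using i1 i2 by (simp add: a_def)
    have "energy (\<lambda>y. \<bar>\<delta> i u y\<bar>) (1 / 2) \<le> infl2 i u * exp (- (1 - \<theta>) * a)"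
      using nash[of "\<lambda>y. \<bar>\<delta> i u y\<bar>" "1 / 2"] i1 by (simp add: energy_infl2 infl1_def a_def \<theta>_def)
    also have "\<dots> = (infl1 i u)\<^sup>2 * (exp a * exp (- (1 - \<theta>) * a))" by (simp add: ea)
    also have "exp a * exp (- (1 - \<theta>) * a) = exp (\<theta> * b) * exp (\<theta> * (a - b))"
      unfolding exp_add[symmetric] by (simp add: algebra_simps)
    also have "(infl1 i u)\<^sup>2 * (exp (\<theta> * b) * exp (\<theta> * (a - b))) \<le> (infl1 i u)\<^sup>2 * (exp (\<theta> * b) * (1 - \<theta> + \<theta> * exp (a - b)))"
      by (intro mult_left_mono exp_convex_01 \<theta>) auto
    also have "exp (a - b) = exp a * exp (- b)" unfolding exp_add[symmetric] by simp
    also have "(infl1 i u)\<^sup>2 * (exp (\<theta> * b) * (1 - \<theta> + \<theta> * (exp a * exp (- b)))) =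
        exp (\<theta> * b) * ((1 - \<theta>) * (infl1 i u)\<^sup>2 + \<theta> * exp (- b) * infl2 i u)"
      by (simp add: ea algebra_simps)
    finally show ?thesis .
  qed
  have S: "(\<Sum>i\<in>I. (infl1 i u)\<^sup>2) \<le> 4 * exp (3 * \<kappa> + C) * infl1_sq f"
  proof -
    have "(\<Sum>i\<in>I. (infl1 i u)\<^sup>2) \<le> 4 * exp (3 * \<kappa>) * infl1_sq f"
      using gradient_L1[of "1 / 2" f] by (simp add: u_def infl1_def infl1_sq_def)
    also have "\<dots> \<le> 4 * exp (3 * \<kappa> + C) * infl1_sq f"
      using Cpos J by (intro mult_right_mono) auto
    finally show ?thesis .
  qed
  have N: "exp (- b) * (\<Sum>i\<in>I. infl2 i u) \<le> 4 * exp (3 * \<kappa> + C) * infl1_sq f"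
  proof -
    have "(\<Sum>i\<in>I. infl2 i u) \<le> exp C * Dir u u" using E_\<Gamma>_le_Dir[of u] by (simp add: E_\<Gamma> infl2_def)
    also have "Dir u u \<le> Var f"
    proof -
      have "Dir u u \<le> energy f 0 - energy f (1 / 2)" using Dir_decreasing[of "1 / 2" f] by (simp add: u_def)
      also have "\<dots> = Var f - Var (P (1 / 2) f)" unfolding Var_P Var_def[of f] by (simp add: energy_zero)
      finally show ?thesis using Var_nonneg[of "P (1 / 2) f"] by linarith
    qed
    finally have "(\<Sum>i\<in>I. infl2 i u) \<le> exp C * Var f" by simp
    also have "\<dots> \<le> 4 * exp (3 * \<kappa> + C) * Var f"
    proof (rule mult_right_mono)
      have "exp C \<le> exp (3 * \<kappa> + C)" using \<kappa>_pos by simp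
      then show "exp C \<le> 4 * exp (3 * \<kappa> + C)" using exp_ge_zero[of "3 * \<kappa> + C"] by linarith
    qed (use V in simp)
    finally have "exp (- b) * (\<Sum>i\<in>I. infl2 i u) \<le> exp (- b) * (4 * exp (3 * \<kappa> + C) * Var f)"
      by (rule mult_left_mono) simp
    moreover have "exp (- b) * (4 * exp (3 * \<kappa> + C) * Var f) = 4 * exp (3 * \<kappa> + C) * infl1_sq f"
      using V by (simp add: eb(2))
    ultimately show ?thesis by (simp only:)
  qed
  have "(\<Sum>i\<in>I. energy (\<lambda>y. \<bar>\<delta> i u y\<bar>) (1 / 2)) \<le>
      (\<Sum>i\<in>I. exp (\<theta> * b) * ((1 - \<theta>) * (infl1 i u)\<^sup>2 + \<theta> * exp (- b) * infl2 i u))"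
    by (intro sum_mono e)
  also have "\<dots> = exp (\<theta> * b) * ((1 - \<theta>) * (\<Sum>i\<in>I. (infl1 i u)\<^sup>2) + \<theta> * (exp (- b) * (\<Sum>i\<in>I. infl2 i u)))"
    by (simp add: sum_distrib_left[symmetric] sum.distrib mult.assoc)
  also have "\<dots> \<le> exp (\<theta> * b) * ((1 - \<theta>) * (4 * exp (3 * \<kappa> + C) * infl1_sq f) + \<theta> * (4 * exp (3 * \<kappa> + C) * infl1_sq f))"
    using \<theta> by (intro mult_left_mono add_mono S N) auto
  also have "\<dots> = 4 * exp (3 * \<kappa> + C) * (exp (\<theta> * b) * (exp (- b) * Var f))"
    using V by (simp add: eb(2) algebra_simps)
  also have "exp (\<theta> * b) * (exp (- b) * Var f) = exp (- (half_gap * b)) * Var f"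
    unfolding mult.assoc[symmetric] exp_add[symmetric] by (simp add: half_gap_def \<theta>_def algebra_simps)
  finally have en: "(\<Sum>i\<in>I. energy (\<lambda>y. \<bar>\<delta> i u y\<bar>) (1 / 2)) \<le> 4 * exp (3 * \<kappa> + C) * (exp (- (half_gap * b)) * Var f)" .
  have \<Gamma>eq: "E (\<Gamma> (P 1 f)) = E (\<Gamma> (P (1 / 2) u))"
  proof (rule E_cong)
    fix x assume x: "x \<in> \<Omega>"
    have "P 1 f y = P (1 / 2) u y" if "y \<in> \<Omega>" for y
      using P_semigroup[OF that, of "1 / 2" "1 / 2" f] by (simp add: u_def)
    then show "\<Gamma> (P 1 f) x = \<Gamma> (P (1 / 2) u) x"
      unfolding Gamma_star_def delta_star_def using x flip_in_cube[OF x] by (intro sum.cong) auto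
  qed
  have "Var (P 1 f) \<le> \<Lambda> * Dir (P 1 f) (P 1 f)" by (rule poincare)
  also have "\<dots> \<le> \<Lambda> * (exp C * E (\<Gamma> (P 1 f)))"
    using \<Lambda>_pos by (intro mult_left_mono Dir_le_E_\<Gamma>) auto
  also have "\<dots> \<le> \<Lambda> * (exp C * (4 * exp (3 * \<kappa>) * (\<Sum>i\<in>I. energy (\<lambda>y. \<bar>\<delta> i u y\<bar>) (1 / 2))))"
    unfolding \<Gamma>eq using \<Lambda>_pos gradient_L2[of "1 / 2" u] by (intro mult_left_mono) auto
  also have "\<dots> \<le> \<Lambda> * (exp C * (4 * exp (3 * \<kappa>) * (4 * exp (3 * \<kappa> + C) * (exp (- (half_gap * b)) * Var f))))"
    using \<Lambda>_pos by (intro mult_left_mono en) auto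
  also have "\<dots> = 16 * \<Lambda> * (exp C * exp (3 * \<kappa>) * exp (3 * \<kappa> + C)) * (exp (- (half_gap * b)) * Var f)" by simp
  also have "exp C * exp (3 * \<kappa>) * exp (3 * \<kappa> + C) = exp (2 * C + 6 * \<kappa>)"
    unfolding exp_add[symmetric] by (simp add: algebra_simps)
  also have "16 * \<Lambda> * exp (2 * C + 6 * \<kappa>) * (exp (- (half_gap * b)) * Var f) = exp (- (half_gap * b - ln D_influence)) * Var f"
  proof -
    have "exp (- (half_gap * b - ln D_influence)) = exp (ln D_influence) * exp (- (half_gap * b))"
      unfolding exp_add[symmetric] by simp
    also have "exp (ln D_influence) = D_influence" using D_influence_ge by simp
    finally show ?thesis by (simp add: D_influence_def)
  qed
  finally show ?thesis unfolding b_def .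
qed

definition K_influence :: real where "K_influence = 1 / half_gap + 1 / gap + (2 + ln D_influence / half_gap + ln 4)"

lemma K_influence_ge: "1 \<le> K_influence" "2 \<le> K_influence"
proof -
  have "0 \<le> 1 / half_gap" "0 \<le> 1 / gap" "0 \<le> ln D_influence / half_gap" "0 \<le> ln (4 :: real)"
    using half_gap_bounds gap_bounds D_influence_ge by auto
  then show "1 \<le> K_influence" "2 \<le> K_influence" unfolding K_influence_def by linarith+
qed

text \<open>
  Since \<open>ln (1 / J\<^sup>*) = ln (Var f / J\<^sup>*) + ln (1 / Var f)\<close>, the required logarithm is a linear combination of the
  two decay exponents of \<open>influence_decay\<close> and \<open>indicator_decay\<close>, up to a constant. The factor \<open>4\<close> in front
  of \<open>J\<^sup>*\<close> comes from passing to functions with values \<open>- 1\<close> and \<open>1\<close>.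
\<close>
lemma eldan_gross_indicator:
  assumes f: "f \<in> \<Omega> \<rightarrow> {0, 1}"
  shows "c_surface / K_influence * Var f * sqrt (ln (1 + exp 1 / (4 * infl1_sq f))) \<le> surface f"
proof (cases "Var f = 0")
  case True
  then show ?thesis by (simp add: surface_nonneg)
next
  case False
  then have V: "0 < Var f" using Var_nonneg[of f] by simp
  have J0: "0 \<le> infl1_sq f" by (simp add: infl1_sq_def sum_nonneg)
  have J: "0 < infl1_sq f"
  proof (rule ccontr)
    assume "\<not> 0 < infl1_sq f"
    then have "(\<Sum>i\<in>I. (infl1 i f)\<^sup>2) = 0" using J0 by (simp add: infl1_sq_def)
    then have "\<And>i. i \<in> I \<Longrightarrow> infl1 i f = 0" by (subst (asm) sum_nonneg_eq_0_iff) auto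
    then have "\<And>i. i \<in> I \<Longrightarrow> infl2 i f = 0" using infl1_pos infl2_nonneg by (metis less_le)
    then have "E (\<Gamma> f) = 0" by (simp add: E_\<Gamma> infl2_def)
    then have "\<Lambda> * Dir f f \<le> 0" using Dir_le_E_\<Gamma>[of f] \<Lambda>_pos by (simp add: mult_nonneg_nonpos)
    then show False using poincare[of f] V by linarith
  qed
  define Y where "Y = ln (1 + exp 1 / (4 * infl1_sq f))"
  have Y0: "0 \<le> Y" using J by (simp add: Y_def)
  define X1 where "X1 = gap * (ln (1 / Var f) - ln 4)"
  define X2 where "X2 = half_gap * ln (Var f / infl1_sq f) - ln D_influence"
  let ?v = "(c_surface * Var f)\<^sup>2"
  have 0: "?v \<le> (surface f)\<^sup>2" by (rule surface_ge_variance[OF f])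
  have 1: "?v * X1 \<le> (surface f)\<^sup>2"
    unfolding X1_def by (rule surface_ge_log_decay[OF f V indicator_decay[OF f V]])
  have 2: "?v * X2 \<le> (surface f)\<^sup>2"
    unfolding X2_def by (rule surface_ge_log_decay[OF f V influence_decay[OF V J]])
  have ln2: "ln (1 + exp 1) \<le> (2 :: real)"
  proof -
    have "1 + exp 1 \<le> exp 1 * exp (1 :: real)"
    proof -
      have "2 * exp 1 \<le> exp 1 * exp (1 :: real)" using exp_ge_add_one_self[of "1 :: real"] by (intro mult_right_mono) auto
      then show ?thesis using exp_ge_add_one_self[of "1 :: real"] by linarith
    qed
    also have "\<dots> = exp 2" unfolding exp_add[symmetric] by simp
    finally have "ln (1 + exp 1) \<le> ln (exp (2 :: real))" by (intro ln_mono) (auto intro: add_pos_pos)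
    then show ?thesis by simp
  qed
  have "?v * Y \<le> K_influence * (surface f)\<^sup>2"
  proof (cases "infl1_sq f < 1")
    case True
    have e0: "0 < 1 + exp (1 :: real)" by (simp add: add_pos_pos)
    have "1 + exp 1 / (4 * infl1_sq f) \<le> (1 + exp 1) / infl1_sq f"
      unfolding add_divide_distrib
    proof (rule add_mono)
      show "1 \<le> 1 / infl1_sq f" using J True by (simp add: le_divide_eq)
      show "exp 1 / (4 * infl1_sq f) \<le> exp 1 / infl1_sq f" using J by (intro divide_left_mono) auto
    qed
    then have "Y \<le> ln ((1 + exp 1) / infl1_sq f)"
      unfolding Y_def using J by (intro ln_mono) (auto intro!: add_pos_pos)
    also have "\<dots> = ln (1 + exp 1) + ln (1 / infl1_sq f)"
      using J e0 by (subst (1 2) ln_div) auto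
    also have "\<dots> \<le> 2 + ln (1 / infl1_sq f)" using ln2 by simp
    also have "ln (1 / infl1_sq f) = X2 / half_gap + ln D_influence / half_gap + (X1 / gap + ln 4)"
      using J V gap_bounds half_gap_bounds by (simp add: X1_def X2_def ln_div diff_divide_distrib)
    finally have "Y \<le> 1 / half_gap * X2 + 1 / gap * X1 + (2 + ln D_influence / half_gap + ln 4)" by simp
    then have "?v * Y \<le> ?v * (1 / half_gap * X2 + 1 / gap * X1 + (2 + ln D_influence / half_gap + ln 4))"
      by (rule mult_left_mono) simp
    also have "\<dots> = 1 / half_gap * (?v * X2) + 1 / gap * (?v * X1) + (2 + ln D_influence / half_gap + ln 4) * ?v"
      by (simp add: algebra_simps)
    also have "\<dots> \<le> 1 / half_gap * (surface f)\<^sup>2 + 1 / gap * (surface f)\<^sup>2 + (2 + ln D_influence / half_gap + ln 4) * (surface f)\<^sup>2"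
      using gap_bounds half_gap_bounds D_influence_ge
      by (intro add_mono mult_left_mono 0 1 2) (auto intro!: add_nonneg_nonneg)
    also have "\<dots> = K_influence * (surface f)\<^sup>2" by (simp add: K_influence_def algebra_simps)
    finally show ?thesis .
  next
    case False
    have "Y \<le> ln (1 + exp 1)"
      unfolding Y_def
    proof (rule ln_mono)
      have "exp 1 / (4 * infl1_sq f) \<le> exp 1 / 1" using False by (intro divide_left_mono) auto
      then show "1 + exp 1 / (4 * infl1_sq f) \<le> 1 + exp 1" by simp
    qed (use J in \<open>auto intro: add_pos_pos\<close>)
    then have "Y \<le> 2" using ln2 by linarith
    then have "?v * Y \<le> ?v * 2" by (rule mult_left_mono) simp
    also have "\<dots> \<le> (surface f)\<^sup>2 * K_influence" using 0 K_influence_ge by (intro mult_mono) auto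
    finally show ?thesis by (simp add: mult.commute)
  qed
  then show ?thesis unfolding Y_def[symmetric] by (rule from_squares[OF K_influence_ge(1) Y0])
qed

lemma eldan_gross:
  assumes f: "f \<in> \<Omega> \<rightarrow> {- 1, 1}"
  shows "c_surface / (2 * K_influence) * Var f * sqrt (ln (1 + exp 1 / infl1_sq f)) \<le> surface f"
proof -
  define g where "g = (\<lambda>x. (f x + 1) / 2)"
  have fg: "f = (\<lambda>x. 2 * g x + (- 1))" by (rule ext) (simp add: g_def add_divide_distrib)
  have d: "\<delta> i f x = 2 * \<delta> i g x" for i x by (simp add: delta_star_def fg algebra_simps)
  have "g \<in> \<Omega> \<rightarrow> {0, 1}" using f by (force simp: g_def)
  then have main: "c_surface / K_influence * Var g * sqrt (ln (1 + exp 1 / (4 * infl1_sq g))) \<le> surface g"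
    by (rule eldan_gross_indicator)
  have s: "surface f = 2 * surface g"
    unfolding surface_def E_cmult[symmetric] Gamma_star_def d
    by (simp add: power_mult_distrib sum_distrib_left[symmetric] real_sqrt_mult)
  have j: "infl1_sq f = 4 * infl1_sq g"
    unfolding infl1_sq_def infl1_def d by (simp add: abs_mult E_cmult power_mult_distrib sum_distrib_left)
  have Ef: "E f = 2 * E g + (- 1)"
    using E_linear[of 2 g 1 "\<lambda>_. - 1"] by (simp add: fg E_const)
  have "Var f = E (\<lambda>x. 4 * (g x - E g)\<^sup>2)"
    unfolding Var_centered Ef by (rule E_cong) (simp add: fg power2_eq_square algebra_simps)
  then have v: "Var f = 4 * Var g" unfolding E_cmult Var_centered[symmetric] .
  have "c_surface / (2 * K_influence) * (4 * Var g) * r = 2 * (c_surface / K_influence * Var g * r)" for r by simp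
  then show ?thesis unfolding s j v using main by simp
qed

section \<open>Common constants\<close>

definition c_all :: real where
  "c_all = Min {c_talagrand, c_kkl, c_surface / K_surface, c_surface / (2 * K_influence)}"

lemma c_all: "0 < c_all" "c_all \<le> c_talagrand" "c_all \<le> c_kkl" "c_all \<le> c_surface / K_surface" "c_all \<le> c_surface / (2 * K_influence)"
  using c_talagrand_pos c_surface_pos K_surface_ge K_influence_ge Cpos by (auto simp: c_all_def c_kkl_def)

lemma b_const_bounds: "0 < b_const" "b_const \<le> 1"
proof -
  have "exp (- C) \<le> 1" using Cpos by simp
  then have "exp (- C) / 4 \<le> 1" by linarith
  then show "0 < b_const" "b_const \<le> 1" by (simp_all only: b_const_def) simp
qed

lemma star_eqs:
  "I_star n J i f = infl2 i f" "L1_influence n J i f = infl1 i f"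
  "total_I_star n J f = (\<Sum>i\<in>I. infl2 i f)" "A_star n J f = surface f" "J_star n J f = infl1_sq f"
  by (simp_all add: I_star_def L1_influence_def total_I_star_def A_star_def J_star_def expectation_eq
      infl1_def infl2_def infl1_sq_def surface_def)

end

theorem theorem6p11:
  fixes s C :: real
  assumes "s < 1" and "C > 0"
  shows "\<exists>c b \<rho> :: real. c > 0 \<and> 0 < b \<and> b \<le> 1 \<and>
    (\<forall>(n::nat) (J :: nat \<Rightarrow> nat \<Rightarrow> real).
       n \<ge> 1 \<longrightarrow> symmetric_mat n J \<longrightarrow>
       spectral_norm n (\<lambda>i j. \<bar>J i j\<bar>) = s \<longrightarrow> max_col_sum_norm n J \<le> C \<longrightarrow>
       (\<forall>f t. f \<in> cube n \<rightarrow> {0..1} \<longrightarrow> t \<ge> 0 \<longrightarrow>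
          (\<forall>x\<in>cube n. gauss_profile (semigroup_P n J t f x) \<le>
             semigroup_P n J t
               (\<lambda>y. sqrt ((gauss_profile (f y))\<^sup>2 + bobkov_gamma b \<rho> t * Gamma_star n J f y)) x)) \<and>
       (\<forall>f. f \<in> cube n \<rightarrow> {0, 1} \<longrightarrow>
          A_star n J f \<ge> c * Var_ising n J f * sqrt (ln (exp 1 / Var_ising n J f))) \<and>
       (\<forall>f. c * Var_ising n J f \<le>
          (\<Sum>i\<in>{1..n}. if I_star n J i f = 0 then 0
             else I_star n J i f / (1 + ln (sqrt (I_star n J i f) / L1_influence n J i f)))) \<and>
       (\<forall>f. f \<in> cube n \<rightarrow> {-1, 1} \<longrightarrow>
          total_I_star n J f \<ge> c * ln (1 / M_star n J f) * Var_ising n J f) \<and>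
       (\<forall>f. f \<in> cube n \<rightarrow> {-1, 1} \<longrightarrow>
          A_star n J f \<ge> c * Var_ising n J f * sqrt (ln (1 + exp 1 / J_star n J f))))"
proof -
  \<comment> \<open>The bound \<open>s'\<close> is nonnegative also for values of \<open>s\<close> that no spectral norm attains.\<close>
  define s' where "s' = max s 0"
  \<comment> \<open>The positivity of the constants is known inside the locale, for which one instance is
    needed: a single spin without interaction. They depend on \<open>C\<close> and \<open>s'\<close> only.\<close>
  have free: "subcritical_ising 1 (\<lambda>_ _. 0) C s'"
  proof
    show "symmetric_mat 1 (\<lambda>_ _. 0)" by (simp add: symmetric_mat_def)
    show "max_col_sum_norm 1 (\<lambda>_ _. 0) \<le> C" using assms by (simp add: max_col_sum_norm_def)
    have "L2_set (\<lambda>_. 1) {1..1 :: nat} = 1" by (simp add: L2_set_def)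
    then have "{v. L2_set v {1..1 :: nat} = 1} \<noteq> {}" by blast
    then show "spectral_norm 1 (\<lambda>i j. \<bar>(\<lambda>_ _. 0) i j\<bar>) \<le> s'"
      unfolding spectral_norm_def by (intro cSUP_least) (auto simp: s'_def L2_set_def)
  qed (use assms in \<open>auto simp: s'_def\<close>)
  define c where "c = subcritical_ising.c_all C s'"
  define b where "b = ising_model.b_const C"
  define \<rho> where "\<rho> = ising_model.\<rho>_const C"
  show ?thesis
  proof (rule exI[of _ c], rule exI[of _ b], rule exI[of _ \<rho>], intro conjI allI impI ballI)
    show "0 < c" "0 < b" "b \<le> 1"
      unfolding c_def b_def
      using subcritical_ising.c_all(1)[OF free] subcritical_ising.b_const_bounds[OF free] by blast+
  next
    fix n :: nat and J :: "nat \<Rightarrow> nat \<Rightarrow> real"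
    assume n: "n \<ge> 1" and J: "symmetric_mat n J" "spectral_norm n (\<lambda>i j. \<bar>J i j\<bar>) = s" "max_col_sum_norm n J \<le> C"
    interpret subcritical_ising n J C s'
      by unfold_locales (use J assms in \<open>auto simp: s'_def\<close>)
    have c: "0 < c" "c \<le> c_talagrand" "c \<le> c_kkl" "c \<le> c_surface / K_surface" "c \<le> c_surface / (2 * K_influence)"
      unfolding c_def using c_all by auto
    note eqs = star_eqs Var_ising_eq
    {
      fix f :: "(nat \<Rightarrow> real) \<Rightarrow> real" and t :: real and x assume "f \<in> cube n \<rightarrow> {0..1}" "0 \<le> t" "x \<in> cube n"
      then show "gauss_profile (semigroup_P n J t f x) \<le> semigroup_P n J t
               (\<lambda>y. sqrt ((gauss_profile (f y))\<^sup>2 + bobkov_gamma b \<rho> t * Gamma_star n J f y)) x"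
        unfolding b_def \<rho>_def by (intro local_bobkov)
    next
      fix f :: "(nat \<Rightarrow> real) \<Rightarrow> real" assume f: "f \<in> cube n \<rightarrow> {0, 1}"
      have "c * Var f * sqrt (ln (exp 1 / Var f)) \<le> c_surface / K_surface * Var f * sqrt (ln (exp 1 / Var f))"
      proof (cases "Var f = 0")
        case False
        then have V: "0 < Var f" using Var_nonneg[of f] by simp
        have "ln (exp 1 / Var f) = 1 + ln (1 / Var f)" using V by (simp add: ln_div)
        then have "0 \<le> ln (exp 1 / Var f)" using indicator_log_nonneg[OF f V] by linarith
        then show ?thesis by (intro mult_right_mono c Var_nonneg real_sqrt_ge_zero)
      qed simp
      then show "A_star n J f \<ge> c * Var_ising n J f * sqrt (ln (exp 1 / Var_ising n J f))"
        unfolding eqs using talagrand_surface[OF f] by linarith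
    next
      fix f
      have "c * Var f \<le> c_talagrand * Var f" by (intro mult_right_mono c Var_nonneg)
      then show "c * Var_ising n J f \<le> (\<Sum>i\<in>{1..n}. if I_star n J i f = 0 then 0
             else I_star n J i f / (1 + ln (sqrt (I_star n J i f) / L1_influence n J i f)))"
        unfolding eqs using talagrand_L1_L2[of f] by linarith
    next
      fix f :: "(nat \<Rightarrow> real) \<Rightarrow> real" assume f: "f \<in> cube n \<rightarrow> {- 1, 1}"
      let ?m = "ln (1 / M_star n J f)"
      have M: "infl2 i f \<le> M_star n J f" if "i \<in> {1..n}" for i
        unfolding M_star_def eqs using that by (intro Max_ge) auto
      show "total_I_star n J f \<ge> c * ln (1 / M_star n J f) * Var_ising n J f"
      proof (cases "0 \<le> ?m")
        case True
        then have "c * ?m * Var f \<le> c_kkl * ?m * Var f" by (intro mult_right_mono c Var_nonneg)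
        then show ?thesis unfolding eqs using kkl[OF f M] by linarith
      next
        case False
        then have "c * ?m * Var f \<le> 0" using c(1) Var_nonneg[of f]
          by (intro mult_nonpos_nonneg mult_nonneg_nonpos) auto
        also have "0 \<le> (\<Sum>i\<in>{1..n}. infl2 i f)" by (intro sum_nonneg infl2_nonneg)
        finally show ?thesis unfolding eqs .
      qed
    next
      fix f :: "(nat \<Rightarrow> real) \<Rightarrow> real" assume f: "f \<in> cube n \<rightarrow> {- 1, 1}"
      have "0 \<le> infl1_sq f" by (simp add: infl1_sq_def sum_nonneg)
      then have "c * Var f * sqrt (ln (1 + exp 1 / infl1_sq f)) \<le> c_surface / (2 * K_influence) * Var f * sqrt (ln (1 + exp 1 / infl1_sq f))"
        by (intro mult_right_mono c Var_nonneg real_sqrt_ge_zero ln_ge_zero) auto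
      then show "A_star n J f \<ge> c * Var_ising n J f * sqrt (ln (1 + exp 1 / J_star n J f))"
        unfolding eqs using eldan_gross[OF f] by linarith
    }
  qed
qed

end
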